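(* Let $d\ge3$ and $2\le m\le d-1$, and let $G=G^{(d,m)}$ be the spinal Hanoi towers group of type $(d,m)$. Then $G$ is just infinite if and only if $d\geq 4$. Furthermore: (i) If $m$ is even and $d\geq 4$, then $$\psi(\mathrm{St}_G(1))=\left\{(g_1,\ldots,g_d)\in G\times\cdots\times G\ \middle|\ \sum_{j=1}^d\sum_{i=1}^d e_i(g_j)\equiv 0\pmod 2\right\}.$$ (ii) If $m$ is odd and $d\geq 5$, then $\psi(\mathrm{St}_G(1))=G\times\cdots\times G$ ($d$ factors), equivalently $\psi(G)=(G\times\cdots\times G)\rtimes\mathrm{Alt}(d)$. (iii) If $(d,m)=(4,3)$, then $$\psi(\mathrm{St}_G(1))=\left\{(g_1,g_2,g_3,g_4)\in G\times G\times G\times G\ \middle|\ \sum_{j=1}^{4}\sum_{i=1}^{4}(-1)^{i-1}e_i(g_j)\equiv 0\pmod 3\right\}.$$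
   Context: $\mathcal T_d$ is the $d$-regular rooted tree whose vertices are the finite words over $X=\{1,\dots,d\}$. Automorphisms and permutations act on the right and products are read from left to right. For $g\in\mathrm{Aut}(\mathcal T_d)$ and a vertex $v$, the section $g|_v$ is defined by $(vw)^g=v^g\,w^{g|_v}$. We write $\psi(g)=(g|_1,\dots,g|_d)\tau$, where $\tau\in\mathrm{Sym}(d)$ is the action of $g$ on the first level. $\mathrm{St}_G(1)$ is the subgroup of elements of $G$ fixing every vertex of the first level. $G^{(d,m)}=\langle a_1,\dots,a_d\rangle\le\mathrm{Aut}(\mathcal T_d)$, where $\psi(a_i)=(1,\dots,1,a_i,1,\dots,1)\sigma_i$ (with $a_i$ in the $i$-th coordinate) and $\sigma_i$ is the $m$-cycle $(i+1\ \ i+2\ \cdots\ i+m)$, indices taken modulo $d$. Each $a_i$ has order $m$. For $g\in G$, $e_i(g)\in\mathbb Z/o(a_i)\mathbb Z=\mathbb Z/m\mathbb Z$ is the total exponent, modulo $o(a_i)$, of $a_i$ in any word in the generators representing $g$ (this is well defined). A group is just infinite if it is infinite and all its proper quotients are finite. *)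

theory Defs
  imports "HOL-Algebra.Algebra" "HOL-Number_Theory.Cong"
begin

section \<open>The regular rooted tree and its automorphism group\<close>

abbreviation vertices :: "nat \<Rightarrow> nat list set"
  where "vertices d \<equiv> lists {1..d}"

definition tree_edge :: "nat \<Rightarrow> nat list \<Rightarrow> nat list \<Rightarrow> bool"
  where "tree_edge d u v \<longleftrightarrow>
    u \<in> vertices d \<and> v \<in> vertices d \<and> (\<exists>x. v = u @ [x] \<or> u = v @ [x])"

(* Following the library's symmetric groups, an automorphism is a total function that is the
   identity off the vertex set.  Automorphisms act on the right, so the product of f and g is
   "first f, then g". *)
definition tree_aut :: "nat \<Rightarrow> (nat list \<Rightarrow> nat list) monoid"
  where "tree_aut d = \<lparr>
    carrier = {f. f permutes vertices d \<and> f [] = [] \<and>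
                  (\<forall>u v. tree_edge d (f u) (f v) \<longleftrightarrow> tree_edge d u v)},
    monoid.mult = (\<lambda>f g. g \<circ> f),
    one = id \<rparr>"

(* Solves (v @ w)^g = v^g @ w^(g|_v) for the last factor. *)
definition tree_section :: "(nat list \<Rightarrow> nat list) \<Rightarrow> nat list \<Rightarrow> nat list \<Rightarrow> nat list"
  where "tree_section g v = (\<lambda>w. drop (length (g v)) (g (v @ w)))"

definition root_perm :: "(nat list \<Rightarrow> nat list) \<Rightarrow> nat \<Rightarrow> nat"
  where "root_perm g = (\<lambda>x. hd (g [x]))"

(* The pair (f, \<tau>) stands for (f 1, ..., f d) \<tau>.  The permutations act on the right, so
   moving \<tau> past a tuple permutes the coordinates of the latter. *)
definition perm_semidirect ::
    "nat \<Rightarrow> ('a, 'b) monoid_scheme \<Rightarrow> (nat \<Rightarrow> nat) monoid \<Rightarrow> ((nat \<Rightarrow> 'a) \<times> (nat \<Rightarrow> nat)) monoid"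
  where "perm_semidirect d H P = \<lparr>
    carrier = (\<Pi>\<^sub>E x\<in>{1..d}. carrier H) \<times> carrier P,
    monoid.mult = (\<lambda>(f, \<sigma>) (g, \<tau>). (\<lambda>x\<in>{1..d}. f x \<otimes>\<^bsub>H\<^esub> g (\<sigma> x), \<tau> \<circ> \<sigma>)),
    one = (\<lambda>x\<in>{1..d}. \<one>\<^bsub>H\<^esub>, id) \<rparr>"

definition psi :: "nat \<Rightarrow> (nat list \<Rightarrow> nat list) \<Rightarrow> (nat \<Rightarrow> nat list \<Rightarrow> nat list) \<times> (nat \<Rightarrow> nat)"
  where "psi d g = (\<lambda>x\<in>{1..d}. tree_section g [x], root_perm g)"

definition level_one_stabilizer ::
    "nat \<Rightarrow> (nat list \<Rightarrow> nat list, 'b) monoid_scheme \<Rightarrow> (nat list \<Rightarrow> nat list) set"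
  where "level_one_stabilizer d G = {g \<in> carrier G. \<forall>x\<in>{1..d}. g [x] = [x]}"


section \<open>The spinal Hanoi towers group\<close>

(* The cycle (i+1 i+2 ... i+m), with entries reduced modulo d to representatives in {1..d}. *)
definition hanoi_cycle :: "nat \<Rightarrow> nat \<Rightarrow> nat \<Rightarrow> nat \<Rightarrow> nat"
  where "hanoi_cycle d m i = cycle_of_list (map (\<lambda>k. (i + k - 1) mod d + 1) [1..<Suc m])"

primrec hanoi_act :: "nat \<Rightarrow> nat \<Rightarrow> nat \<Rightarrow> nat list \<Rightarrow> nat list"
  where
    "hanoi_act d m i [] = []"
  | "hanoi_act d m i (x # w) = hanoi_cycle d m i x # (if x = i then hanoi_act d m i w else w)"

definition hanoi_gen :: "nat \<Rightarrow> nat \<Rightarrow> nat \<Rightarrow> nat list \<Rightarrow> nat list"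
  where "hanoi_gen d m i = restrict_id (hanoi_act d m i) (vertices d)"

definition hanoi_group :: "nat \<Rightarrow> nat \<Rightarrow> (nat list \<Rightarrow> nat list) monoid"
  where "hanoi_group d m =
    (tree_aut d)\<lparr>carrier := generate (tree_aut d) (hanoi_gen d m ` {1..d})\<rparr>"


section \<open>Exponents\<close>

(* The word [(i1, k1), ..., (ir, kr)] stands for a_i1 ^ k1 ... a_ir ^ kr. *)
definition gen_words :: "nat \<Rightarrow> (nat \<times> int) list set"
  where "gen_words d = lists ({1..d} \<times> UNIV)"

primrec word_value :: "nat \<Rightarrow> nat \<Rightarrow> (nat \<times> int) list \<Rightarrow> nat list \<Rightarrow> nat list"
  where
    "word_value d m [] = \<one>\<^bsub>tree_aut d\<^esub>"
  | "word_value d m (p # ws) =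
       (hanoi_gen d m (fst p) [^]\<^bsub>tree_aut d\<^esub> snd p) \<otimes>\<^bsub>tree_aut d\<^esub> word_value d m ws"

definition word_exponent :: "nat \<Rightarrow> (nat \<times> int) list \<Rightarrow> int"
  where "word_exponent i ws = (\<Sum>(j, k)\<leftarrow>ws. if j = i then k else 0)"

(* An element of Z/mZ is given by its representative in {0..<m}; m is the order of a_i. *)
definition gen_exponent :: "nat \<Rightarrow> nat \<Rightarrow> nat \<Rightarrow> (nat list \<Rightarrow> nat list) \<Rightarrow> int"
  where "gen_exponent d m i g =
    (THE r. \<exists>ws\<in>gen_words d. word_value d m ws = g \<and> r = word_exponent i ws mod int m)"


section \<open>Just infinite groups\<close>

definition just_infinite :: "('a, 'b) monoid_scheme \<Rightarrow> bool"
  where "just_infinite G \<longleftrightarrow> group G \<and> infinite (carrier G) \<and>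
    (\<forall>N. N \<lhd> G \<longrightarrow> N \<noteq> {\<one>\<^bsub>G\<^esub>} \<longrightarrow> finite (carrier (G Mod N)))"


section \<open>Basic properties\<close>

lemma tree_aut_group: "group (tree_aut d)"
proof (rule groupI)
  fix f assume f: "f \<in> carrier (tree_aut d)"
  then have p: "f permutes vertices d" and r: "f [] = []"
    and e: "\<And>u v. tree_edge d (f u) (f v) \<longleftrightarrow> tree_edge d u v"
    by (auto simp: tree_aut_def)
  have "tree_edge d (inv' f u) (inv' f v) \<longleftrightarrow> tree_edge d u v" for u v
    using e[of "inv' f u" "inv' f v"] permutes_inverses(1)[OF p] by simp
  moreover have "inv' f [] = []"
    using permutes_inverses(2)[OF p, of "[]"] r by simp
  ultimately have "inv' f \<in> carrier (tree_aut d)"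
    using permutes_inv[OF p] by (simp add: tree_aut_def)
  moreover have "inv' f \<otimes>\<^bsub>tree_aut d\<^esub> f = \<one>\<^bsub>tree_aut d\<^esub>"
    using permutes_inv_o(1)[OF p] by (simp add: tree_aut_def)
  ultimately show "\<exists>g\<in>carrier (tree_aut d). g \<otimes>\<^bsub>tree_aut d\<^esub> f = \<one>\<^bsub>tree_aut d\<^esub>"
    by blast
qed (auto simp: tree_aut_def permutes_compose permutes_id o_assoc)

lemma hanoi_cycle_permutes:
  assumes "d \<ge> 1"
  shows "hanoi_cycle d m i permutes {1..d}"
proof -
  have "set (map (\<lambda>k. (i + k - 1) mod d + 1) [1..<Suc m]) \<subseteq> {1..d}"
    using assms by (auto simp: Suc_le_eq)
  then show ?thesis
    unfolding hanoi_cycle_def by (rule permutes_subset[OF cycle_permutes])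
qed

lemma hanoi_act_length [simp]: "length (hanoi_act d m i w) = length w"
  by (induction w) auto

lemma hanoi_act_vertices:
  assumes "d \<ge> 1" "w \<in> vertices d"
  shows "hanoi_act d m i w \<in> vertices d"
  using assms(2) permutes_in_image[OF hanoi_cycle_permutes[OF assms(1), of m i]]
  by (induction w) auto

lemma hanoi_act_inj:
  assumes "d \<ge> 1" "hanoi_act d m i u = hanoi_act d m i v"
  shows "u = v"
  using assms(2)
proof (induction u arbitrary: v)
  case Nil
  then show ?case by (cases v) auto
next
  case (Cons x u)
  then show ?case
    using permutes_inj[OF hanoi_cycle_permutes[OF assms(1), of m i]]
    by (cases v) (auto dest: injD split: if_splits)
qed

lemma hanoi_act_surj:
  assumes "d \<ge> 1" "w \<in> vertices d"
  shows "\<exists>v\<in>vertices d. hanoi_act d m i v = w"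
  using assms(2)
proof (induction w)
  case Nil
  show ?case by (intro bexI[of _ "[]"]) auto
next
  case (Cons y w)
  note p = hanoi_cycle_permutes[OF assms(1), of m i]
  obtain x where x: "hanoi_cycle d m i x = y" "x \<in> {1..d}"
    using Cons.hyps(1) permutes_image[OF p] by (metis imageE)
  obtain v where v: "v \<in> vertices d" "hanoi_act d m i v = w"
    using Cons.IH by blast
  show ?case
  proof (intro bexI)
    show "hanoi_act d m i (x # (if x = i then v else w)) = y # w"
      using x v by auto
    show "x # (if x = i then v else w) \<in> vertices d"
      using x v Cons.hyps by auto
  qed
qed

lemma hanoi_act_snoc: "\<exists>y. hanoi_act d m i (w @ [x]) = hanoi_act d m i w @ [y]"
  by (induction w) auto

lemma hanoi_gen_in_tree_aut:
  assumes "d \<ge> 1"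
  shows "hanoi_gen d m i \<in> carrier (tree_aut d)"
proof -
  let ?a = "hanoi_act d m i" and ?g = "hanoi_gen d m i"
  have g: "w \<in> vertices d \<Longrightarrow> ?g w = ?a w" "w \<notin> vertices d \<Longrightarrow> ?g w = w" for w
    by (simp_all add: hanoi_gen_def restrict_id_def)
  have bij: "bij_betw ?a (vertices d) (vertices d)"
    unfolding bij_betw_def
  proof
    show "inj_on ?a (vertices d)"
      by (rule inj_onI) (rule hanoi_act_inj[OF assms])
    show "?a ` vertices d = vertices d"
    proof (intro equalityI subsetI)
      fix w assume "w \<in> ?a ` vertices d"
      then show "w \<in> vertices d"
        by (elim imageE) (simp only: hanoi_act_vertices[OF assms])
    next
      fix w assume "w \<in> vertices d"
      from hanoi_act_surj[OF assms this, of m i]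
      obtain v where "v \<in> vertices d" "?a v = w"
        by (elim bexE)
      then show "w \<in> ?a ` vertices d"
        by (metis imageI)
    qed
  qed
  have "bij_betw ?g (vertices d) (vertices d)"
    by (rule iffD2[OF bij_betw_cong bij]) (rule g(1))
  then have p: "?g permutes vertices d"
    using g(2) by (rule bij_imp_permutes)
  have snoc: "(\<exists>y. ?a v = ?a u @ [y]) \<longleftrightarrow> (\<exists>x. v = u @ [x])" for u v
  proof
    assume "\<exists>y. ?a v = ?a u @ [y]"
    then obtain y where y: "?a v = ?a u @ [y]" by blast
    then have "length v = Suc (length u)"
      by (metis hanoi_act_length length_append_singleton)
    then obtain v' x where v: "v = v' @ [x]"
      by (cases v rule: rev_cases) auto
    then have "?a v' = ?a u"
      using y hanoi_act_snoc[of d m i v' x] by auto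
    then show "\<exists>x. v = u @ [x]"
      using v hanoi_act_inj[OF assms, of m i v' u] by simp
  qed (use hanoi_act_snoc[of d m i u] in auto)
  have "tree_edge d (?g u) (?g v) \<longleftrightarrow> tree_edge d u v" for u v
  proof (cases "u \<in> vertices d \<and> v \<in> vertices d")
    case True
    then have "?a u \<in> vertices d" "?a v \<in> vertices d"
      by (simp_all only: hanoi_act_vertices[OF assms])
    then show ?thesis
      using True snoc[of u v] snoc[of v u]
      by (simp only: tree_edge_def g(1) ex_disj_distrib)
  next
    case False
    then show ?thesis
      by (simp only: tree_edge_def permutes_in_image[OF p]) blast
  qed
  moreover have "?g [] = []"
    using g(1)[of "[]"] by simp
  ultimately show ?thesis
    using p by (simp add: tree_aut_def)
qed

lemma hanoi_group_group:
  assumes "d \<ge> 1"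
  shows "group (hanoi_group d m)"
proof -
  have "subgroup (generate (tree_aut d) (hanoi_gen d m ` {1..d})) (tree_aut d)"
    by (intro group.generate_is_subgroup[OF tree_aut_group] image_subsetI
        hanoi_gen_in_tree_aut[OF assms])
  then show ?thesis
    unfolding hanoi_group_def by (rule group.subgroup_imp_group[OF tree_aut_group])
qed

lemma psi_hanoi_gen:
  assumes "d \<ge> 1"
  shows "psi d (hanoi_gen d m i) =
    (\<lambda>x\<in>{1..d}. if x = i then hanoi_gen d m i else \<one>\<^bsub>tree_aut d\<^esub>, hanoi_cycle d m i)"
proof -
  have "tree_section (hanoi_gen d m i) [x] w =
      (if x = i then hanoi_gen d m i else \<one>\<^bsub>tree_aut d\<^esub>) w" if "x \<in> {1..d}" for x w
    using that
    by (auto simp: tree_section_def hanoi_gen_def restrict_id_def tree_aut_def)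
  moreover have "root_perm (hanoi_gen d m i) x = hanoi_cycle d m i x" for x
    using permutes_not_in[OF hanoi_cycle_permutes[OF assms, of m i], of x]
    by (auto simp: root_perm_def hanoi_gen_def restrict_id_def)
  ultimately show ?thesis
    unfolding psi_def by (auto simp: fun_eq_iff restrict_def)
qed

end

theory Submission
  imports Defs
begin

text \<open>
  Write \<open>G\<close> for the group, \<open>St\<close> for the stabilizer of the first level, \<open>e\<close> for the exponents and
  \<open>K\<close> for the elements all of whose exponents vanish.

  \<^emph>\<open>Exponents.\<close>  A power of \<open>a_i\<close> fixes the letter \<open>i\<close>, acts below it by the same power of \<open>a_i\<close>, and
  is trivial below every other letter.  Hence each syllable of a word ends up in exactly one of the
  \<open>d\<close> section words, and two neighbouring syllables with different indices end up in different ones.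
  So a word for the identity with at least two syllables can either be merged or has strictly
  shorter section words, which again spell the identity: this is the induction
  \<open>trivial_word_induct\<close>.  It shows that the exponents are well defined modulo \<open>m\<close>
  (\<open>trivial_word_exponent\<close>) and add up over the sections (\<open>e_sections\<close>).  Consequently
  \<open>K\<close> is the commutator subgroup.

  \<^emph>\<open>Sections for \<open>d \<ge> 4\<close>.\<close>  The products \<open>b i\<close> of \<open>a_i\<close> with the inverse of the next generator
  act on the first level as 3-cycles, and these 3-cycles generate the alternating group
  (\<open>has_cycle_G\<close>).  A few explicit words lie in \<open>St\<close>, are trivial in one coordinate and have
  a generator or its inverse in another, or have the same row of exponents in two coordinates and a
  zero row in a third.  Conjugating and subtracting turns the latter into exponent matrices of the form
  "one generator in coordinate \<open>x\<close>, its inverse in coordinate \<open>z\<close>", so that every matrix with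
  zero column sums is attained (\<open>attained_balanced\<close>).  The former allow one to prescribe one
  section while another one is trivial.  If one section can be prescribed freely with trivial sections
  on a set \<open>A\<close>, and also with trivial sections on \<open>B\<close>, then commutators of two such elements
  prescribe it within \<open>K\<close> with trivial sections on the union of \<open>A\<close> and \<open>B\<close>; and balanced matrices
  upgrade \<open>K\<close> back to \<open>G\<close> as long as one coordinate is left free (\<open>avoids_most\<close>).  At the end
  \<open>K \<times> \<dots> \<times> K\<close> is contained in the image of \<open>St\<close>, so that a tuple is a tuple of
  sections of an element of \<open>St\<close> as soon as its exponent matrix is attained
  (\<open>tuple_realized\<close>).

  \<^emph>\<open>The stabilizer.\<close>  Balanced matrices being available, only the column sums of a matrix matter,
  and these are the exponents of the element itself (\<open>attained_iff\<close>).  It remains to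
  determine the exponents that occur on \<open>St\<close>.  If the root permutations of \<open>K\<close> already form the
  alternating group, these are the exponents of the elements with even root permutation
  (\<open>attained_iff_even\<close>).  For \<open>(d, m) = (4, 3)\<close> the root permutations are those of
  \<open>Alt(4)\<close>, whose abelianization has order 3, whence the condition modulo 3
  (\<open>attained_iff_4_3\<close>).

  \<^emph>\<open>Just infiniteness.\<close>  Let \<open>d \<ge> 4\<close>.  A nontrivial normal subgroup moves a vertex, and a double
  commutator argument puts all commutators of elements of \<open>K\<close>, transplanted below the vertices
  of some level, into it (\<open>normal_contains_commutators\<close>).  The commutator subgroup of \<open>K\<close>
  contains \<open>K \<times> \<dots> \<times> K\<close>: take elements with sections \<open>g\<close>, \<open>inv g\<close> in coordinates
  \<open>x\<close>, \<open>y\<close> and \<open>h\<close>, \<open>inv h\<close> in coordinates \<open>x\<close>, \<open>z\<close>.  Hence it has finite index, and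
  inductively so has the normal subgroup (\<open>level_commutators_finite_index\<close>).

  For \<open>d = 3\<close> the group has an infinite dihedral quotient with nontrivial kernel: let the
  first two generators act as two reflections of the integers and the third one trivially.  That this
  respects all relations follows from the linear identity \<open>translation_sections\<close> between
  the translation part of a word and those of its section words.
\<close>

text \<open>The letters start at 1, so \<open>1\<close> is kept as a numeral rather than rewritten to \<open>Suc 0\<close>.\<close>

declare One_nat_def [simp del]

section \<open>Automorphisms and their sections\<close>

abbreviation sec :: "(nat list \<Rightarrow> nat list) \<Rightarrow> nat \<Rightarrow> nat list \<Rightarrow> nat list"
  where "sec g x \<equiv> tree_section g [x]"

lemma tree_aut_mult: "f \<otimes>\<^bsub>tree_aut d\<^esub> g = g \<circ> f"
  by (simp add: tree_aut_def)

lemma tree_aut_one: "\<one>\<^bsub>tree_aut d\<^esub> = id"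
  by (simp add: tree_aut_def)

text \<open>Adjacency is symmetric, so an edge could be sent to one in the opposite direction; injectivity and
  induction along the path from the root exclude this.\<close>

lemma tree_aut_parent:
  assumes "g \<in> carrier (tree_aut d)" "v \<in> vertices d" "x \<in> {1..d}"
  shows "\<exists>y\<in>{1..d}. g (v @ [x]) = g v @ [y]"
  using assms(2,3)
proof (induction v arbitrary: x rule: rev_induct)
  have p: "g permutes vertices d" and r: "g [] = []"
    and e: "\<And>u v. tree_edge d (g u) (g v) \<longleftrightarrow> tree_edge d u v"
    using assms(1) by (auto simp: tree_aut_def)
  {
    case Nil
    have "tree_edge d [] [x]" using Nil by (auto simp: tree_edge_def)
    then have "tree_edge d [] (g [x])" using e[of "[]" "[x]"] r by simp
    then show ?case using r by (auto simp: tree_edge_def)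
  next
    case (snoc z v)
    then have v: "v \<in> vertices d" "z \<in> {1..d}" by auto
    then obtain y where y: "g (v @ [z]) = g v @ [y]" using snoc.IH by blast
    have "tree_edge d (v @ [z]) (v @ [z] @ [x])" using snoc.prems by (auto simp: tree_edge_def)
    then have ed: "tree_edge d (g (v @ [z])) (g (v @ [z] @ [x]))" using e by simp
    then consider y' where "g (v @ [z] @ [x]) = g (v @ [z]) @ [y']" "y' \<in> {1..d}"
      | y' where "g (v @ [z]) = g (v @ [z] @ [x]) @ [y']"
      by (auto simp: tree_edge_def)
    then show ?case
    proof cases
      case 2
      \<comment> \<open>Otherwise the child and the grandparent of a vertex would have the same image.\<close>
      then have "g (v @ [z] @ [x]) = g v" using y by simp
      then show ?thesis using injD[OF permutes_inj[OF p]] by fastforce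
    qed auto
  }
qed

lemma tree_aut_append:
  assumes "g \<in> carrier (tree_aut d)" "v \<in> vertices d" "w \<in> vertices d"
  shows "\<exists>u. g (v @ w) = g v @ u \<and> length u = length w \<and> u \<in> vertices d"
  using assms(3)
proof (induction w rule: rev_induct)
  case (snoc x w)
  then obtain u where "g (v @ w) = g v @ u" "length u = length w" "u \<in> vertices d" by auto
  with tree_aut_parent[OF assms(1), of "v @ w" x] snoc.prems assms(2)
  obtain y where "y \<in> {1..d}" "g ((v @ w) @ [x]) = g (v @ w) @ [y]" by auto
  then show ?case using \<open>g (v @ w) = g v @ u\<close> \<open>length u = length w\<close> \<open>u \<in> vertices d\<close>
    by (intro exI[of _ "u @ [y]"]) auto
qed auto

lemma tree_aut_length:
  assumes "g \<in> carrier (tree_aut d)" "v \<in> vertices d"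
  shows "length (g v) = length v"
proof -
  have "g [] = []" using assms(1) by (simp add: tree_aut_def)
  then show ?thesis using tree_aut_append[OF assms(1) _ assms(2), of "[]"] by auto
qed

lemma tree_aut_off:
  assumes "g \<in> carrier (tree_aut d)" "v \<notin> vertices d"
  shows "g v = v"
  using assms permutes_not_in[of g "vertices d" v] by (simp add: tree_aut_def)

lemma tree_aut_single:
  assumes "g \<in> carrier (tree_aut d)" "x \<in> {1..d}"
  shows "g [x] = [root_perm g x]" "root_perm g x \<in> {1..d}"
proof -
  have "g [] = []" using assms(1) by (simp add: tree_aut_def)
  then show "g [x] = [root_perm g x]" "root_perm g x \<in> {1..d}"
    using tree_aut_parent[OF assms(1), of "[]" x] assms(2) by (auto simp: root_perm_def)
qed

lemma root_perm_off:
  assumes "g \<in> carrier (tree_aut d)" "x \<notin> {1..d}"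
  shows "root_perm g x = x"
  using tree_aut_off[OF assms(1), of "[x]"] assms(2) by (simp add: root_perm_def)

lemma tree_aut_Cons:
  assumes "g \<in> carrier (tree_aut d)" "x \<in> {1..d}" "w \<in> vertices d"
  shows "g (x # w) = root_perm g x # sec g x w" "sec g x w \<in> vertices d"
proof -
  obtain u where u: "g ([x] @ w) = g [x] @ u" "u \<in> vertices d"
    using tree_aut_append[OF assms(1) _ assms(3), of "[x]"] assms(2) by auto
  then show "g (x # w) = root_perm g x # sec g x w" "sec g x w \<in> vertices d"
    using tree_aut_single[OF assms(1,2)] by (auto simp: tree_section_def)
qed

lemma sec_off:
  assumes "g \<in> carrier (tree_aut d)" "x \<in> {1..d}" "w \<notin> vertices d"
  shows "sec g x w = w"
  using tree_aut_off[OF assms(1), of "x # w"] tree_aut_single[OF assms(1,2)] assms(3)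
  by (auto simp: tree_section_def)

lemma tree_aut_eqI:
  assumes "g \<in> carrier (tree_aut d)" "h \<in> carrier (tree_aut d)"
    and "\<And>x. x \<in> {1..d} \<Longrightarrow> root_perm g x = root_perm h x"
    and "\<And>x. x \<in> {1..d} \<Longrightarrow> sec g x = sec h x"
  shows "g = h"
proof
  fix v
  show "g v = h v"
  proof (cases "v \<in> vertices d")
    case True
    then show ?thesis
    proof (cases v)
      case Nil
      then show ?thesis using assms(1,2) by (simp add: tree_aut_def)
    next
      case (Cons x w)
      then have "x \<in> {1..d}" "w \<in> vertices d" using True by auto
      then show ?thesis using assms(3,4) Cons
          tree_aut_Cons(1)[OF assms(1)] tree_aut_Cons(1)[OF assms(2)] by simp
    qed
  next
    case False
    then show ?thesis using assms(1,2) by (simp add: tree_aut_off)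
  qed
qed

lemma root_perm_mult:
  assumes "g \<in> carrier (tree_aut d)" "h \<in> carrier (tree_aut d)"
  shows "root_perm (g \<otimes>\<^bsub>tree_aut d\<^esub> h) x = root_perm h (root_perm g x)"
proof (cases "x \<in> {1..d}")
  case True
  then show ?thesis using tree_aut_single[OF assms(1) True]
    by (simp add: tree_aut_mult root_perm_def)
next
  case False
  then have "g \<otimes>\<^bsub>tree_aut d\<^esub> h \<in> carrier (tree_aut d)"
    using assms group.is_monoid[OF tree_aut_group] by (simp add: monoid.m_closed)
  then show ?thesis using False assms by (simp add: root_perm_off)
qed

lemma sec_mult:
  assumes "g \<in> carrier (tree_aut d)" "h \<in> carrier (tree_aut d)" "x \<in> {1..d}"
  shows "sec (g \<otimes>\<^bsub>tree_aut d\<^esub> h) x = sec g x \<otimes>\<^bsub>tree_aut d\<^esub> sec h (root_perm g x)"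
proof
  fix w
  have gh: "g \<otimes>\<^bsub>tree_aut d\<^esub> h \<in> carrier (tree_aut d)"
    using assms group.is_monoid[OF tree_aut_group] by (simp add: monoid.m_closed)
  show "sec (g \<otimes>\<^bsub>tree_aut d\<^esub> h) x w = (sec g x \<otimes>\<^bsub>tree_aut d\<^esub> sec h (root_perm g x)) w"
  proof (cases "w \<in> vertices d")
    case True
    have "root_perm (g \<otimes>\<^bsub>tree_aut d\<^esub> h) x # sec (g \<otimes>\<^bsub>tree_aut d\<^esub> h) x w = h (g (x # w))"
      using tree_aut_Cons(1)[OF gh assms(3) True] by (simp add: tree_aut_mult)
    also have "\<dots> = root_perm h (root_perm g x) # sec h (root_perm g x) (sec g x w)"
      using tree_aut_Cons[OF assms(1,3) True] tree_aut_single[OF assms(1,3)]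
        tree_aut_Cons(1)[OF assms(2)] by simp
    finally show ?thesis by (simp add: tree_aut_mult)
  next
    case False
    then show ?thesis using assms gh tree_aut_single[OF assms(1,3)]
      by (simp add: sec_off tree_aut_mult)
  qed
qed

lemma root_perm_one: "root_perm \<one>\<^bsub>tree_aut d\<^esub> = id"
  by (auto simp: root_perm_def tree_aut_one)

lemma sec_one: "sec \<one>\<^bsub>tree_aut d\<^esub> x = \<one>\<^bsub>tree_aut d\<^esub>"
  by (auto simp: tree_section_def tree_aut_one)

lemma root_perm_permutes:
  assumes "g \<in> carrier (tree_aut d)"
  shows "root_perm g permutes {1..d}"
proof -
  interpret T: group "tree_aut d" by (rule tree_aut_group)
  let ?h = "inv\<^bsub>tree_aut d\<^esub> g"
  have h: "?h \<in> carrier (tree_aut d)" using assms by simp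
  have l: "root_perm ?h (root_perm g x) = x" and r: "root_perm g (root_perm ?h x) = x" for x
    using root_perm_mult[OF assms h, of x] root_perm_mult[OF h assms, of x] assms
    by (simp_all add: root_perm_one)
  show ?thesis
    unfolding permutes_def
  proof (intro conjI allI impI)
    show "\<exists>!x. root_perm g x = y" for y using l r by metis
  qed (simp add: root_perm_off[OF assms])
qed

section \<open>The group and its generators\<close>

text \<open>An automorphism whose sections are again itself or trivial is determined by its root permutation.\<close>

lemma tree_aut_trivialI:
  assumes g: "g \<in> carrier (tree_aut d)"
    and rt: "\<And>x. x \<in> {1..d} \<Longrightarrow> root_perm g x = x"
    and sc: "\<And>x. x \<in> {1..d} \<Longrightarrow> sec g x = g \<or> sec g x = \<one>\<^bsub>tree_aut d\<^esub>"
  shows "g = \<one>\<^bsub>tree_aut d\<^esub>"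
proof
  fix v
  show "g v = \<one>\<^bsub>tree_aut d\<^esub> v"
  proof (cases "v \<in> vertices d")
    case True
    then show ?thesis
    proof (induction v)
      case Nil
      then show ?case using g by (simp add: tree_aut_def)
    next
      case (Cons x w)
      then show ?case using tree_aut_Cons(1)[OF g Cons(1,2)] rt[OF Cons(1)] sc[OF Cons(1)]
        by (auto simp: tree_aut_one)
    qed
  next
    case False
    then show ?thesis by (simp add: tree_aut_off[OF g] tree_aut_one)
  qed
qed

locale hanoi =
  fixes d m :: nat
  assumes d3: "3 \<le> d" and m2: "2 \<le> m" and md: "m < d"
begin

abbreviation H where "H \<equiv> hanoi_group d m"
abbreviation G where "G \<equiv> carrier (hanoi_group d m)"
abbreviation I :: "nat set" where "I \<equiv> {1..d}"
abbreviation a where "a \<equiv> hanoi_gen d m"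
abbreviation prod_H (infixl "\<cdot>" 70) where "f \<cdot> g \<equiv> f \<otimes>\<^bsub>hanoi_group d m\<^esub> g"
abbreviation inv_H where "inv_H g \<equiv> inv\<^bsub>hanoi_group d m\<^esub> g"
abbreviation one_H where "one_H \<equiv> \<one>\<^bsub>hanoi_group d m\<^esub>"
abbreviation rt where "rt \<equiv> root_perm"

text \<open>The letter reached from \<open>i\<close> by \<open>k\<close> steps around the cycle \<open>1, \<dots>, d\<close>; the generator
  \<open>a i\<close> permutes \<open>after i 1, \<dots>, after i m\<close> cyclically.\<close>

definition after :: "nat \<Rightarrow> nat \<Rightarrow> nat" where "after i k = (i + k - 1) mod d + 1"

text \<open>Membership in \<open>I\<close> is kept folded: the letters are compared through their cyclic distance, not
  through inequalities.\<close>

declare atLeastAtMost_iff [simp del]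

sublocale H: group H
  using d3 by (intro hanoi_group_group) simp

lemma H_mult: "f \<cdot> g = f \<otimes>\<^bsub>tree_aut d\<^esub> g" and H_mult': "f \<cdot> g = g \<circ> f"
  and H_one: "one_H = \<one>\<^bsub>tree_aut d\<^esub>" and H_one': "one_H = id"
  by (simp_all add: hanoi_group_def tree_aut_mult tree_aut_one)

lemma G_subgroup: "subgroup G (tree_aut d)"
  unfolding hanoi_group_def using d3
  by (auto intro!: group.generate_is_subgroup[OF tree_aut_group] hanoi_gen_in_tree_aut)

lemma G_tree: "g \<in> G \<Longrightarrow> g \<in> carrier (tree_aut d)"
  using subgroup.subset[OF G_subgroup] by blast

lemma H_eq: "H = (tree_aut d)\<lparr>carrier := G\<rparr>"
  by (simp add: hanoi_group_def)

lemma a_G [simp, intro]: "i \<in> I \<Longrightarrow> a i \<in> G"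
  by (auto simp: hanoi_group_def intro: generate.incl)

lemma rt_mult: "g \<in> G \<Longrightarrow> h \<in> G \<Longrightarrow> rt (g \<cdot> h) x = rt h (rt g x)"
  by (simp add: H_mult root_perm_mult G_tree)

lemma sec_mult': "g \<in> G \<Longrightarrow> h \<in> G \<Longrightarrow> x \<in> I \<Longrightarrow> sec (g \<cdot> h) x = sec g x \<cdot> sec h (rt g x)"
  by (simp add: H_mult sec_mult G_tree)

lemma rt_one: "rt one_H = id" and sec_one': "sec one_H x = one_H"
  by (simp_all add: H_one root_perm_one sec_one)

lemma rt_permutes: "g \<in> G \<Longrightarrow> rt g permutes I"
  by (simp add: root_perm_permutes G_tree)

lemma rt_I [simp]: "g \<in> G \<Longrightarrow> rt g x \<in> I \<longleftrightarrow> x \<in> I"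
  by (simp only: permutes_in_image[OF rt_permutes])

lemma rt_inj [simp]: "g \<in> G \<Longrightarrow> rt g x = rt g y \<longleftrightarrow> x = y"
  using injD[OF permutes_inj[OF rt_permutes]] by blast

lemma G_eqI:
  assumes "g \<in> G" "h \<in> G" "\<And>x. x \<in> I \<Longrightarrow> rt g x = rt h x" "\<And>x. x \<in> I \<Longrightarrow> sec g x = sec h x"
  shows "g = h"
  by (rule tree_aut_eqI[OF G_tree G_tree]) (use assms in auto)

lemma rt_a: "rt (a i) = hanoi_cycle d m i"
  using psi_hanoi_gen[of d m i] d3 by (simp add: psi_def)

lemma sec_a: "x \<in> I \<Longrightarrow> sec (a i) x = (if x = i then a i else one_H)"
proof -
  assume x: "x \<in> I"
  have "(\<lambda>x\<in>I. sec (a i) x) x = (\<lambda>x\<in>I. if x = i then a i else \<one>\<^bsub>tree_aut d\<^esub>) x"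
    using psi_hanoi_gen[of d m i] d3 by (simp add: psi_def)
  then show ?thesis using x by (simp add: H_one)
qed

lemma rt_inv: "g \<in> G \<Longrightarrow> rt (inv_H g) (rt g x) = x" "g \<in> G \<Longrightarrow> rt g (rt (inv_H g) x) = x"
  using rt_mult[of g "inv_H g" x] rt_mult[of "inv_H g" g x] by (simp_all add: rt_one)

lemma G_induct [consumes 1, case_names one gen inv mult]:
  assumes "g \<in> G" "P one_H" "\<And>i. i \<in> I \<Longrightarrow> P (a i)" "\<And>i. i \<in> I \<Longrightarrow> P (inv_H (a i))"
    "\<And>g h. g \<in> G \<Longrightarrow> h \<in> G \<Longrightarrow> P g \<Longrightarrow> P h \<Longrightarrow> P (g \<cdot> h)"
  shows "P g"
proof -
  have iv: "inv_H (a i) = inv\<^bsub>tree_aut d\<^esub> (a i)" if "i \<in> I" for i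
    using group.m_inv_consistent[OF tree_aut_group G_subgroup a_G[OF that]] H_eq by simp
  have "g \<in> generate (tree_aut d) (a ` I)" using assms(1) by (simp add: hanoi_group_def)
  then show ?thesis
  proof induction
    case one
    then show ?case using assms(2) by (simp add: H_one)
  next
    case (incl h)
    then show ?case using assms(3) by auto
  next
    case (inv h)
    then show ?case using assms(4) iv by auto
  next
    case (eng h1 h2)
    then have "h1 \<in> G" "h2 \<in> G" by (simp_all add: hanoi_group_def)
    then show ?case using assms(5) eng by (simp add: H_mult)
  qed
qed

text \<open>The self-similarity of the group.\<close>

lemma sec_G [simp]: "g \<in> G \<Longrightarrow> x \<in> I \<Longrightarrow> sec g x \<in> G"
proof (induction g arbitrary: x rule: G_induct)
  case one
  then show ?case by (simp add: sec_one')
next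
  case (gen i)
  then show ?case by (simp add: sec_a)
next
  case (inv i)
  let ?b = "inv_H (a i)" and ?y = "rt (inv_H (a i)) x"
  have y: "?y \<in> I" using inv by simp
  have "sec ?b x \<cdot> sec (a i) ?y = one_H"
    using inv sec_mult'[of ?b "a i" x] by (simp add: sec_one')
  moreover have "sec (a i) ?y \<in> {one_H, a i}" using sec_a[OF y] by auto
  ultimately consider "sec ?b x = one_H" | "a i \<circ> sec ?b x = id"
    by (auto simp: H_mult' H_one')
  then show ?case
  proof cases
    case 2
    then have "inv_H (a i) \<circ> (a i \<circ> sec ?b x) = inv_H (a i)" by simp
    moreover have "inv_H (a i) \<circ> a i = id"
      using H.r_inv[of "a i"] inv by (simp add: H_mult' H_one')
    ultimately have "sec ?b x = inv_H (a i)" by (simp add: o_assoc)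
    then show ?thesis using inv by simp
  qed simp
next
  case (mult g h)
  then show ?case by (simp add: sec_mult')
qed

lemma sec_inv: "g \<in> G \<Longrightarrow> x \<in> I \<Longrightarrow> sec (inv_H g) (rt g x) = inv_H (sec g x)"
proof -
  assume g: "g \<in> G" and x: "x \<in> I"
  have "sec g x \<cdot> sec (inv_H g) (rt g x) = one_H"
    using sec_mult'[of g "inv_H g" x] g x by (simp add: sec_one')
  then show ?thesis using g x by (metis H.inv_closed H.inv_equality H.inv_inv rt_I sec_G)
qed

lemma sec_inv': "g \<in> G \<Longrightarrow> x \<in> I \<Longrightarrow> sec (inv_H g) x = inv_H (sec g (rt (inv_H g) x))"
  using sec_inv[of g "rt (inv_H g) x"] by (simp add: rt_inv)


section \<open>Cyclic positions on the first level\<close>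

lemma after_I [simp]: "after i k \<in> I"
proof -
  have "(i + k - 1) mod d < d" using d3 by (intro mod_less_divisor) simp
  then show ?thesis unfolding after_def by (auto simp: atLeastAtMost_iff)
qed

lemma after_0: "i \<in> I \<Longrightarrow> after i 0 = i"
  by (auto simp: after_def atLeastAtMost_iff)

lemma after_after: "i \<in> I \<Longrightarrow> after (after i j) k = after i (j + k)"
proof -
  assume "i \<in> I"
  then obtain i' where i: "i = i' + 1" by (metis add.commute atLeastAtMost_iff le_Suc_ex)
  have "((i' + j) mod d + k) mod d = (i' + j + k) mod d" by (rule mod_add_left_eq)
  then show ?thesis by (simp add: after_def i add.assoc)
qed

lemma after_period: "i \<in> I \<Longrightarrow> after i (d + k) = after i k" "i \<in> I \<Longrightarrow> after i d = i"
proof -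
  assume i: "i \<in> I"
  show "after i (d + k) = after i k" for k
  proof -
    have "i + (d + k) - 1 = d + (i + k - 1)" using i by (auto simp: atLeastAtMost_iff)
    then show ?thesis by (simp add: after_def)
  qed
  from this[of 0] show "after i d = i" using i by (simp add: after_0)
qed

lemma after_inj: "i \<in> I \<Longrightarrow> j < d \<Longrightarrow> k < d \<Longrightarrow> after i j = after i k \<longleftrightarrow> j = k"
proof
  assume i: "i \<in> I" and jk: "j < d" "k < d" and eq: "after i j = after i k"
  have "(i - 1 + j) mod d = (i - 1 + k) mod d" using eq i by (auto simp: after_def atLeastAtMost_iff)
  then have "j mod d = k mod d"
    using cong_add_lcancel_nat[of "i - 1" j k d] by (simp add: cong_def)
  then show "j = k" using jk by simp
qed simp

lemma after_surj: "i \<in> I \<Longrightarrow> x \<in> I \<Longrightarrow> \<exists>k<d. x = after i k"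
proof -
  assume i: "i \<in> I" and x: "x \<in> I"
  have "inj_on (after i) {..<d}" using after_inj[OF i] by (auto simp: inj_on_def)
  then have "after i ` {..<d} = I"
    by (intro card_subset_eq) (auto simp: card_image image_subset_iff)
  then show ?thesis using x by auto
qed

lemma cycle_after:
  assumes i: "i \<in> I" and k: "k < d"
  shows "hanoi_cycle d m i (after i k) =
    (if k = 0 \<or> m < k then after i k else if k = m then after i 1 else after i (k + 1))"
proof -
  let ?cs = "map (after i) [1..<Suc m]"
  have cyc: "hanoi_cycle d m i = cycle_of_list ?cs"
    unfolding hanoi_cycle_def after_def ..
  have inj: "inj_on (after i) {..<d}" using after_inj[OF i] by (auto simp: inj_on_def)
  have "inj_on (after i) (set [1..<Suc m])" by (rule inj_on_subset[OF inj]) (use md in auto)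
  then have dist: "distinct ?cs" by (simp add: distinct_map)
  show ?thesis
  proof (cases "k = 0 \<or> m < k")
    case True
    have "after i k \<notin> set ?cs"
    proof
      assume "after i k \<in> set ?cs"
      then obtain l where "l \<in> {1..m}" "after i k = after i l" by (auto simp: atLeastAtMost_iff intro: less_imp_le)
      then show False using True after_inj[OF i k, of l] md by (auto simp: atLeastAtMost_iff)
    qed
    from id_outside_supp[OF this] show ?thesis using True by (simp add: cyc del: upt_Suc)
  next
    case False
    have "map (cycle_of_list ?cs) ?cs = rotate1 ?cs"
      using cyclic_rotation[OF dist, of 1] by (simp add: One_nat_def)
    moreover have l: "length ?cs = m" by simp
    ultimately have "cycle_of_list ?cs (?cs ! (k - 1)) = rotate1 ?cs ! (k - 1)"
      using False nth_map[of "k - 1" ?cs "cycle_of_list ?cs"] by (auto simp del: upt_Suc)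
    moreover have "?cs ! (k - 1) = after i k"
      using False nth_map_upt[of "k - 1" "Suc m" 1 "after i"] by (auto simp del: upt_Suc)
    moreover have "rotate1 ?cs ! (k - 1) = (if k = m then after i 1 else after i (k + 1))"
    proof (cases "k = m")
      case True
      then have "rotate1 ?cs ! (k - 1) = ?cs ! 0"
        using m2 by (subst nth_rotate1) (auto simp del: upt_Suc)
      then show ?thesis using True m2 nth_map_upt[of 0 "Suc m" 1 "after i"] by (simp del: upt_Suc)
    next
      case k: False
      then have "rotate1 ?cs ! (k - 1) = ?cs ! k"
        using False by (subst nth_rotate1) (auto simp del: upt_Suc)
      then show ?thesis
        using k False nth_map_upt[of k "Suc m" 1 "after i"] by (simp add: add.commute del: upt_Suc)
    qed
    ultimately show ?thesis using False cyc by simp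
  qed
qed

lemma cycle_fix: "i \<in> I \<Longrightarrow> hanoi_cycle d m i i = i"
  using cycle_after[of i 0] d3 by (simp add: after_0)

section \<open>Words, section words and exponents\<close>

lemma rt_pow: "g \<in> G \<Longrightarrow> rt (g [^]\<^bsub>H\<^esub> (n::nat)) = rt g ^^ n"
  by (induction n) (auto simp: rt_one rt_mult)

lemma sec_pow:
  assumes "i \<in> I" "x \<in> I"
  shows "sec (a i [^]\<^bsub>H\<^esub> (n::nat)) x = (if x = i then a i [^]\<^bsub>H\<^esub> n else one_H)"
proof (induction n)
  case (Suc n)
  let ?y = "rt (a i [^]\<^bsub>H\<^esub> n) x"
  have "rt (a i [^]\<^bsub>H\<^esub> n) i = i"
    using assms by (induction n) (auto simp: rt_one rt_mult rt_a cycle_fix)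
  then have "?y = i \<longleftrightarrow> x = i" using assms by (metis H.nat_pow_closed a_G rt_inj)
  moreover have "?y \<in> I" using assms by simp
  ultimately show ?case using assms Suc by (simp add: sec_mult' sec_a)
qed (simp add: sec_one')

lemma cycle_pow:
  assumes "i \<in> I" "n < m"
  shows "(hanoi_cycle d m i ^^ n) (after i 1) = after i (n + 1)"
  using assms(2)
proof (induction n)
  case (Suc n)
  then show ?case using cycle_after[OF assms(1), of "n + 1"] md by (simp add: One_nat_def)
qed simp

lemma cycle_order:
  assumes "i \<in> I"
  shows "hanoi_cycle d m i ^^ m = id"
proof -
  have "distinct (map (after i) [1..<Suc m])"
    using after_inj[OF assms] md by (simp add: distinct_map inj_on_def del: upt_Suc)
  from cycle_is_id_root[OF this] show ?thesis
    by (simp add: hanoi_cycle_def after_def[abs_def] del: upt_Suc)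
qed

text \<open>The power fixes the first level and its only possibly nontrivial section is the power itself.\<close>

lemma a_order: "i \<in> I \<Longrightarrow> a i [^]\<^bsub>H\<^esub> m = one_H"
  unfolding H_one
proof (rule tree_aut_trivialI)
  assume i: "i \<in> I"
  show "a i [^]\<^bsub>H\<^esub> m \<in> carrier (tree_aut d)" using i by (simp add: G_tree)
  show "rt (a i [^]\<^bsub>H\<^esub> m) x = x" for x
    using i by (simp add: rt_pow rt_a cycle_order)
  show "sec (a i [^]\<^bsub>H\<^esub> m) x = a i [^]\<^bsub>H\<^esub> m \<or> sec (a i [^]\<^bsub>H\<^esub> m) x = \<one>\<^bsub>tree_aut d\<^esub>"
    if "x \<in> I" for x
    using i that by (simp add: sec_pow H_one)
qed

lemma a_int_pow:
  assumes "i \<in> I"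
  shows "a i [^]\<^bsub>H\<^esub> (k::int) = a i [^]\<^bsub>H\<^esub> nat (k mod int m)"
proof -
  have "a i [^]\<^bsub>H\<^esub> k = a i [^]\<^bsub>H\<^esub> (int m * (k div int m) + int (nat (k mod int m)))"
    using m2 by simp
  also have "\<dots> = (a i [^]\<^bsub>H\<^esub> int m) [^]\<^bsub>H\<^esub> (k div int m) \<cdot> a i [^]\<^bsub>H\<^esub> int (nat (k mod int m))"
    using assms by (simp only: H.int_pow_mult H.int_pow_pow a_G mult.commute)
  also have "a i [^]\<^bsub>H\<^esub> int m = one_H" using assms by (simp only: int_pow_int a_order)
  finally show ?thesis using assms by (simp add: int_pow_int)
qed

lemma a_int_pow_trivial:
  assumes "i \<in> I"
  shows "a i [^]\<^bsub>H\<^esub> (k::int) = one_H \<longleftrightarrow> int m dvd k"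
proof -
  let ?r = "nat (k mod int m)"
  have r: "?r < m" using m2 by (simp add: nat_less_iff)
  show ?thesis
  proof
    assume "a i [^]\<^bsub>H\<^esub> k = one_H"
    then have "(hanoi_cycle d m i ^^ ?r) (after i 1) = after i 1"
      using a_int_pow[OF assms] rt_pow[of "a i" ?r] assms by (simp add: rt_a rt_one)
    then have "after i (?r + 1) = after i 1" using cycle_pow[OF assms r] by simp
    then have "?r = 0" using after_inj[OF assms, of "?r + 1" 1] r md by simp
    then show "int m dvd k" using m2
      by (metis dvd_eq_mod_eq_0 nat_eq_iff2 nat_0_iff order_antisym_conv pos_mod_sign
          of_nat_0_less_iff r gr_zeroI not_less_zero)
  next
    assume "int m dvd k"
    then show "a i [^]\<^bsub>H\<^esub> k = one_H" using a_int_pow[OF assms] by (simp add: dvd_imp_mod_0)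
  qed
qed

lemma sec_int_pow:
  "i \<in> I \<Longrightarrow> x \<in> I \<Longrightarrow>
    sec (a i [^]\<^bsub>H\<^esub> (k::int)) x = (if x = i then a i [^]\<^bsub>H\<^esub> k else one_H)"
  by (simp only: a_int_pow[of i k] sec_pow)

lemma rt_int_pow_fix: "i \<in> I \<Longrightarrow> rt (a i [^]\<^bsub>H\<^esub> (k::int)) i = i"
proof -
  assume i: "i \<in> I"
  have "(hanoi_cycle d m i ^^ n) i = i" for n
    using i by (induction n) (auto simp: cycle_fix)
  then show ?thesis using i a_int_pow[OF i, of k] by (simp add: rt_pow rt_a)
qed

abbreviation W where "W \<equiv> gen_words d"
abbreviation wv where "wv \<equiv> word_value d m"

lemma W_Nil [simp]: "[] \<in> W" and W_Cons [simp]: "p # w \<in> W \<longleftrightarrow> fst p \<in> I \<and> w \<in> W"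
  and W_append [simp]: "u @ w \<in> W \<longleftrightarrow> u \<in> W \<and> w \<in> W"
  by (cases p; auto simp: gen_words_def)+

lemma wv_Nil [simp]: "wv [] = one_H"
  by (simp add: H_one)

lemma wv_Cons [simp]: "fst p \<in> I \<Longrightarrow> wv (p # w) = a (fst p) [^]\<^bsub>H\<^esub> snd p \<cdot> wv w"
  using group.int_pow_consistent[OF tree_aut_group G_subgroup a_G[of "fst p"], of "snd p"]
  by (simp add: H_mult H_eq[symmetric])

declare word_value.simps [simp del]

lemma wv_G [simp]: "w \<in> W \<Longrightarrow> wv w \<in> G"
  by (induction w) auto

lemma wv_append: "u \<in> W \<Longrightarrow> w \<in> W \<Longrightarrow> wv (u @ w) = wv u \<cdot> wv w"
  by (induction u) (auto simp: H.m_assoc)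

lemma G_word: "g \<in> G \<Longrightarrow> \<exists>w\<in>W. wv w = g"
proof (induction g rule: G_induct)
  case one
  then show ?case by (intro bexI[of _ "[]"]) auto
next
  case (gen i)
  then show ?case by (intro bexI[of _ "[(i, 1)]"]) auto
next
  case (inv i)
  then show ?case by (intro bexI[of _ "[(i, -1)]"]) (auto simp: H.int_pow_neg)
next
  case (mult g h)
  then obtain u w where "u \<in> W" "wv u = g" "w \<in> W" "wv w = h" by blast
  then show ?case by (intro bexI[of _ "u @ w"]) (auto simp: wv_append)
qed

text \<open>The syllables that act at the current image of \<open>x\<close>.  A syllable acting at \<open>x\<close> fixes \<open>x\<close>, so the
  letter changes only when the syllable is dropped.\<close>

primrec section_word :: "nat \<Rightarrow> (nat \<times> int) list \<Rightarrow> (nat \<times> int) list"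
  where
    "section_word x [] = []"
  | "section_word x (p # w) =
      (if fst p = x then p # section_word x w else section_word (rt (a (fst p) [^]\<^bsub>H\<^esub> snd p) x) w)"

lemma sec_wv: "w \<in> W \<Longrightarrow> x \<in> I \<Longrightarrow> section_word x w \<in> W \<and> sec (wv w) x = wv (section_word x w)"
proof (induction w arbitrary: x)
  case (Cons p w)
  then show ?case by (auto simp: sec_mult' sec_int_pow rt_int_pow_fix)
qed (simp add: sec_one')

lemma length_section_word: "length (section_word x w) \<le> length w"
  by (induction w arbitrary: x) (auto simp: le_SucI)

lemma word_exponent_Cons [simp]:
  "word_exponent i (p # w) = (if fst p = i then snd p else 0) + word_exponent i w"
  by (auto simp: word_exponent_def split: prod.splits)

lemma word_exponent_append [simp]:
  "word_exponent i (u @ w) = word_exponent i u + word_exponent i w"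
  by (simp add: word_exponent_def)

lemma word_exponent_Nil [simp]: "word_exponent i [] = 0"
  by (simp add: word_exponent_def)

text \<open>Each syllable goes into exactly one section word.\<close>

lemma sum_section_word:
  "w \<in> W \<Longrightarrow> (\<Sum>x\<in>I. word_exponent i (section_word x w)) = word_exponent i w"
proof (induction w)
  case (Cons p w)
  let ?\<sigma> = "rt (a (fst p) [^]\<^bsub>H\<^esub> snd p)"
  have \<sigma>: "?\<sigma> permutes I" using Cons.prems by (intro rt_permutes) auto
  have "word_exponent i (section_word x (p # w)) =
      (if x = fst p then (if fst p = i then snd p else 0) else 0) + word_exponent i (section_word (?\<sigma> x) w)" for x
    using Cons.prems by (auto simp: rt_int_pow_fix)
  then have "(\<Sum>x\<in>I. word_exponent i (section_word x (p # w))) =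
      (if fst p = i then snd p else 0) + (\<Sum>x\<in>I. word_exponent i (section_word (?\<sigma> x) w))"
    using Cons.prems by (simp add: sum.distrib del: section_word.simps)
  also have "(\<Sum>x\<in>I. word_exponent i (section_word (?\<sigma> x) w)) = (\<Sum>x\<in>I. word_exponent i (section_word x w))"
    using sum.permute[OF \<sigma>, of "\<lambda>x. word_exponent i (section_word x w)"] by (simp add: o_def)
  finally show ?case using Cons by simp
qed simp

text \<open>A word for the identity has at most one syllable, or starts with two syllables that can be merged,
  or has shorter section words, which also represent the identity.\<close>

lemma trivial_word_induct [consumes 2, case_names Nil single merge sections]:
  assumes "w \<in> W" "wv w = one_H"
    and Nil: "P []"
    and single: "\<And>i k. i \<in> I \<Longrightarrow> int m dvd k \<Longrightarrow> P [(i, k)]"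
    and merge: "\<And>i k l w. i \<in> I \<Longrightarrow> w \<in> W \<Longrightarrow> P ((i, k + l) # w) \<Longrightarrow> P ((i, k) # (i, l) # w)"
    and sections: "\<And>w. w \<in> W \<Longrightarrow> wv w = one_H \<Longrightarrow> (\<And>x. x \<in> I \<Longrightarrow> P (section_word x w)) \<Longrightarrow> P w"
  shows "P w"
  using assms(1,2)
proof (induction w rule: length_induct)
  case (1 w)
  consider "w = []" | i k where "w = [(i, k)]" | i k j l v where "w = (i, k) # (j, l) # v"
    by (cases w rule: remdups_adj.cases) auto
  then show ?case
  proof cases
    case 1
    then show ?thesis using Nil by simp
  next
    case (2 i k)
    then show ?thesis using "1.prems" single a_int_pow_trivial[of i k] by simp
  next
    case (3 i k j l v)
    show ?thesis
    proof (cases "i = j")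
      case True
      have "wv ((i, k + l) # v) = one_H"
        using "1.prems" 3 True by (simp add: H.int_pow_mult H.m_assoc)
      then have "P ((i, k + l) # v)" using "1.IH" "1.prems" 3 True by simp
      then show ?thesis using merge[of i v k l] "1.prems" 3 True by simp
    next
      case False
      \<comment> \<open>The first two syllables contribute to different coordinates, so every section word is
        shorter.\<close>
      have "length (section_word x w) < length w" for x
        using 3 False length_section_word[of _ v] by (auto simp: less_Suc_eq_le le_SucI)
      moreover have "wv (section_word x w) = one_H" "section_word x w \<in> W" if "x \<in> I" for x
        using sec_wv[OF "1.prems"(1) that] "1.prems"(2) by (simp_all add: sec_one')
      ultimately show ?thesis using "1.IH" sections[OF "1.prems"] by blast
    qed
  qed
qed

lemma trivial_word_exponent:
  assumes "w \<in> W" "wv w = one_H"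
  shows "int m dvd word_exponent i w"
  using assms
proof (induction w rule: trivial_word_induct)
  case (sections w)
  then show ?case
    using sum_section_word[of w i] dvd_sum[of I "int m" "\<lambda>x. word_exponent i (section_word x w)"] by simp
qed (auto simp: add.assoc)

abbreviation e where "e \<equiv> gen_exponent d m"

definition inv_word :: "(nat \<times> int) list \<Rightarrow> (nat \<times> int) list"
  where "inv_word w = rev (map (\<lambda>p. (fst p, - snd p)) w)"

lemma inv_word: "w \<in> W \<Longrightarrow> inv_word w \<in> W \<and> wv (inv_word w) = inv_H (wv w)"
  by (induction w) (auto simp: inv_word_def wv_append H.inv_mult_group H.int_pow_neg)

lemma word_exponent_inv_word: "word_exponent i (inv_word w) = - word_exponent i w"
  by (induction w) (auto simp: inv_word_def)

lemma word_exponent_cong: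
  assumes "u \<in> W" "w \<in> W" "wv u = wv w"
  shows "[word_exponent i u = word_exponent i w] (mod int m)"
proof -
  have "wv (u @ inv_word w) = one_H" "u @ inv_word w \<in> W"
    using assms inv_word[of w] by (simp_all add: wv_append)
  then have "int m dvd word_exponent i (u @ inv_word w)" by (metis trivial_word_exponent)
  then show ?thesis by (simp add: word_exponent_inv_word cong_iff_dvd_diff)
qed

text \<open>This is the sense in which the exponents of a group element are well defined.\<close>

lemma e_word: "w \<in> W \<Longrightarrow> e i (wv w) = word_exponent i w mod int m"
  unfolding gen_exponent_def
  by (rule the_equality) (use word_exponent_cong[unfolded cong_def] in blast)+

lemma e_mod [simp]: "g \<in> G \<Longrightarrow> e i g mod int m = e i g"
  using G_word[of g] e_word[of _ i] by auto

lemma e_one [simp]: "e i one_H = 0"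
  using e_word[of "[]" i] by simp

lemma e_gen: "j \<in> I \<Longrightarrow> e i (a j) = (if i = j then 1 else 0)"
  using e_word[of "[(j, 1)]" i] m2 by auto

lemma e_mult:
  assumes "g \<in> G" "h \<in> G"
  shows "[e i (g \<cdot> h) = e i g + e i h] (mod int m)"
proof -
  obtain u w where "u \<in> W" "wv u = g" "w \<in> W" "wv w = h" using G_word assms by blast
  then show ?thesis
    using e_word[of "u @ w" i] e_word[of u i] e_word[of w i]
    by (auto simp: wv_append cong_def mod_simps)
qed

lemma e_inv:
  assumes "g \<in> G"
  shows "[e i (inv_H g) = - e i g] (mod int m)"
proof -
  have "[0 = e i g + e i (inv_H g)] (mod int m)"
    using e_mult[of g "inv_H g" i] assms by simp
  then have "int m dvd e i g + e i (inv_H g)" by (metis cong_0_iff cong_sym)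
  then show ?thesis by (simp add: cong_iff_dvd_diff add.commute)
qed

lemma e_eqI: "g \<in> G \<Longrightarrow> h \<in> G \<Longrightarrow> [e i g = e i h] (mod int m) \<Longrightarrow> e i g = e i h"
  by (metis cong_def e_mod)

lemma e_sections:
  assumes "g \<in> G"
  shows "[(\<Sum>x\<in>I. e i (sec g x)) = e i g] (mod int m)"
proof -
  obtain w where w: "w \<in> W" "wv w = g" using G_word assms by blast
  have "(\<Sum>x\<in>I. e i (sec g x)) = (\<Sum>x\<in>I. word_exponent i (section_word x w) mod int m)"
    using w sec_wv[OF w(1)] e_word by (intro sum.cong) auto
  then show ?thesis
    using w sum_section_word[OF w(1), of i] e_word[OF w(1), of i] by (simp add: cong_def mod_simps)
qed

section \<open>The level-one stabilizer and the commutator subgroup\<close>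

abbreviation St where "St \<equiv> level_one_stabilizer d (hanoi_group d m)"

definition K where "K = {g \<in> G. \<forall>i\<in>I. e i g = 0}"

abbreviation comm where "comm g h \<equiv> g \<cdot> h \<cdot> inv_H g \<cdot> inv_H h"

lemma St_iff: "g \<in> St \<longleftrightarrow> g \<in> G \<and> rt g = id"
proof -
  have "(\<forall>x\<in>I. g [x] = [x]) \<longleftrightarrow> rt g = id" if "g \<in> G"
    using tree_aut_single(1)[OF G_tree[OF that]] root_perm_off[OF G_tree[OF that]]
    by (metis eq_id_iff list.inject)
  then show ?thesis by (auto simp: level_one_stabilizer_def)
qed

lemma StI: "g \<in> G \<Longrightarrow> rt g = id \<Longrightarrow> g \<in> St" by (simp add: St_iff)

lemma St_G [simp]: "n \<in> St \<Longrightarrow> n \<in> G" and St_rt [simp]: "n \<in> St \<Longrightarrow> rt n = id"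
  by (simp_all add: St_iff)

lemma St_one [simp]: "one_H \<in> St" by (rule StI) (simp_all add: rt_one)

lemma St_mult [simp]: "n \<in> St \<Longrightarrow> n' \<in> St \<Longrightarrow> n \<cdot> n' \<in> St"
  by (rule StI) (auto simp: rt_mult)

lemma St_inv [simp]: "n \<in> St \<Longrightarrow> inv_H n \<in> St"
  using rt_inv(1)[of n] by (intro StI) (auto simp: fun_eq_iff)

lemma sec_St_mult [simp]:
  "n \<in> St \<Longrightarrow> n' \<in> G \<Longrightarrow> x \<in> I \<Longrightarrow> sec (n \<cdot> n') x = sec n x \<cdot> sec n' x"
  by (simp add: sec_mult')

lemma sec_St_inv [simp]: "n \<in> St \<Longrightarrow> x \<in> I \<Longrightarrow> sec (inv_H n) x = inv_H (sec n x)"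
  using sec_inv[of n x] by simp

lemma St_eqI:
  "n \<in> St \<Longrightarrow> n' \<in> St \<Longrightarrow> (\<And>x. x \<in> I \<Longrightarrow> sec n x = sec n' x) \<Longrightarrow> n = n'"
  by (rule G_eqI) auto

lemma conj_St:
  assumes "n \<in> St" "p \<in> G"
  shows "inv_H p \<cdot> n \<cdot> p \<in> St"
    and "x \<in> I \<Longrightarrow> sec (inv_H p \<cdot> n \<cdot> p) (rt p x) = inv_H (sec p x) \<cdot> sec n x \<cdot> sec p x"
proof -
  show "inv_H p \<cdot> n \<cdot> p \<in> St"
    using assms by (intro StI) (auto simp: rt_mult rt_inv)
  show "sec (inv_H p \<cdot> n \<cdot> p) (rt p x) = inv_H (sec p x) \<cdot> sec n x \<cdot> sec p x" if "x \<in> I"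
  proof -
    have "rt n x = x" using assms(1) by simp
    then show ?thesis using assms that
      by (simp add: sec_mult' rt_mult rt_inv sec_inv del: sec_St_mult)
  qed
qed

lemma K_iff: "g \<in> K \<longleftrightarrow> g \<in> G \<and> (\<forall>i\<in>I. [e i g = 0] (mod int m))"
proof -
  have "e i g = 0 \<longleftrightarrow> [e i g = 0] (mod int m)" if "g \<in> G" for i
    using e_eqI[OF that H.one_closed, of i] by auto
  then show ?thesis by (auto simp: K_def)
qed

lemma K_one [simp]: "one_H \<in> K" by (simp add: K_def)

lemma K_G [simp]: "k \<in> K \<Longrightarrow> k \<in> G" and K_e: "k \<in> K \<Longrightarrow> i \<in> I \<Longrightarrow> e i k = 0"
  by (simp_all add: K_def)

lemma e_prod_inv:
  assumes "g \<in> G" "h \<in> G"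
  shows "[e i (g \<cdot> inv_H h) = e i g - e i h] (mod int m)"
  using cong_trans[OF e_mult[of g "inv_H h" i] cong_add[OF cong_refl e_inv[of h i]]] assms by simp

lemma K_diffI:
  assumes "g \<in> G" "h \<in> G" "\<And>i. i \<in> I \<Longrightarrow> [e i g = e i h] (mod int m)"
  shows "g \<cdot> inv_H h \<in> K"
  unfolding K_iff
proof (intro conjI ballI)
  fix i assume "i \<in> I"
  with assms(3) have "[e i g - e i h = 0] (mod int m)" by (metis cong_diff cong_refl diff_self)
  then show "[e i (g \<cdot> inv_H h) = 0] (mod int m)"
    using e_prod_inv[OF assms(1,2), of i] cong_trans by blast
qed (use assms in auto)

lemma comm_K: "g \<in> G \<Longrightarrow> h \<in> G \<Longrightarrow> comm g h \<in> K"
proof -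
  assume g: "g \<in> G" and h: "h \<in> G"
  have "g \<cdot> h \<cdot> inv_H (h \<cdot> g) \<in> K"
  proof (rule K_diffI)
    show "[e i (g \<cdot> h) = e i (h \<cdot> g)] (mod int m)" for i
      using e_mult[OF g h, of i] e_mult[OF h g, of i]
      by (metis add.commute cong_sym cong_trans)
  qed (use g h in auto)
  then show ?thesis using g h by (simp add: H.inv_mult_group H.m_assoc)
qed

lemma e_conj:
  assumes "g \<in> G" "p \<in> G"
  shows "e i (inv_H p \<cdot> g \<cdot> p) = e i g"
proof (rule e_eqI)
  have "[e i (inv_H p \<cdot> g \<cdot> p) = - e i p + e i g + e i p] (mod int m)"
    using e_mult[of "inv_H p \<cdot> g" p i] e_mult[of "inv_H p" g i] e_inv[of p i] assms
    by (meson H.inv_closed H.m_closed cong_add cong_refl cong_trans)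
  then show "[e i (inv_H p \<cdot> g \<cdot> p) = e i g] (mod int m)" by simp
qed (use assms in auto)

lemma K_subgroup: "subgroup K H"
proof (rule H.subgroupI)
  show "K \<subseteq> G" "K \<noteq> {}" using K_one K_G by blast+
  show "inv_H g \<in> K" if "g \<in> K" for g
    using K_diffI[of one_H g] that by (simp add: K_e)
  show "g \<cdot> h \<in> K" if "g \<in> K" "h \<in> K" for g h
  proof -
    have "g \<cdot> inv_H (inv_H h) \<in> K"
    proof (rule K_diffI)
      show "[e i g = e i (inv_H h)] (mod int m)" if "i \<in> I" for i
        using e_inv[of h i] K_e[OF \<open>g \<in> K\<close> that] K_e[OF \<open>h \<in> K\<close> that] \<open>h \<in> K\<close>
        by (simp add: cong_sym)
    qed (use that in auto)
    then show ?thesis using that by simp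
  qed
qed

text \<open>In the abelianization a word is the product of the generators raised to their total exponents, and
  these powers are trivial if the exponents are divisible by \<open>m\<close>.\<close>

lemma K_subset_derived: "K \<subseteq> derived H G"
proof
  fix k assume k: "k \<in> K"
  let ?D = "derived H G"
  let ?Q = "H Mod ?D"
  interpret Q: comm_group ?Q by (rule H.derived_quot_is_comm_group)
  interpret D: normal ?D H by (rule H.derived_self_is_normal)
  have D: "subgroup ?D H" by (rule D.subgroup_axioms)
  let ?h = "\<lambda>g. ?D #>\<^bsub>H\<^esub> g"
  have hom: "?h \<in> hom H ?Q" by (rule D.r_coset_hom_Mod)
  interpret h: group_hom H ?Q ?h by unfold_locales (rule hom)
  have cl: "?h g \<in> carrier ?Q" if "g \<in> G" for g using that by (rule h.hom_closed)
  have word: "?h (wv w) = finprod ?Q (\<lambda>i. ?h (a i [^]\<^bsub>H\<^esub> word_exponent i w)) I" if "w \<in> W" for w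
    using that
  proof (induction w)
    case Nil
    have "?h (a i [^]\<^bsub>H\<^esub> word_exponent i []) = \<one>\<^bsub>?Q\<^esub>" if "i \<in> I" for i
      using h.hom_one by simp
    then show ?case using h.hom_one by (simp add: Q.finprod_one_eqI)
  next
    case (Cons p w)
    let ?f = "\<lambda>i. ?h (a i [^]\<^bsub>H\<^esub> snd p)"
    have p: "fst p \<in> I" and w: "w \<in> W" using Cons.prems by auto
    have "?h (wv (p # w)) = ?f (fst p) \<otimes>\<^bsub>?Q\<^esub> ?h (wv w)"
      using p w by simp
    also have "?f (fst p) = finprod ?Q (\<lambda>i. if fst p = i then ?f i else \<one>\<^bsub>?Q\<^esub>) I"
      using Q.finprod_singleton[of "fst p" I ?f] p cl by auto
    also have "\<dots> \<otimes>\<^bsub>?Q\<^esub> ?h (wv w) = finprod ?Q (\<lambda>i. (if fst p = i then ?f i else \<one>\<^bsub>?Q\<^esub>)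
        \<otimes>\<^bsub>?Q\<^esub> ?h (a i [^]\<^bsub>H\<^esub> word_exponent i w)) I"
      unfolding Cons.IH[OF w] by (rule Q.finprod_multf[symmetric]) (use cl Q.one_closed in auto)
    also have "\<dots> = finprod ?Q (\<lambda>i. ?h (a i [^]\<^bsub>H\<^esub> word_exponent i (p # w))) I"
    proof (rule Q.finprod_cong')
      fix i assume i: "i \<in> I"
      show "(if fst p = i then ?f i else \<one>\<^bsub>?Q\<^esub>) \<otimes>\<^bsub>?Q\<^esub> ?h (a i [^]\<^bsub>H\<^esub> word_exponent i w)
          = ?h (a i [^]\<^bsub>H\<^esub> word_exponent i (p # w))"
      proof (cases "fst p = i")
        case True
        then show ?thesis using i h.hom_mult[symmetric] by (simp add: H.int_pow_mult)
      next
        case False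
        then show ?thesis using i Q.l_one[OF cl] by simp
      qed
    qed (use cl in auto)
    finally show ?case .
  qed
  obtain w where w: "w \<in> W" "wv w = k" using G_word[of k] k by auto
  have "?h (a i [^]\<^bsub>H\<^esub> word_exponent i w) = \<one>\<^bsub>?Q\<^esub>" if "i \<in> I" for i
  proof -
    have "int m dvd word_exponent i w"
      using w e_word[OF w(1), of i] K_e[OF k that] by auto
    then have "a i [^]\<^bsub>H\<^esub> word_exponent i w = one_H" using a_int_pow_trivial[OF that] by simp
    then show ?thesis using h.hom_one by simp
  qed
  then have "?h k = \<one>\<^bsub>?Q\<^esub>" using word[OF w(1)] w(2) by (simp add: Q.finprod_one_eqI)
  then have "?h k = ?D" by (simp add: FactGroup_def)
  then show "k \<in> ?D" using H.coset_join1[OF _ K_G[OF k] D] by simp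
qed

text \<open>The form in which the equality of \<open>K\<close> with the commutator subgroup is used.\<close>

lemma K_subsetI:
  assumes "subgroup M H" "\<And>g h. g \<in> G \<Longrightarrow> h \<in> G \<Longrightarrow> comm g h \<in> M"
  shows "K \<subseteq> M"
proof -
  have "derived H G \<subseteq> M"
    unfolding derived_def by (rule H.generate_subgroup_incl[OF _ assms(1)]) (use assms(2) in auto)
  then show ?thesis using K_subset_derived by blast
qed


section \<open>Self-replication\<close>

text \<open>Step through the letters one at a time, with a generator that moves the current letter and is
  therefore trivial below it.\<close>

lemma path:
  assumes "x \<in> I" "y \<in> I"
  shows "\<exists>p\<in>G. rt p x = y \<and> sec p x = one_H"
proof -
  have "\<exists>p\<in>G. rt p x = after x k \<and> sec p x = one_H" for k
  proof (induction k)
    case 0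
    show ?case using assms by (intro bexI[of _ one_H]) (auto simp: rt_one sec_one' after_0)
  next
    case (Suc k)
    then obtain p where p: "p \<in> G" "rt p x = after x k" "sec p x = one_H" by blast
    define j where "j = after x (d + k - 1)"
    have j: "j \<in> I" by (simp add: j_def)
    have "d + k - 1 + 1 = d + k" "d + k - 1 + 2 = d + Suc k" using d3 by auto
    then have c1: "after j 1 = after x k" and c2: "after j 2 = after x (Suc k)"
      using assms(1) by (simp_all only: j_def after_after after_period(1))
    \<comment> \<open>A generator that moves a point has trivial section there.\<close>
    have "after j 1 \<noteq> j" using after_inj[OF j, of 1 0] d3 after_0[OF j] by simp
    then have "sec (a j) (after x k) = one_H" using c1 by (simp add: sec_a)
    moreover have "rt (a j) (after x k) = after x (Suc k)"
      using cycle_after[OF j, of 1] c1 c2 d3 m2 md by (simp add: rt_a)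
    ultimately show ?case
      using p j assms by (intro bexI[of _ "p \<cdot> a j"]) (auto simp: rt_mult sec_mult')
  qed
  then show ?thesis using after_surj[OF assms] by blast
qed

text \<open>Transport a generator, which fixes its own index, along a path with trivial section.\<close>

lemma fractal:
  assumes "g \<in> G" "x \<in> I"
  shows "\<exists>h\<in>G. rt h x = x \<and> sec h x = g"
proof -
  have inv: "\<exists>h\<in>G. rt h x = x \<and> sec h x = inv_H g"
    if "\<exists>h\<in>G. rt h x = x \<and> sec h x = g" for g
  proof -
    from that obtain h where h: "h \<in> G" "rt h x = x" "sec h x = g" by blast
    then show ?thesis using sec_inv[of h x] rt_inv(1)[of h x] assms(2)
      by (intro bexI[of _ "inv_H h"]) auto
  qed
  have gen: "\<exists>h\<in>G. rt h x = x \<and> sec h x = a i" if i: "i \<in> I" for i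
  proof -
    obtain p where p: "p \<in> G" "rt p i = x" "sec p i = one_H" using path[OF i assms(2)] by blast
    have r: "rt (inv_H p) x = i" "sec (inv_H p) x = one_H"
      using rt_inv(1)[of p i] sec_inv[of p i] p i by auto
    then show ?thesis
      using p i assms(2)
      by (intro bexI[of _ "inv_H p \<cdot> a i \<cdot> p"]) (auto simp: rt_mult sec_mult' rt_a sec_a cycle_fix)
  qed
  show ?thesis
    using assms(1)
  proof (induction rule: G_induct)
    case one
    show ?case by (intro bexI[of _ one_H]) (auto simp: rt_one sec_one')
  next
    case (mult g h)
    then obtain g' h' where "g' \<in> G" "rt g' x = x" "sec g' x = g" "h' \<in> G" "rt h' x = x" "sec h' x = h"
      by blast
    then show ?case using assms(2)
      by (intro bexI[of _ "g' \<cdot> h'"]) (auto simp: rt_mult sec_mult')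
  qed (use gen inv in auto)
qed


section \<open>Three-cycles on the first level\<close>

declare cycle_of_list.simps [simp del]

lemma cycle3 [simp]:
  "x \<noteq> y \<Longrightarrow> x \<noteq> z \<Longrightarrow> cycle_of_list [x, y, z] x = y"
  "x \<noteq> z \<Longrightarrow> y \<noteq> z \<Longrightarrow> cycle_of_list [x, y, z] y = z"
  "cycle_of_list [x, y, z] z = x"
  "w \<noteq> x \<Longrightarrow> w \<noteq> y \<Longrightarrow> w \<noteq> z \<Longrightarrow> cycle_of_list [x, y, z] w = w"
  by (auto simp: transpose_def cycle_of_list.simps)

text \<open>The triples with this property for a subgroup \<open>Q\<close> form a hypergraph on the letters, which is closed
  under the operations below.\<close>

definition has_cycle :: "(nat list \<Rightarrow> nat list) set \<Rightarrow> nat \<Rightarrow> nat \<Rightarrow> nat \<Rightarrow> bool"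
  where "has_cycle Q x y z \<longleftrightarrow> distinct [x, y, z] \<and> {x, y, z} \<subseteq> I \<and> (\<exists>g\<in>Q. rt g = cycle_of_list [x, y, z])"

lemma has_cycle_rotate: "has_cycle Q x y z \<Longrightarrow> has_cycle Q y z x"
  using cycle_of_list_rotate_independent[of "[x, y, z]" 1] unfolding has_cycle_def
  by (auto simp: rotate1_def[symmetric] One_nat_def)

lemma has_cycle_flip:
  assumes "subgroup Q H" "has_cycle Q x y z"
  shows "has_cycle Q y x z"
proof -
  obtain g where g: "g \<in> Q" "rt g = cycle_of_list [x, y, z]" and dist: "distinct [x, y, z]"
    using assms(2) by (auto simp: has_cycle_def)
  have gG: "g \<in> G" using g(1) subgroup.subset[OF assms(1)] by blast
  have "rt (inv_H g) w = cycle_of_list [y, x, z] w" for w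
  proof -
    have "rt (inv_H g) (rt g (cycle_of_list [y, x, z] w)) = cycle_of_list [y, x, z] w"
      by (rule rt_inv(1)[OF gG])
    moreover have "cycle_of_list [x, y, z] (cycle_of_list [y, x, z] w) = w"
    proof -
      have "x \<noteq> y" "y \<noteq> x" "x \<noteq> z" "y \<noteq> z" using dist by auto
      note ne = this
      consider "w = x" | "w = y" | "w = z" | "w \<noteq> x" "w \<noteq> y" "w \<noteq> z" by blast
      then show ?thesis by cases (simp_all add: ne)
    qed
    ultimately show ?thesis by (simp only: g(2))
  qed
  moreover have "inv_H g \<in> Q" using g(1) assms(1) by (simp add: subgroup.m_inv_closed)
  ultimately show ?thesis using assms(2) unfolding has_cycle_def by auto
qed

lemma has_cycle_conj:
  assumes "subgroup Q H" "has_cycle Q x y z" "q \<in> G" "\<And>g. g \<in> Q \<Longrightarrow> inv_H q \<cdot> g \<cdot> q \<in> Q"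
  shows "has_cycle Q (rt q x) (rt q y) (rt q z)"
proof -
  obtain g where g: "g \<in> Q" "rt g = cycle_of_list [x, y, z]" and dist: "distinct [x, y, z]"
    using assms(2) by (auto simp: has_cycle_def)
  have gG: "g \<in> G" using g(1) subgroup.subset[OF assms(1)] by blast
  have bij: "bij (rt q)" using permutes_bij[OF rt_permutes[OF assms(3)]] .
  have "inv' (rt q) w = rt (inv_H q) w" for w
    using assms(3) by (simp add: inv_f_eq[OF bij_is_inj[OF bij]] rt_inv)
  then have "rt (inv_H q \<cdot> g \<cdot> q) = rt q \<circ> rt g \<circ> inv' (rt q)"
    using assms(3) gG by (auto simp: rt_mult)
  also have "\<dots> = cycle_of_list [rt q x, rt q y, rt q z]"
    using conjugation_of_cycle[OF dist bij] g(2) by simp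
  finally show ?thesis
    using assms(2,3) assms(4)[OF g(1)] unfolding has_cycle_def by auto
qed

lemma has_cycle_conj_self:
  assumes "subgroup Q H" "has_cycle Q x y z" "has_cycle Q u v w"
  shows "has_cycle Q (cycle_of_list [u, v, w] x) (cycle_of_list [u, v, w] y) (cycle_of_list [u, v, w] z)"
proof -
  obtain q where q: "q \<in> Q" "rt q = cycle_of_list [u, v, w]" using assms(3) by (auto simp: has_cycle_def)
  interpret Q: subgroup Q H by (rule assms(1))
  show ?thesis unfolding q(2)[symmetric]
    by (rule has_cycle_conj[OF assms(1,2)]) (use q(1) Q.subset in auto)
qed

text \<open>Conjugating one of two overlapping 3-cycles by the other moves the common letter; the cases are the
  possible overlaps of the two triples.\<close>

lemma has_cycle_chain:
  assumes Q: "subgroup Q H" and xy: "has_cycle Q x y u" and yz: "has_cycle Q y z v" and "x \<noteq> z"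
  shows "has_cycle Q x y z"
proof -
  note perm = has_cycle_rotate has_cycle_flip[OF Q]
  have dist: "distinct [x, y, u]" "distinct [y, z, v]" using xy yz by (auto simp: has_cycle_def)
  have *: "has_cycle Q x y z" if "has_cycle Q x y u" "has_cycle Q x z u" "distinct [x, y, z, u]"
  proof -
    have "has_cycle Q u x z" using that(2) perm by blast
    from has_cycle_conj_self[OF Q that(1) this] have "has_cycle Q z y x"
      using that(3) by simp
    then show ?thesis using perm by blast
  qed
  consider "u = z" | "v = x" | "u = v" | "u \<noteq> z" "v \<noteq> x" "u \<noteq> v" by blast
  then show ?thesis
  proof cases
    case 2
    then show ?thesis using yz perm by blast
  next
    case 3
    have "has_cycle Q u y z" using yz 3 perm by blast
    from has_cycle_conj_self[OF Q xy this] have "has_cycle Q x z y"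
      using dist assms(4) 3 by simp
    then show ?thesis using perm by blast
  next
    case 4
    have "u \<noteq> y" "x \<noteq> v" using dist 4 by auto
    with has_cycle_conj_self[OF Q xy yz] have "has_cycle Q x z u"
      using dist assms(4) 4 by simp
    then show ?thesis using * xy dist 4 assms(4) by auto
  qed (use xy in simp)
qed

text \<open>By \<open>has_cycle_chain\<close>, lying on a common triple is a transitive relation on letters, so it is enough
  to connect neighbouring letters.\<close>

lemma has_cycle_all:
  assumes Q: "subgroup Q H" and step: "\<And>i. i \<in> I \<Longrightarrow> \<exists>u. has_cycle Q i (after i 1) u"
    and "distinct [x, y, z]" "{x, y, z} \<subseteq> I"
  shows "has_cycle Q x y z"
proof -
  note perm = has_cycle_rotate has_cycle_flip[OF Q]
  have *: "\<exists>u. has_cycle Q x y u" if xy: "x \<in> I" "y \<in> I" "x \<noteq> y" for x y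
  proof -
    have "after x k = x \<or> (\<exists>u. has_cycle Q x (after x k) u)" for k
    proof (induction k)
      case 0
      then show ?case using xy by (simp add: after_0)
    next
      case (Suc k)
      obtain u where u: "has_cycle Q (after x k) (after x (Suc k)) u"
        using step[of "after x k"] after_after[OF xy(1), of k 1] Suc_eq_plus1[of k] by auto
      from Suc show ?case
      proof
        assume "after x k = x"
        then show ?thesis using u by auto
      next
        assume "\<exists>v. has_cycle Q x (after x k) v"
        then obtain v where "has_cycle Q x (after x k) v" by blast
        have "has_cycle Q x (after x k) (after x (Suc k))" if "after x (Suc k) \<noteq> x"
          using has_cycle_chain[OF Q \<open>has_cycle Q x (after x k) v\<close> u] that by auto
        then show ?thesis using perm by blast
      qed
    qed
    then show ?thesis using after_surj[OF xy(1,2)] xy(3) by metis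
  qed
  obtain u v where "has_cycle Q x y u" "has_cycle Q y z v" using *[of x y] *[of y z] assms(3,4) by auto
  then show ?thesis using has_cycle_chain[OF Q] assms(3) by auto
qed

lemma alt_realized:
  assumes Q: "subgroup Q H" and "\<And>x y z. distinct [x, y, z] \<Longrightarrow> {x, y, z} \<subseteq> I \<Longrightarrow> has_cycle Q x y z"
    and "\<tau> \<in> carrier (alt_group d)"
  shows "\<exists>g\<in>Q. rt g = \<tau>"
proof -
  interpret Q: subgroup Q H by (rule Q)
  have "\<tau> \<in> generate (alt_group d) (three_cycles d)"
    using assms(3) alt_group_carrier_as_three_cycles by simp
  then show ?thesis
  proof induction
    case one
    then show ?case by (intro bexI[of _ one_H]) (auto simp: alt_group_one rt_one)
  next
    case (incl \<tau>)
    then obtain cs where cs: "\<tau> = cycle_of_list cs" "distinct cs" "length cs = 3" "set cs \<subseteq> I" by auto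
    then obtain x y z where "cs = [x, y, z]" using stupid_lemma by blast
    then show ?case using assms(2)[of x y z] cs unfolding has_cycle_def by auto
  next
    case (inv \<tau>)
    then obtain cs where cs: "\<tau> = cycle_of_list cs" "distinct cs" "length cs = 3" "set cs \<subseteq> I" by auto
    then obtain x y z where "cs = [x, y, z]" using stupid_lemma by blast
    then obtain g where g: "g \<in> Q" "rt g = \<tau>" using assms(2)[of x y z] cs unfolding has_cycle_def by auto
    have "\<tau> \<in> carrier (alt_group d)" using inv three_cycles_incl by blast
    moreover have "inv' \<tau> w = rt (inv_H g) w" for w
      using g Q.subset by (auto intro!: inv_f_eq simp: rt_inv permutes_inj[OF rt_permutes] simp flip: g(2))
    ultimately show ?case
      using g Q.m_inv_closed alt_group_inv_equality by (intro bexI[of _ "inv_H g"]) auto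
  next
    case (eng \<sigma> \<tau>)
    then obtain g h where "g \<in> Q" "rt g = \<sigma>" "h \<in> Q" "rt h = \<tau>" by blast
    then show ?case using Q.subset
      by (intro bexI[of _ "h \<cdot> g"]) (auto simp: alt_group_mult rt_mult)
  qed
qed

section \<open>Elements with small support\<close>

text \<open>The generators \<open>a i\<close> and \<open>a (after i 1)\<close> act almost in the same way; their quotient is a
  3-cycle with only two nontrivial sections.\<close>

definition b where "b i = a i \<cdot> inv_H (a (after i 1))"

lemma b_G [simp]: "i \<in> I \<Longrightarrow> b i \<in> G" by (simp add: b_def)

text \<open>The cycle of a generator in terms of the positions counted from another letter.\<close>

lemma cycle_shift:
  assumes i: "i \<in> I" and "s \<le> d" "k \<le> d" "s \<le> k"
  shows "hanoi_cycle d m (after i s) (after i k) =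
    (if k = s \<or> m < k - s then after i k else if k - s = m then after i (s + 1) else after i (k + 1))"
proof (cases "k - s = d")
  case True
  then have "s = 0" "k = d" using assms by auto
  then show ?thesis using i md by (simp add: after_0 after_period cycle_fix)
next
  case False
  then show ?thesis
    using cycle_after[of "after i s" "k - s"] assms by (auto simp: after_after[OF i])
qed

lemma cycle_after_next:
  assumes i: "i \<in> I" and k: "1 \<le> k" "k \<le> d"
  shows "hanoi_cycle d m (after i 1) (after i k) =
    (if k = 1 \<or> m + 1 < k then after i k else if k = m + 1 then after i 2 else after i (k + 1))"
  using cycle_shift[OF i, of 1 k] k md m2 by auto

lemma after_cases: "i \<in> I \<Longrightarrow> x \<in> I \<Longrightarrow> \<exists>k. 1 \<le> k \<and> k \<le> d \<and> x = after i k"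
proof -
  assume i: "i \<in> I" and x: "x \<in> I"
  then obtain k where "k < d" "x = after i k" using after_surj by blast
  moreover have "after i 0 = after i d" using i by (simp add: after_0 after_period)
  ultimately show ?thesis using d3 by (cases "k = 0") (auto intro: exI[of _ d] exI[of _ k])
qed

lemma after_inj': "i \<in> I \<Longrightarrow> 1 \<le> j \<Longrightarrow> j \<le> d \<Longrightarrow> 1 \<le> k \<Longrightarrow> k \<le> d \<Longrightarrow> after i j = after i k \<longleftrightarrow> j = k"
proof -
  assume i: "i \<in> I" and jk: "1 \<le> j" "j \<le> d" "1 \<le> k" "k \<le> d"
  show ?thesis
    using after_inj[OF i, of j k] after_inj[OF i, of j 0] after_inj[OF i, of 0 k] jk after_0[OF i] after_period(2)[OF i]
    by (cases "j = d"; cases "k = d") auto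
qed

text \<open>Compare the action of \<open>a i\<close> with that of the next generator after the 3-cycle, position by
  position.  Positions run through \<open>1, \<dots>, d\<close>, with \<open>d\<close> standing for \<open>i\<close> itself.\<close>

lemma rt_b:
  assumes i: "i \<in> I"
  shows "rt (b i) = cycle_of_list [after i 1, after i (m + 1), after i m]"
proof
  fix x
  let ?\<tau> = "cycle_of_list [after i 1, after i (m + 1), after i m]"
  show "rt (b i) x = ?\<tau> x"
  proof (cases "x \<in> I")
    case True
    then obtain k where k: "1 \<le> k" "k \<le> d" "x = after i k" using after_cases[OF i] by blast
    have ne: "after i 1 \<noteq> after i (m + 1)" "after i 1 \<noteq> after i m" "after i (m + 1) \<noteq> after i m"
      using after_inj'[OF i] md m2 by auto
    have \<sigma>: "hanoi_cycle d m i x =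
        (if m < k then after i k else if k = m then after i 1 else after i (k + 1))"
      using cycle_after[OF i, of k] cycle_fix[OF i] after_period(2)[OF i] k md by (cases "k = d") auto
    have "hanoi_cycle d m (after i 1) (?\<tau> x) = hanoi_cycle d m i x"
    proof -
      consider "k = 1" | "k = m" | "k = m + 1" | "k \<noteq> 1" "k \<noteq> m" "k \<noteq> m + 1" by blast
      then show ?thesis
      proof cases
        case 1
        then show ?thesis using ne \<sigma> k cycle_after_next[OF i, of "m + 1"] md m2
          by (simp add: eval_nat_numeral One_nat_def)
      next
        case 2
        then show ?thesis using ne \<sigma> k cycle_after_next[OF i, of 1] md m2 by simp
      next
        case 3
        then show ?thesis using ne \<sigma> k cycle_after_next[OF i, of m] md m2 by simp
      next
        case 4
        then have "?\<tau> x = x" using k after_inj'[OF i] md m2 by auto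
        then show ?thesis using 4 \<sigma> k cycle_after_next[OF i, of k] by auto
      qed
    qed
    then have "rt (b i) x = rt (inv_H (a (after i 1))) (rt (a (after i 1)) (?\<tau> x))"
      using i by (simp add: b_def rt_mult rt_a)
    then show ?thesis by (simp add: rt_inv)
  next
    case False
    then have "x \<noteq> after i k" for k by auto
    then show ?thesis using False i by (simp add: root_perm_off[OF G_tree])
  qed
qed

lemma sec_b:
  assumes i: "i \<in> I" and x: "x \<in> I"
  shows "sec (b i) x = (if x = i then a i else if x = after i m then inv_H (a (after i 1)) else one_H)"
proof -
  let ?j = "after i 1" and ?y = "rt (inv_H (a (after i 1))) (hanoi_cycle d m i x)"
  have im: "after i m \<noteq> i" using after_inj[OF i, of m 0] after_0[OF i] md m2 by auto
  have "?y = ?j \<longleftrightarrow> hanoi_cycle d m i x = ?j"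
    using rt_inv[of "a ?j"] cycle_fix[of ?j] by (metis a_G after_I rt_a)
  also have "\<dots> \<longleftrightarrow> x = after i m"
  proof -
    have "hanoi_cycle d m i (after i m) = ?j" using cycle_after[OF i, of m] md m2 by simp
    then show ?thesis using rt_inj[of "a i" x "after i m"] i by (simp add: rt_a)
  qed
  finally have y: "?y = ?j \<longleftrightarrow> x = after i m" .
  have xI: "hanoi_cycle d m i x \<in> I" using rt_I[of "a i" x] i x by (simp add: rt_a)
  then have "?y \<in> I" by simp
  then have "sec (inv_H (a ?j)) (hanoi_cycle d m i x) = inv_H (if ?y = ?j then a ?j else one_H)"
    using sec_inv'[of "a ?j" "hanoi_cycle d m i x"] xI by (simp add: sec_a)
  then show ?thesis using i x y im by (auto simp: b_def sec_mult' sec_a rt_a)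
qed

lemma has_cycle_b: "i \<in> I \<Longrightarrow> has_cycle G (after i 1) (after i (m + 1)) (after i m)"
  using rt_b[of i] b_G[of i] after_inj'[of i] md m2 unfolding has_cycle_def by fastforce

lemma G_subgroup_self: "subgroup G H" by (rule H.subgroup_self)

text \<open>The support of \<open>b\<close> contains the neighbouring letters at distance \<open>m\<close> and \<open>m + 1\<close>.\<close>

lemma has_cycle_step:
  assumes Q: "subgroup Q H" and b: "\<And>i. i \<in> I \<Longrightarrow> has_cycle Q (after i 1) (after i (m + 1)) (after i m)"
    and i: "i \<in> I"
  shows "\<exists>u. has_cycle Q i (after i 1) u"
proof -
  let ?i = "after i (d - m)"
  have "after ?i m = i" "after ?i (m + 1) = after i 1"
    using after_after[OF i, of "d - m" m] after_after[OF i, of "d - m" "m + 1"] after_period[OF i] md by simp_all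
  then have "has_cycle Q (after ?i 1) (after i 1) i" using b[of ?i] by simp
  then show ?thesis using has_cycle_rotate has_cycle_flip[OF Q] by blast
qed

lemma has_cycle_G: "distinct [x, y, z] \<Longrightarrow> {x, y, z} \<subseteq> I \<Longrightarrow> has_cycle G x y z"
  by (rule has_cycle_all[OF G_subgroup_self has_cycle_step[OF G_subgroup_self has_cycle_b]])

lemma exists_outside:
  assumes "finite S" "card S < d"
  shows "\<exists>z\<in>I. z \<notin> S"
proof (rule ccontr)
  assume "\<not> (\<exists>z\<in>I. z \<notin> S)"
  then have "I \<subseteq> S" by auto
  then show False using assms card_mono[of S I] by simp
qed

text \<open>The cube of \<open>b i\<close>.  As \<open>m + 1 < d\<close>, the letter \<open>i\<close> is outside the 3-cycle, so each of the
  three letters of the cycle collects exactly one factor.\<close>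

lemma repeated_generator_small:
  assumes j: "j \<in> I" and "5 \<le> d" "m + 2 \<le> d"
  shows "\<exists>n\<in>St. \<exists>x\<in>I. \<exists>y\<in>I. \<exists>z\<in>I. distinct [x, y, z] \<and>
    sec n x = inv_H (a j) \<and> sec n y = inv_H (a j) \<and> sec n z = one_H"
proof -
  define i where "i = after j (d - 1)"
  have i: "i \<in> I" by (simp add: i_def)
  have j1: "after i 1 = j" using j d3 by (simp add: i_def after_after after_period)
  let ?x = "after i 1" and ?y = "after i m" and ?w = "after i (m + 1)"
  have "card {i, ?x, ?y, ?w} \<le> 4" by (auto simp: card_insert_if)
  then obtain z where z: "z \<in> I" "z \<notin> {i, ?x, ?y, ?w}"
    using exists_outside[of "{i, ?x, ?y, ?w}"] assms(2) by fastforce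
  have ne: "?x \<noteq> i" "?y \<noteq> i" "?w \<noteq> i" "?x \<noteq> ?y" "?x \<noteq> ?w" "?w \<noteq> ?y"
    using after_inj[OF i, of 1 0] after_inj[OF i, of m 0] after_inj[OF i, of "m + 1" 0] after_0[OF i]
      after_inj[OF i, of 1 m] after_inj[OF i, of 1 "m + 1"] after_inj[OF i, of "m + 1" m] assms m2 by auto
  define n where "n = b i \<cdot> b i \<cdot> b i"
  have r: "rt (b i) ?x = ?w" "rt (b i) ?w = ?y" "rt (b i) ?y = ?x"
    "\<And>v. v \<noteq> ?x \<Longrightarrow> v \<noteq> ?w \<Longrightarrow> v \<noteq> ?y \<Longrightarrow> rt (b i) v = v"
    using ne by (simp_all add: rt_b[OF i])
  have "rt n v = v" for v
  proof -
    have "rt n v = rt (b i) (rt (b i) (rt (b i) v))" using i by (simp add: n_def rt_mult)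
    then show ?thesis using r by metis
  qed
  then have n: "n \<in> St" using i by (intro StI) (auto simp: n_def)
  have s: "sec n v = sec (b i) v \<cdot> sec (b i) (rt (b i) v) \<cdot> sec (b i) (rt (b i) (rt (b i) v))" if "v \<in> I" for v
    using that i by (simp add: n_def sec_mult' rt_mult)
  have "sec n ?x = inv_H (a j)" "sec n ?y = inv_H (a j)"
    using i ne r by (simp_all add: s sec_b j1[symmetric] del: j1)
  moreover have "sec n z = one_H" using z i r(4)[of z] by (auto simp: s sec_b)
  ultimately show ?thesis using n z ne by (intro bexI[of _ n] bexI[of _ ?x] bexI[of _ ?y] bexI[of _ z]) auto
qed

text \<open>Here \<open>i\<close> is itself a letter of the 3-cycle of \<open>b i\<close>, and the cube of \<open>b i\<close> would mix
  generators.  The product of \<open>b i\<close> with the next such element is a product of two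
  transpositions; its square has the required sections, because two of its factors cancel.\<close>

lemma repeated_generator_large:
  assumes i: "i \<in> I" and "5 \<le> d" "m + 1 = d"
  shows "\<exists>n\<in>St. \<exists>x\<in>I. \<exists>y\<in>I. \<exists>z\<in>I. distinct [x, y, z] \<and>
    sec n x = a i \<and> sec n y = a i \<and> sec n z = one_H"
proof -
  let ?j = "after i 1" and ?m = "after i m" and ?k = "after i 2" and ?z = "after i 3"
  have "after i (m + 1) = i" "after ?j m = i" "after ?j (m + 1) = ?j" "after ?j 1 = ?k"
    using after_after[OF i, of 1 m] after_after[OF i, of 1 "m + 1"] after_after[OF i, of 1 1] after_period(2)[OF i] after_period(1)[OF i, of 1]
      assms(3) by (simp_all add: add.commute)
  then have r: "rt (b i) = cycle_of_list [?j, i, ?m]" "rt (b ?j) = cycle_of_list [?k, ?j, i]"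
    and sb: "\<And>x. x \<in> I \<Longrightarrow> sec (b i) x = (if x = i then a i else if x = ?m then inv_H (a ?j) else one_H)"
      "\<And>x. x \<in> I \<Longrightarrow> sec (b ?j) x = (if x = ?j then a ?j else if x = i then inv_H (a ?k) else one_H)"
    using rt_b[OF i] rt_b[of ?j] sec_b[OF i] sec_b[of ?j] by simp_all
  have ne: "?j \<noteq> i" "?m \<noteq> i" "?k \<noteq> i" "?z \<noteq> i" "?j \<noteq> ?m" "?j \<noteq> ?k" "?j \<noteq> ?z" "?m \<noteq> ?k" "?m \<noteq> ?z" "?k \<noteq> ?z"
    using after_inj[OF i, of _ 0] after_0[OF i] after_inj[OF i, of 1] after_inj[OF i, of m] after_inj[OF i, of 2 3] assms by auto
  note ne' = ne ne[symmetric]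
  have i_neq: "i \<noteq> ?j" "i \<noteq> ?m" "i \<noteq> ?k" "i \<noteq> ?z" using ne by auto
  define u where "u = b i \<cdot> b ?j"
  have u: "u \<in> G" using i by (simp add: u_def)
  have ru: "rt u v = cycle_of_list [?k, ?j, i] (cycle_of_list [?j, i, ?m] v)" for v
    using i by (simp add: u_def rt_mult r)
  have ru': "rt u i = ?m" "rt u ?m = i" "rt u ?j = ?k" "rt u ?k = ?j"
    "\<And>v. v \<noteq> i \<Longrightarrow> v \<noteq> ?m \<Longrightarrow> v \<noteq> ?j \<Longrightarrow> v \<noteq> ?k \<Longrightarrow> rt u v = v"
    using ne' by (simp_all add: ru)
  define n where "n = u \<cdot> u"
  have "rt n v = v" for v
  proof -
    have "rt n v = rt u (rt u v)" using u by (simp add: n_def rt_mult)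
    then show ?thesis using ru' by metis
  qed
  then have n: "n \<in> St" using u by (intro StI) (auto simp: n_def)
  have su: "sec u v = sec (b i) v \<cdot> sec (b ?j) (rt (b i) v)" if "v \<in> I" for v
    using that i by (simp add: u_def sec_mult')
  have "sec u i = a i" "sec u ?m = one_H" "sec u ?z = one_H"
    using i ne' by (simp_all add: su sb r)
  then have "sec n i = a i" "sec n ?m = a i" "sec n ?z = one_H"
    using u i ne' ru' by (simp_all add: n_def sec_mult')
  then show ?thesis using n i ne by (intro bexI[of _ n] bexI[of _ i] bexI[of _ ?m] bexI[of _ ?z]) auto
qed

text \<open>The transpositions of \<open>a i\<close>, \<open>a (after i 1)\<close>, \<open>a (after i 2)\<close> form a path; conjugating the
  last by the other two gives the transposition of the fourth generator.\<close>

lemma repeated_generator_4_2: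
  assumes i: "i \<in> I" and dm: "d = 4" "m = 2"
  shows "\<exists>n\<in>St. \<exists>x\<in>I. \<exists>y\<in>I. \<exists>z\<in>I. distinct [x, y, z] \<and>
    sec n x = a i \<and> sec n y = a i \<and> sec n z = one_H"
proof -
  have p: "after i 4 = i" "after i 5 = after i 1" "after i 6 = after i 2" "after i 0 = i"
    using after_period(2)[OF i] after_period(1)[OF i, of 1] after_period(1)[OF i, of 2] after_0[OF i] dm
    by (simp_all add: eval_nat_numeral One_nat_def)
  have shift: "hanoi_cycle d m (after i s) (after i (s + k)) =
      (if k = 1 then after i (s + 2) else if k = 2 then after i (s + 1) else after i (s + k))" if "k < 4" for k s
  proof -
    have "k < d" using that dm(1) by simp
    from cycle_after[OF after_I this, of i s] show ?thesis
      using that by (auto simp: after_after[OF i] dm(2) add.assoc)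
  qed
  have 0: "rt (a i) i = i" "rt (a i) (after i 1) = after i 2" "rt (a i) (after i 2) = after i 1" "rt (a i) (after i 3) = after i 3"
    using shift[of 0 0] shift[of 1 0] shift[of 2 0] shift[of 3 0] p by (simp_all add: rt_a numeral_2_eq_2[symmetric])
  have 1: "rt (a (after i 1)) i = i" "rt (a (after i 1)) (after i 1) = after i 1" "rt (a (after i 1)) (after i 2) = after i 3" "rt (a (after i 1)) (after i 3) = after i 2"
    using shift[of 0 1] shift[of 1 1] shift[of 2 1] shift[of 3 1] p by (simp_all add: rt_a numeral_2_eq_2[symmetric])
  have 2: "rt (a (after i 2)) i = after i 3" "rt (a (after i 2)) (after i 1) = after i 1" "rt (a (after i 2)) (after i 2) = after i 2" "rt (a (after i 2)) (after i 3) = i"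
    using shift[of 0 2] shift[of 1 2] shift[of 2 2] shift[of 3 2] p by (simp_all add: rt_a numeral_2_eq_2[symmetric])
  have 3: "rt (a (after i 3)) i = after i 1" "rt (a (after i 3)) (after i 1) = i" "rt (a (after i 3)) (after i 2) = after i 2" "rt (a (after i 3)) (after i 3) = after i 3"
    using shift[of 0 3] shift[of 1 3] shift[of 2 3] shift[of 3 3] p by (simp_all add: rt_a numeral_2_eq_2[symmetric])
  have ne: "i \<noteq> after i 1" "i \<noteq> after i 2" "i \<noteq> after i 3" "after i 1 \<noteq> after i 2" "after i 1 \<noteq> after i 3" "after i 2 \<noteq> after i 3"
    using after_inj[OF i, of 0] after_0[OF i] after_inj[OF i, of 1] after_inj[OF i, of 2 3] dm by auto
  define n where "n = a i \<cdot> a (after i 1) \<cdot> a (after i 2) \<cdot> a (after i 1) \<cdot> a i \<cdot> a (after i 3)"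
  have nG: "n \<in> G" using i by (simp add: n_def)
  have "rt n v = v" for v
  proof (cases "v \<in> I")
    case True
    then obtain k where "k < 4" "v = after i k" using after_surj[OF i] dm by auto
    moreover have "k \<in> {0, 1, 2, 3}" using \<open>k < 4\<close> by auto
    ultimately have "v \<in> {i, after i 1, after i 2, after i 3}" using after_0[OF i] by auto
    then show ?thesis using i by (auto simp: n_def rt_mult 0 1 2 3)
  qed (use nG in \<open>simp add: root_perm_off[OF G_tree]\<close>)
  then have n: "n \<in> St" using nG by (intro StI) auto
  have sq: "a j \<cdot> a j = one_H" if j: "j \<in> I" for j
  proof -
    have "Suc (Suc 0) = m" using dm(2) by simp
    then have "a j [^]\<^bsub>H\<^esub> Suc (Suc 0) = one_H" using a_order[OF j] by (simp only:)
    then show ?thesis using j by simp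
  qed
  have "sec n i = a i" "sec n (after i 1) = a i" "sec n (after i 2) = one_H"
    using i ne ne[symmetric] sq unfolding n_def
    by (simp_all add: sec_mult' rt_mult sec_a 0 1 2 3 del: K_G St_G St_rt sec_St_mult)
  then show ?thesis using n i ne by (intro bexI[of _ n] bexI[of _ i] bexI[of _ "after i 1"] bexI[of _ "after i 2"]) auto
qed

text \<open>The two products of consecutive 3-cycles in the definitions of \<open>u\<close> and \<open>w\<close> below are the same
  permutation.\<close>

lemma generator_4_3:
  assumes i: "i \<in> I" and dm: "d = 4" "m = 3"
  shows "\<exists>n\<in>St. sec n (after i 1) = inv_H (a (after i 1)) \<and> sec n (after i 2) = one_H \<and> sec n (after i 3) = a (after i 1)"
proof -
  have p: "after i 4 = i" "after i 5 = after i 1" "after i 6 = after i 2" "after i 0 = i"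
    using after_period(2)[OF i] after_period(1)[OF i, of 1] after_period(1)[OF i, of 2] after_0[OF i] dm
    by (simp_all add: eval_nat_numeral One_nat_def)
  have shift: "hanoi_cycle d m (after i s) (after i (s + k)) =
      (if k = 1 then after i (s + 2) else if k = 2 then after i (s + 3) else if k = 3 then after i (s + 1) else after i (s + k))" if "k < 4" for k s
  proof -
    have "k < d" using that dm(1) by simp
    from cycle_after[OF after_I this, of i s] show ?thesis
      using that by (auto simp: after_after[OF i] dm(2) add.assoc)
  qed
  have 0: "rt (a i) i = i" "rt (a i) (after i 1) = after i 2" "rt (a i) (after i 2) = after i 3" "rt (a i) (after i 3) = after i 1"
    using shift[of 0 0] shift[of 1 0] shift[of 2 0] shift[of 3 0] p by (simp_all add: rt_a numeral_2_eq_2[symmetric])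
  have 1: "rt (a (after i 1)) i = after i 2" "rt (a (after i 1)) (after i 1) = after i 1" "rt (a (after i 1)) (after i 2) = after i 3" "rt (a (after i 1)) (after i 3) = i"
    using shift[of 0 1] shift[of 1 1] shift[of 2 1] shift[of 3 1] p by (simp_all add: rt_a numeral_2_eq_2[symmetric])
  have 2: "rt (a (after i 2)) i = after i 1" "rt (a (after i 2)) (after i 1) = after i 3" "rt (a (after i 2)) (after i 2) = after i 2" "rt (a (after i 2)) (after i 3) = i"
    using shift[of 0 2] shift[of 1 2] shift[of 2 2] shift[of 3 2] p by (simp_all add: rt_a numeral_2_eq_2[symmetric])
  have ne: "i \<noteq> after i 1" "i \<noteq> after i 2" "i \<noteq> after i 3" "after i 1 \<noteq> after i 2" "after i 1 \<noteq> after i 3" "after i 2 \<noteq> after i 3"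
    using after_inj[OF i, of 0] after_0[OF i] after_inj[OF i, of 1] after_inj[OF i, of 2 3] dm by auto
  define u where "u = a i \<cdot> a (after i 1)"
  define w where "w = a (after i 1) \<cdot> a (after i 2)"
  have uw: "u \<in> G" "w \<in> G" using i by (simp_all add: u_def w_def)
  have eq: "rt u v = rt w v" for v
  proof (cases "v \<in> I")
    case True
    then obtain k where "k < 4" "v = after i k" using after_surj[OF i] dm by auto
    moreover have "k \<in> {0, 1, 2, 3}" using \<open>k < 4\<close> by auto
    ultimately have "v \<in> {i, after i 1, after i 2, after i 3}" using after_0[OF i] by auto
    then show ?thesis using i by (auto simp: u_def w_def rt_mult 0 1 2)
  qed (use uw in \<open>simp add: root_perm_off[OF G_tree]\<close>)
  define n where "n = u \<cdot> inv_H w"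
  have n: "n \<in> St" using uw by (intro StI) (auto simp: n_def rt_mult eq rt_inv)
  have s: "sec n v = sec u v \<cdot> inv_H (sec w v)" if "v \<in> I" for v
    using uw that sec_inv[of w v] by (simp add: n_def sec_mult' eq)
  have "sec n (after i 1) = inv_H (a (after i 1))" "sec n (after i 2) = one_H" "sec n (after i 3) = a (after i 1)"
    using i ne ne[symmetric] by (simp_all add: s u_def w_def sec_mult' sec_a rt_mult 0 1 2)
  then show ?thesis using n by blast
qed

end

section \<open>Double transitivity\<close>

locale hanoi4 = hanoi +
  assumes d4: "4 \<le> d"
begin

lemma repeated_generator:
  assumes j: "j \<in> I" and "\<not> (d = 4 \<and> m = 3)"
  shows "\<exists>n\<in>St. \<exists>x\<in>I. \<exists>y\<in>I. \<exists>z\<in>I. \<exists>h\<in>{a j, inv_H (a j)}. distinct [x, y, z] \<and>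
    sec n x = h \<and> sec n y = h \<and> sec n z = one_H"
proof -
  consider "5 \<le> d" "m + 2 \<le> d" | "5 \<le> d" "m + 1 = d" | "d = 4" "m = 2"
    using assms(2) d4 md m2 by linarith
  then show ?thesis
  proof cases
    case 1
    then show ?thesis using repeated_generator_small[OF j] by blast
  next
    case 2
    then show ?thesis using repeated_generator_large[OF j] by blast
  next
    case 3
    then show ?thesis using repeated_generator_4_2[OF j] by blast
  qed
qed

lemma generator_and_trivial:
  assumes j: "j \<in> I"
  shows "\<exists>n\<in>St. \<exists>x\<in>I. \<exists>z\<in>I. x \<noteq> z \<and> sec n x \<in> {a j, inv_H (a j)} \<and> sec n z = one_H"
proof (cases "d = 4 \<and> m = 3")
  case True
  define i where "i = after j (d - 1)"
  have i: "i \<in> I" by (simp add: i_def)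
  have j1: "after i 1 = j" using j d3 by (simp add: i_def after_after after_period)
  have "after i 1 \<noteq> after i 2" using after_inj[OF i, of 1 2] d4 by simp
  then show ?thesis using generator_4_3[OF i] True j1 after_I by blast
next
  case False
  from repeated_generator[OF j this] obtain n x y z h where n: "n \<in> St" "x \<in> I" "z \<in> I" "h \<in> {a j, inv_H (a j)}"
    "distinct [x, y, z]" "sec n x = h" "sec n z = one_H" by blast
  from n(5) have "x \<noteq> z" by simp
  with n show ?thesis by blast
qed

text \<open>The fourth letter is needed for a 3-cycle that fixes one letter and moves a second to a third.\<close>

lemma two_transitive:
  assumes "x \<in> I" "y \<in> I" "x \<noteq> y" "x' \<in> I" "y' \<in> I" "x' \<noteq> y'"
  shows "\<exists>g\<in>G. rt g x = x' \<and> rt g y = y'"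
proof -
  obtain g where g: "g \<in> G" "rt g x = x'" using path[OF assms(1,4)] by blast
  let ?y = "rt g y"
  have y: "?y \<in> I" "?y \<noteq> x'" using g assms by auto
  show ?thesis
  proof (cases "?y = y'")
    case False
    have "card {x', ?y, y'} < d" using d4 by (simp add: card_insert_if)
    then obtain z where z: "z \<in> I" "z \<notin> {x', ?y, y'}" using exists_outside[of "{x', ?y, y'}"] by auto
    then have "has_cycle G ?y y' z" using has_cycle_G[of ?y y' z] False y assms by auto
    then obtain h where h: "h \<in> G" "rt h = cycle_of_list [?y, y', z]" by (auto simp: has_cycle_def)
    have "rt h x' = x'" "rt h ?y = y'"
      unfolding h(2) using False y z assms by (auto intro!: cycle3)
    then show ?thesis using g h by (intro bexI[of _ "g \<cdot> h"]) (auto simp: rt_mult)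
  qed (use g in blast)
qed


section \<open>Exponent matrices of the level-one stabilizer\<close>

text \<open>The matrix \<open>M x i\<close> of exponents, read modulo \<open>m\<close>, occurs as the exponents of the sections
  of an element of \<open>St\<close>; the rows are indexed by the coordinates.\<close>

definition attained :: "(nat \<Rightarrow> nat \<Rightarrow> int) \<Rightarrow> bool"
  where "attained M \<longleftrightarrow> (\<exists>n\<in>St. \<forall>x\<in>I. \<forall>i\<in>I. [e i (sec n x) = M x i] (mod int m))"

lemma attainedI: "n \<in> St \<Longrightarrow> (\<And>x i. x \<in> I \<Longrightarrow> i \<in> I \<Longrightarrow> [e i (sec n x) = M x i] (mod int m)) \<Longrightarrow> attained M"
  by (auto simp: attained_def)

lemma attained_cong:
  "attained M \<Longrightarrow> (\<And>x i. x \<in> I \<Longrightarrow> i \<in> I \<Longrightarrow> [M x i = M' x i] (mod int m)) \<Longrightarrow> attained M'"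
  unfolding attained_def by (meson cong_trans)

lemma attained_add: "attained M \<Longrightarrow> attained M' \<Longrightarrow> attained (\<lambda>x i. M x i + M' x i)"
proof -
  assume "attained M" "attained M'"
  then obtain n n' where n: "n \<in> St" "n' \<in> St"
    "\<And>x i. x \<in> I \<Longrightarrow> i \<in> I \<Longrightarrow> [e i (sec n x) = M x i] (mod int m)"
    "\<And>x i. x \<in> I \<Longrightarrow> i \<in> I \<Longrightarrow> [e i (sec n' x) = M' x i] (mod int m)"
    unfolding attained_def by blast
  show ?thesis
  proof (rule attainedI)
    show "n \<cdot> n' \<in> St" using n by simp
    show "[e i (sec (n \<cdot> n') x) = M x i + M' x i] (mod int m)" if "x \<in> I" "i \<in> I" for x i
      using cong_trans[OF e_mult[of "sec n x" "sec n' x" i] cong_add[OF n(3)[OF that] n(4)[OF that]]]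
        n(1,2) that by simp
  qed
qed

lemma attained_neg: "attained M \<Longrightarrow> attained (\<lambda>x i. - M x i)"
proof -
  assume "attained M"
  then obtain n where n: "n \<in> St"
    "\<And>x i. x \<in> I \<Longrightarrow> i \<in> I \<Longrightarrow> [e i (sec n x) = M x i] (mod int m)"
    unfolding attained_def by blast
  show ?thesis
  proof (rule attainedI)
    show "inv_H n \<in> St" using n by simp
    show "[e i (sec (inv_H n) x) = - M x i] (mod int m)" if "x \<in> I" "i \<in> I" for x i
      using cong_trans[OF e_inv[of "sec n x" i] iffD2[OF cong_minus_minus_iff n(2)[OF that]]]
        n(1) that by simp
  qed
qed

lemma attained_zero: "attained (\<lambda>x i. 0)"
  by (rule attainedI[of one_H]) (auto simp: sec_one')

lemma attained_scale: "attained M \<Longrightarrow> attained (\<lambda>x i. k * M x i)"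
proof -
  assume M: "attained M"
  have nat: "attained (\<lambda>x i. int n * M x i)" for n
  proof (induction n)
    case (Suc n)
    from attained_add[OF M Suc] show ?case by (simp add: distrib_right)
  qed (simp add: attained_zero)
  show ?thesis
  proof (cases "0 \<le> k")
    case True
    then show ?thesis using nat[of "nat k"] by simp
  next
    case False
    then show ?thesis using attained_neg[OF nat[of "nat (- k)"]] by simp
  qed
qed

lemma attained_sum: "finite A \<Longrightarrow> (\<And>t. t \<in> A \<Longrightarrow> attained (M t)) \<Longrightarrow> attained (\<lambda>x i. \<Sum>t\<in>A. M t x i)"
  by (induction A rule: finite_induct) (auto simp: attained_zero intro: attained_add)

lemma attained_conj:
  assumes "attained M" "p \<in> G"
  shows "attained (\<lambda>x i. M (rt (inv_H p) x) i)"
proof -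
  obtain n where n: "n \<in> St"
    "\<And>x i. x \<in> I \<Longrightarrow> i \<in> I \<Longrightarrow> [e i (sec n x) = M x i] (mod int m)"
    using assms(1) unfolding attained_def by blast
  show ?thesis
  proof (rule attainedI)
    show "inv_H p \<cdot> n \<cdot> p \<in> St" using conj_St(1)[OF n(1) assms(2)] .
    show "[e i (sec (inv_H p \<cdot> n \<cdot> p) x) = M (rt (inv_H p) x) i] (mod int m)"
      if x: "x \<in> I" and i: "i \<in> I" for x i
    proof -
      let ?y = "rt (inv_H p) x"
      have y: "?y \<in> I" "rt p ?y = x" using x assms(2) by (simp_all add: rt_inv)
      have "sec (inv_H p \<cdot> n \<cdot> p) x = inv_H (sec p ?y) \<cdot> sec n ?y \<cdot> sec p ?y"
        using conj_St(2)[OF n(1) assms(2) y(1)] y(2) by simp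
      then show ?thesis using n(2)[OF y(1) i] e_conj[of "sec n ?y" "sec p ?y" i] n(1) assms(2) y(1)
        by simp
    qed
  qed
qed

text \<open>The matrix of an element with generator \<open>j\<close> in coordinate \<open>x\<close> and its inverse in
  coordinate \<open>z\<close>.\<close>

definition shift_matrix :: "nat \<Rightarrow> nat \<Rightarrow> nat \<Rightarrow> nat \<Rightarrow> nat \<Rightarrow> int"
  where "shift_matrix j x z u i = (if i = j then of_bool (u = x) - of_bool (u = z) else 0)"

text \<open>Conjugation by a 3-cycle on \<open>x\<close>, \<open>y\<close>, \<open>z\<close> permutes the rows.  Two of the three being equal, the
  difference with the conjugate is nonzero in two rows only.\<close>

lemma attained_shift_if:
  assumes "attained M" "distinct [x, y, z]" "{x, y, z} \<subseteq> I" "s \<in> {1, -1}"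
    "\<And>i. i \<in> I \<Longrightarrow> [M x i = (if i = j then s else 0)] (mod int m)"
    "\<And>i. i \<in> I \<Longrightarrow> [M y i = (if i = j then s else 0)] (mod int m)"
    "\<And>i. i \<in> I \<Longrightarrow> [M z i = 0] (mod int m)"
  shows "attained (shift_matrix j x z)"
proof -
  have "has_cycle G x y z" using has_cycle_G assms(2,3) by blast
  then obtain p where p: "p \<in> G" "rt p = cycle_of_list [x, y, z]" by (auto simp: has_cycle_def)
  have ne: "x \<noteq> y" "x \<noteq> z" "y \<noteq> z" using assms(2) by auto
  have r: "rt (inv_H p) y = x" "rt (inv_H p) z = y" "rt (inv_H p) x = z"
    using rt_inv(1)[OF p(1), of x] rt_inv(1)[OF p(1), of y] rt_inv(1)[OF p(1), of z] ne
    by (simp_all add: p(2))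
  have r': "rt (inv_H p) u = u" if "u \<notin> {x, y, z}" for u
    using rt_inv(1)[OF p(1), of u] that by (simp add: p(2))
  have L: "attained (\<lambda>u i. s * (M u i - M (rt (inv_H p) u) i))"
    using attained_scale[OF attained_add[OF assms(1) attained_neg[OF attained_conj[OF assms(1) p(1)]]], of s] by simp
  have ss: "s * s = 1" using assms(4) by auto
  show ?thesis
  proof (rule attained_cong[OF L])
    fix u i assume u: "u \<in> I" and i: "i \<in> I"
    consider "u = x" | "u = y" | "u = z" | "u \<notin> {x, y, z}" by blast
    then show "[s * (M u i - M (rt (inv_H p) u) i) = shift_matrix j x z u i] (mod int m)"
    proof cases
      case 1
      have "[s * (M x i - M z i) = s * ((if i = j then s else 0) - 0)] (mod int m)"
        by (intro cong_mult cong_diff cong_refl assms i)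
      then show ?thesis using 1 r ne ss by (auto simp: shift_matrix_def)
    next
      case 2
      have "[s * (M y i - M x i) = s * ((if i = j then s else 0) - (if i = j then s else 0))] (mod int m)"
        by (intro cong_mult cong_diff cong_refl assms i)
      then show ?thesis using 2 r ne by (auto simp: shift_matrix_def)
    next
      case 3
      have "[s * (M z i - M y i) = s * (0 - (if i = j then s else 0))] (mod int m)"
        by (intro cong_mult cong_diff cong_refl assms i)
      then show ?thesis using 3 r ne ss by (auto simp: shift_matrix_def)
    next
      case 4
      then show ?thesis using r'[OF 4] by (auto simp: shift_matrix_def)
    qed
  qed
qed

lemma attained_shift_some:
  assumes j: "j \<in> I"
  shows "\<exists>x\<in>I. \<exists>z\<in>I. x \<noteq> z \<and> attained (shift_matrix j x z)"
proof (cases "d = 4 \<and> m = 3")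
  case False
  from repeated_generator[OF j this] obtain n x y z h where n: "n \<in> St" "{x, y, z} \<subseteq> I" "h \<in> {a j, inv_H (a j)}"
    "distinct [x, y, z]" "sec n x = h" "sec n y = h" "sec n z = one_H" by blast
  define s :: int where "s = (if h = a j then 1 else -1)"
  have h: "[e i h = (if i = j then s else 0)] (mod int m)" for i
  proof (cases "h = a j")
    case True
    then show ?thesis using e_gen[OF j, of i] by (simp add: s_def)
  next
    case False
    then have "h = inv_H (a j)" using n(3) by simp
    then show ?thesis using False e_inv[of "a j" i] e_gen[OF j, of i] j by (auto simp: s_def)
  qed
  have "attained (\<lambda>x i. e i (sec n x))" by (rule attainedI[OF n(1)]) simp
  then have "attained (shift_matrix j x z)"
    by (rule attained_shift_if[OF _ n(4,2), where s = s]) (use n h in \<open>auto simp: s_def\<close>)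
  moreover have "x \<noteq> z" using n(4) by simp
  ultimately show ?thesis using n(2) by blast
next
  case True
  define i where "i = after j (d - 1)"
  have i: "i \<in> I" by (simp add: i_def)
  have j1: "after i 1 = j" using j d3 by (simp add: i_def after_after after_period)
  have ne: "i \<noteq> j" "i \<noteq> after i 2" "i \<noteq> after i 3" "j \<noteq> after i 2" "j \<noteq> after i 3" "after i 2 \<noteq> after i 3"
    using after_inj[OF i, of 0] after_0[OF i] after_inj[OF i, of 1] after_inj[OF i, of 2 3] d4 j1 by auto
  from generator_4_3[OF i] True j1 obtain n where n: "n \<in> St" "sec n j = inv_H (a j)"
    "sec n (after i 2) = one_H" "sec n (after i 3) = a j" by auto
  \<comment> \<open>The column of \<open>j\<close> is \<open>-1, 0, 1\<close> on \<open>j, after i 2, after i 3\<close>; rotating and subtracting makes it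
    constant there modulo 3, and clears the remaining row.\<close>
  have "has_cycle G j (after i 2) (after i 3)" using has_cycle_G ne j by simp
  then obtain p where p: "p \<in> G" "rt p = cycle_of_list [j, after i 2, after i 3]" by (auto simp: has_cycle_def)
  have r: "rt (inv_H p) (after i 2) = j" "rt (inv_H p) (after i 3) = after i 2" "rt (inv_H p) j = after i 3"
    "rt (inv_H p) i = i"
    using rt_inv(1)[OF p(1), of j] rt_inv(1)[OF p(1), of "after i 2"] rt_inv(1)[OF p(1), of "after i 3"]
      rt_inv(1)[OF p(1), of i] ne
    by (simp_all add: p(2))
  let ?M = "\<lambda>x i. e i (sec n x) - e i (sec n (rt (inv_H p) x))"
  have "attained (\<lambda>x i. e i (sec n x))" by (rule attainedI[OF n(1)]) simp
  from attained_add[OF this attained_neg[OF attained_conj[OF this p(1)]]] have M: "attained ?M" by simp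
  have inv: "[e k (inv_H (a j)) = (if k = j then -1 else 0)] (mod int m)" for k
    using e_inv[of "a j" k] e_gen[OF j, of k] j by auto
  have 1: "[?M j k = (if k = j then 1 else 0)] (mod int m)" for k
  proof -
    have "[?M j k = (if k = j then -1 else 0) - (if k = j then 1 else 0)] (mod int m)"
      using cong_diff[OF inv[of k] cong_refl[of "e k (a j)"]] n r e_gen[OF j, of k] by simp
    moreover have "[(if k = j then -1 else 0) - (if k = j then 1 else 0) = (if k = j then 1 else 0 :: int)] (mod int m)"
      using True by (simp add: cong_def)
    ultimately show ?thesis using cong_trans by blast
  qed
  have 2: "[?M (after i 2) k = (if k = j then 1 else 0)] (mod int m)" for k
    using cong_diff[OF cong_refl[of 0] inv[of k]] n r by (auto split: if_splits)
  have "attained (shift_matrix j j i)"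
  proof (rule attained_shift_if[OF M, where y = "after i 2" and s = 1])
    show "distinct [j, after i 2, i]" using ne by auto
    show "{j, after i 2, i} \<subseteq> I" using i j by auto
    show "[?M j k = (if k = j then 1 else 0)] (mod int m)" for k by (rule 1)
    show "[?M (after i 2) k = (if k = j then 1 else 0)] (mod int m)" for k by (rule 2)
    show "[?M i k = 0] (mod int m)" for k unfolding r(4) by simp
  qed simp
  moreover have "j \<noteq> i" using ne by simp
  ultimately show ?thesis using i j by (intro bexI[of _ j] bexI[of _ i]) simp_all
qed

lemma attained_shift:
  assumes j: "j \<in> I" and x: "x \<in> I" and z: "z \<in> I"
  shows "attained (shift_matrix j x z)"
proof (cases "x = z")
  case True
  then show ?thesis by (intro attained_cong[OF attained_zero]) (simp add: shift_matrix_def)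
next
  case False
  obtain x' z' where x': "x' \<in> I" "z' \<in> I" "x' \<noteq> z'" and L: "attained (shift_matrix j x' z')"
    using attained_shift_some[OF j] by blast
  obtain p where p: "p \<in> G" "rt p x' = x" "rt p z' = z"
    using two_transitive[OF x' x z False] by blast
  have "rt (inv_H p) u = x' \<longleftrightarrow> u = x" "rt (inv_H p) u = z' \<longleftrightarrow> u = z" for u
    using p rt_inv[OF p(1)] by metis+
  then have "shift_matrix j x' z' (rt (inv_H p) u) i = shift_matrix j x z u i" for u i
    by (simp add: shift_matrix_def)
  then show ?thesis using attained_conj[OF L p(1)] by simp
qed

text \<open>Such a matrix is a combination of the matrices that shift a generator to the first coordinate.\<close>

lemma attained_balanced:
  assumes "\<And>i. i \<in> I \<Longrightarrow> [(\<Sum>x\<in>I. M x i) = 0] (mod int m)"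
  shows "attained M"
proof (rule attained_cong)
  have 1: "1 \<in> I" using d3 by (simp add: atLeastAtMost_iff)
  then show "attained (\<lambda>u i. \<Sum>x\<in>I. \<Sum>j\<in>I. M x j * shift_matrix j x 1 u i)"
    by (intro attained_sum attained_scale attained_shift) auto
  fix u i assume u: "u \<in> I" and i: "i \<in> I"
  have "(\<Sum>x\<in>I. \<Sum>j\<in>I. M x j * shift_matrix j x 1 u i) =
      (\<Sum>x\<in>I. M x i * (of_bool (u = x) - of_bool (u = 1)))"
    using i by (simp add: shift_matrix_def if_distrib[of "\<lambda>t. M _ _ * t"] cong: if_cong)
  also have "\<dots> = M u i - of_bool (u = 1) * (\<Sum>x\<in>I. M x i)"
    using u by (simp add: right_diff_distrib sum_subtractf sum_distrib_left mult.commute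
        of_bool_def if_distrib[of "\<lambda>t. M _ _ * t"] cong: if_cong)
  finally show "[(\<Sum>x\<in>I. \<Sum>j\<in>I. M x j * shift_matrix j x 1 u i) = M u i] (mod int m)"
    using cong_diff[OF cong_refl[of "M u i"] cong_mult[OF cong_refl[of "of_bool (u = 1)"] assms[OF i]]]
    by simp
qed

section \<open>Elements of the stabilizer with prescribed sections\<close>

text \<open>The section in coordinate \<open>x\<close> is \<open>g\<close>, and the sections in the coordinates of \<open>S\<close> are
  trivial; nothing is said about the others.\<close>

definition avoids :: "nat \<Rightarrow> nat set \<Rightarrow> (nat list \<Rightarrow> nat list) \<Rightarrow> bool"
  where "avoids x S g \<longleftrightarrow> (\<exists>n\<in>St. sec n x = g \<and> (\<forall>s\<in>S. sec n s = one_H))"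

lemma avoids_one: "x \<in> I \<Longrightarrow> avoids x S one_H"
  unfolding avoids_def by (intro bexI[of _ one_H]) (auto simp: sec_one')

lemma avoids_mult:
  assumes "x \<in> I" "S \<subseteq> I" "avoids x S g" "avoids x S h"
  shows "avoids x S (g \<cdot> h)"
proof -
  obtain n n' where "n \<in> St" "sec n x = g" "\<forall>s\<in>S. sec n s = one_H"
    "n' \<in> St" "sec n' x = h" "\<forall>s\<in>S. sec n' s = one_H"
    using assms(3,4) unfolding avoids_def by blast
  then show ?thesis using assms(1,2) unfolding avoids_def
    by (intro bexI[of _ "n \<cdot> n'"]) auto
qed

lemma avoids_inv:
  assumes "x \<in> I" "S \<subseteq> I" "avoids x S g"
  shows "avoids x S (inv_H g)"
proof -
  obtain n where "n \<in> St" "sec n x = g" "\<forall>s\<in>S. sec n s = one_H"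
    using assms(3) unfolding avoids_def by blast
  then show ?thesis using assms(1,2) unfolding avoids_def
    by (intro bexI[of _ "inv_H n"]) auto
qed

lemma avoids_G: "x \<in> I \<Longrightarrow> avoids x S g \<Longrightarrow> g \<in> G"
  by (auto simp: avoids_def)

lemma avoids_all:
  assumes "x \<in> I" "S \<subseteq> I" "\<And>j. j \<in> I \<Longrightarrow> avoids x S (a j)" "g \<in> G"
  shows "avoids x S g"
  using assms(4)
  by (induction rule: G_induct) (use assms(1-3) avoids_one avoids_mult avoids_inv in auto)

text \<open>A generator occurs as a section of an element of \<open>St\<close>; a path with trivial section moves it to
  coordinate \<open>x\<close> without conjugating it.\<close>

lemma avoids_empty:
  assumes x: "x \<in> I" and "g \<in> G"
  shows "avoids x {} g"
proof (rule avoids_all[OF x _ _ assms(2)])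
  fix j assume j: "j \<in> I"
  obtain n y where n: "n \<in> St" "y \<in> I" "sec n y \<in> {a j, inv_H (a j)}" using generator_and_trivial[OF j] by blast
  obtain p where p: "p \<in> G" "rt p y = x" "sec p y = one_H" using path[OF n(2) x] by blast
  have "sec (inv_H p \<cdot> n \<cdot> p) x = sec n y"
    using conj_St(2)[OF n(1) p(1) n(2)] p n by simp
  then have "avoids x {} (sec n y)" using conj_St(1)[OF n(1) p(1)] unfolding avoids_def by blast
  moreover from this have "avoids x {} (inv_H (sec n y))" using avoids_inv x by blast
  ultimately show "avoids x {} (a j)" using n(3) j by auto
qed simp

text \<open>Double transitivity moves the pair of coordinates of a suitable element to \<open>x\<close>, \<open>y\<close>.  This
  conjugates the section in \<open>x\<close>, which \<open>avoids_empty\<close> undoes.\<close>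

lemma avoids_single:
  assumes x: "x \<in> I" and y: "y \<in> I" and "x \<noteq> y" and "g \<in> G"
  shows "avoids x {y} g"
proof (rule avoids_all[OF x _ _ assms(4)])
  fix j assume j: "j \<in> I"
  obtain n x' y' where n: "n \<in> St" "x' \<in> I" "y' \<in> I" "x' \<noteq> y'" "sec n x' \<in> {a j, inv_H (a j)}"
    "sec n y' = one_H" using generator_and_trivial[OF j] by blast
  obtain p where p: "p \<in> G" "rt p x' = x" "rt p y' = y"
    using two_transitive[OF n(2-4) x y assms(3)] by blast
  let ?q = "sec p x'"
  have q: "?q \<in> G" using p n by simp
  obtain r where r: "r \<in> St" "sec r x = inv_H ?q"
    using avoids_empty[OF x, of "inv_H ?q"] q unfolding avoids_def by auto
  let ?n = "inv_H p \<cdot> n \<cdot> p"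
  have n': "?n \<in> St" "sec ?n x = inv_H ?q \<cdot> sec n x' \<cdot> ?q" "sec ?n y = one_H"
    using conj_St[OF n(1) p(1)] n p y by auto
  have "?q \<cdot> (inv_H ?q \<cdot> sec n x' \<cdot> ?q) \<cdot> inv_H ?q = (?q \<cdot> inv_H ?q) \<cdot> sec n x' \<cdot> (?q \<cdot> inv_H ?q)"
    using q n(1,2) by (simp only: H.m_assoc H.m_closed H.inv_closed sec_G St_G)
  then have cancel: "?q \<cdot> (inv_H ?q \<cdot> sec n x' \<cdot> ?q) \<cdot> inv_H ?q = sec n x'"
    using q n(1,2) by simp
  have "inv_H r \<cdot> ?n \<cdot> r \<in> St" "sec (inv_H r \<cdot> ?n \<cdot> r) x = sec n x'" "sec (inv_H r \<cdot> ?n \<cdot> r) y = one_H"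
    using conj_St[OF n'(1), of r] n' r x y q n(1,2) cancel by auto
  then have "avoids x {y} (sec n x')" unfolding avoids_def by blast
  moreover from this have "avoids x {y} (inv_H (sec n x'))" using avoids_inv x y by blast
  ultimately show "avoids x {y} (a j)" using n(5) j by auto
qed (use y in auto)

text \<open>The commutator of an element that is trivial on \<open>A\<close> and one that is trivial on \<open>B\<close> is trivial on
  both.\<close>

lemma avoids_commutators:
  assumes x: "x \<in> I" and A: "A \<subseteq> I" and B: "B \<subseteq> I"
    and "\<And>g. g \<in> G \<Longrightarrow> avoids x A g" "\<And>g. g \<in> G \<Longrightarrow> avoids x B g" "k \<in> K"
  shows "avoids x (A \<union> B) k"
proof -
  let ?M = "{g. avoids x (A \<union> B) g}"
  have "K \<subseteq> ?M"
  proof (rule K_subsetI)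
    show "subgroup ?M H"
    proof (rule H.subgroupI)
      show "?M \<noteq> {}" using avoids_one[OF x] by blast
    qed (use x A B avoids_mult avoids_inv avoids_G in auto)
    fix g h assume "g \<in> G" "h \<in> G"
    with assms(4,5) obtain n n' where n: "n \<in> St" "sec n x = g" "\<forall>s\<in>A. sec n s = one_H"
      "n' \<in> St" "sec n' x = h" "\<forall>s\<in>B. sec n' s = one_H"
      unfolding avoids_def by meson
    have *: "sec (comm n n') y = comm (sec n y) (sec n' y)" if "y \<in> I" for y
      using n that by simp
    have "sec (comm n n') s = one_H" if "s \<in> A \<union> B" for s
    proof -
      have s: "s \<in> I" using that A B by auto
      from that show ?thesis
      proof
        assume "s \<in> A"
        then show ?thesis using n *[OF s] s by simp
      next
        assume "s \<in> B"
        then show ?thesis using n *[OF s] s by simp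
      qed
    qed
    then show "comm g h \<in> ?M"
      using n *[OF x] unfolding avoids_def by (auto intro!: bexI[of _ "comm n n'"])
  qed
  then show ?thesis using assms(6) by blast
qed

text \<open>The elements prescribed at single coordinates are multiplied together.\<close>

lemma fill_K:
  assumes T: "T \<subseteq> I" and K: "\<And>x k. x \<in> T \<Longrightarrow> k \<in> K \<Longrightarrow> avoids x (T - {x}) k"
    and f: "\<And>x. x \<in> T \<Longrightarrow> f x \<in> K"
  shows "\<exists>n\<in>St. \<forall>x\<in>T. sec n x = f x"
proof -
  have "finite T" using finite_subset[OF T] by simp
  have "\<exists>n\<in>St. (\<forall>x\<in>U. sec n x = f x) \<and> (\<forall>x\<in>T - U. sec n x = one_H)" if "U \<subseteq> T" for U
    using finite_subset[OF that \<open>finite T\<close>] that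
  proof (induction U rule: finite_induct)
    case empty
    then show ?case by (intro bexI[of _ one_H]) (auto simp: sec_one')
  next
    case (insert x U)
    obtain n where n: "n \<in> St" "\<forall>x\<in>U. sec n x = f x" "\<forall>x\<in>T - U. sec n x = one_H"
      using insert by auto
    obtain n' where n': "n' \<in> St" "sec n' x = f x" "\<forall>s\<in>T - {x}. sec n' s = one_H"
      using K[of x "f x"] f insert unfolding avoids_def by auto
    have G: "y \<in> T \<Longrightarrow> f y \<in> G" for y using f by auto
    have TI: "y \<in> T \<Longrightarrow> y \<in> I" for y using T by auto
    show ?case
    proof (intro bexI[of _ "n \<cdot> n'"] conjI ballI)
      fix y assume y: "y \<in> insert x U"
      show "sec (n \<cdot> n') y = f y"
      proof (cases "y = x")
        case True
        then show ?thesis using n n' insert G TI by simp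
      next
        case False
        then have "y \<in> U" "y \<in> T" using y insert by auto
        then show ?thesis using n n' False G TI by simp
      qed
    next
      fix y assume "y \<in> T - insert x U"
      then show "sec (n \<cdot> n') y = one_H" using n n' TI by simp
    qed (use n n' in simp)
  qed
  from this[of T] show ?thesis by auto
qed

text \<open>An element with the right exponents differs from the wanted one by sections in \<open>K\<close>.\<close>

lemma fill:
  assumes T: "T \<subseteq> I" and K: "\<And>x k. x \<in> T \<Longrightarrow> k \<in> K \<Longrightarrow> avoids x (T - {x}) k"
    and f: "\<And>x. x \<in> T \<Longrightarrow> f x \<in> G"
    and M: "attained M" "\<And>x i. x \<in> T \<Longrightarrow> i \<in> I \<Longrightarrow> [e i (f x) = M x i] (mod int m)"
  shows "\<exists>n\<in>St. \<forall>x\<in>T. sec n x = f x"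
proof -
  obtain n where n: "n \<in> St"
    "\<And>x i. x \<in> I \<Longrightarrow> i \<in> I \<Longrightarrow> [e i (sec n x) = M x i] (mod int m)"
    using M(1) unfolding attained_def by blast
  have TI: "y \<in> T \<Longrightarrow> y \<in> I" for y using T by auto
  have "f x \<cdot> inv_H (sec n x) \<in> K" if "x \<in> T" for x
  proof (rule K_diffI)
    show "[e i (f x) = e i (sec n x)] (mod int m)" if "i \<in> I" for i
      using cong_trans[OF M(2) cong_sym[OF n(2)]] that \<open>x \<in> T\<close> TI by blast
  qed (use f n TI that in auto)
  then obtain n' where n': "n' \<in> St" "\<forall>x\<in>T. sec n' x = f x \<cdot> inv_H (sec n x)"
    using fill_K[OF T K, of "\<lambda>x. f x \<cdot> inv_H (sec n x)"] by blast
  then have "sec (n' \<cdot> n) x = f x" if "x \<in> T" for x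
    using n(1) f that TI by (simp add: H.m_assoc)
  then show ?thesis using n(1) n'(1) by (intro bexI[of _ "n' \<cdot> n"]) auto
qed

text \<open>Induction on the size of \<open>S\<close>.  Splitting the coordinates to be avoided into two smaller sets gives
  the statement for \<open>K\<close>; an element with exponents \<open>e g\<close> in \<open>x\<close> and \<open>- e g\<close> in a coordinate
  \<open>z\<close> outside \<open>S\<close> then gives it for \<open>g\<close>.  The bound on \<open>S\<close> leaves room for \<open>z\<close>.\<close>

lemma avoids_most:
  assumes "S \<subseteq> I" "x \<in> I" "x \<notin> S" "card S \<le> d - 2" "g \<in> G"
  shows "avoids x S g"
  using assms
proof (induction "card S" arbitrary: S x g rule: less_induct)
  case less
  have fin: "finite S" using less.prems(1) finite_subset by auto
  consider "card S = 0" | "card S = 1" | "2 \<le> card S" by linarith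
  then show ?case
  proof cases
    case 1
    then show ?thesis using fin avoids_empty less.prems by auto
  next
    case 2
    then obtain y where "S = {y}" by (metis card_1_singletonE One_nat_def)
    then show ?thesis using avoids_single less.prems by auto
  next
    case 3
    let ?T = "insert x S"
    have T: "?T \<subseteq> I" "card ?T = card S + 1" using less.prems fin by auto
    have TI: "t \<in> ?T \<Longrightarrow> t \<in> I" for t using T(1) by blast
    have K: "avoids y (?T - {y}) k" if y: "y \<in> ?T" and k: "k \<in> K" for y k
    proof -
      have c: "card (?T - {y}) = card S" using T y fin by (simp add: card_Diff_singleton)
      then have "?T - {y} \<noteq> {}" using 3 by (metis card.empty not_numeral_le_zero)
      then obtain t where t: "t \<in> ?T - {y}" by blast
      let ?A = "?T - {y} - {t}"
      have "card ?A < card S" using c t fin 3 by (simp add: card_Diff_singleton)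
      then have "\<And>g. g \<in> G \<Longrightarrow> avoids y ?A g"
        using less.hyps[of ?A y] less.prems(4) T(1) TI[OF y] by (meson Diff_iff Diff_subset dual_order.trans insertI1 less_imp_le subset_trans)
      moreover have "\<And>g. g \<in> G \<Longrightarrow> avoids y {t} g"
        using avoids_single[of y t] TI[OF y] t TI[of t] by blast
      ultimately have "avoids y (?A \<union> {t}) k"
        using T(1) TI t y k by (intro avoids_commutators) auto
      moreover have "?A \<union> {t} = ?T - {y}" using t by auto
      ultimately show ?thesis by simp
    qed
    have "card ?T < d" using T(2) less.prems(4) d4 by linarith
    then obtain z where z: "z \<in> I" "z \<notin> ?T" using exists_outside[of ?T] fin by blast
    let ?M = "\<lambda>y i. (if y = x then e i g else 0) - (if y = z then e i g else 0)"
    have M: "attained ?M"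
      by (rule attained_balanced) (use z less.prems(2) in \<open>simp add: sum_subtractf\<close>)
    have "\<exists>n\<in>St. \<forall>y\<in>?T. sec n y = (if y = x then g else one_H)"
    proof (rule fill[OF T(1) K _ M])
      show "(if y = x then g else one_H) \<in> G" for y using less.prems(5) by simp
      show "[e i (if y = x then g else one_H) = ?M y i] (mod int m)" if "y \<in> ?T" for y i
        using z that by auto
    qed
    then show ?thesis unfolding avoids_def using less.prems(3) by auto
  qed
qed

text \<open>The last step, in which every other coordinate is avoided, is the commutator argument alone.\<close>

lemma avoids_K:
  assumes x: "x \<in> I" and k: "k \<in> K"
  shows "avoids x (I - {x}) k"
proof -
  have "card {x} < d" using d3 by simp
  then obtain y where y: "y \<in> I" "y \<notin> {x}" using exists_outside[of "{x}"] by auto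
  have "card (I - {x} - {y}) = d - 2" using x y by (simp add: card_Diff_singleton)
  then have "\<And>g. g \<in> G \<Longrightarrow> avoids x (I - {x} - {y}) g"
    using x avoids_most[of "I - {x} - {y}" x] by auto
  moreover have "\<And>g. g \<in> G \<Longrightarrow> avoids x {y} g" using avoids_single[of x y] x y by auto
  ultimately have "avoids x ((I - {x} - {y}) \<union> {y}) k"
    using x y k by (intro avoids_commutators) auto
  moreover have "(I - {x} - {y}) \<union> {y} = I - {x}" using y by auto
  ultimately show ?thesis by simp
qed

lemma tuple_realized:
  assumes "\<And>x. x \<in> I \<Longrightarrow> f x \<in> G" "attained (\<lambda>x i. e i (f x))"
  shows "\<exists>n\<in>St. \<forall>x\<in>I. sec n x = f x"
  by (rule fill[OF _ avoids_K _ assms(2)]) (use assms(1) in auto)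

end

section \<open>Just infiniteness for four or more letters\<close>

definition at_child :: "nat \<Rightarrow> (nat list \<Rightarrow> nat list) \<Rightarrow> nat list \<Rightarrow> nat list"
  where "at_child x k = (\<lambda>w. case w of [] \<Rightarrow> [] | y # u \<Rightarrow> if y = x then y # k u else w)"

text \<open>The element \<open>k\<close> transplanted below the vertex \<open>v\<close>.\<close>

primrec at_vertex :: "nat list \<Rightarrow> (nat list \<Rightarrow> nat list) \<Rightarrow> nat list \<Rightarrow> nat list"
  where
    "at_vertex [] k = k"
  | "at_vertex (x # v) k = at_child x (at_vertex v k)"

lemma at_child_comp: "at_child x (l \<circ> k) = at_child x l \<circ> at_child x k"
  by (auto simp: at_child_def fun_eq_iff split: list.splits)

lemma at_child_id: "at_child x id = id"
  by (auto simp: at_child_def fun_eq_iff split: list.splits)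

lemma at_vertex_comp: "at_vertex v (l \<circ> k) = at_vertex v l \<circ> at_vertex v k"
  by (induction v) (simp_all only: at_vertex.simps at_child_comp)

lemma at_vertex_id: "at_vertex v id = id"
  by (induction v) (simp_all only: at_vertex.simps at_child_id)

lemma at_vertex_below: "k [] = [] \<Longrightarrow> at_vertex v k (v @ w) = v @ k w"
  by (induction v) (auto simp: at_child_def)

lemma at_vertex_elsewhere: "k [] = [] \<Longrightarrow> (\<And>u. w \<noteq> v @ u) \<Longrightarrow> at_vertex v k w = w"
proof (induction v arbitrary: w)
  case Nil
  then show ?case by auto
next
  case (Cons x v)
  then show ?case by (cases w) (auto simp: at_child_def)
qed

context hanoi begin

lemma G_Nil [simp]: "g \<in> G \<Longrightarrow> g [] = []"
  using G_tree[of g] by (simp add: tree_aut_def)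

text \<open>An element of \<open>St\<close> with a single nontrivial section is a transplanted element.\<close>

lemma at_child_eqI:
  assumes n: "n \<in> St" and x: "x \<in> I" and "\<And>y. y \<in> I \<Longrightarrow> y \<noteq> x \<Longrightarrow> sec n y = one_H"
  shows "n = at_child x (sec n x)"
proof
  fix v
  have T: "n \<in> carrier (tree_aut d)" "sec n x \<in> carrier (tree_aut d)" using n x by (auto intro: G_tree)
  show "n v = at_child x (sec n x) v"
  proof (cases v)
    case Nil
    then show ?thesis using n by (simp add: at_child_def)
  next
    case (Cons y u)
    show ?thesis
    proof (cases "v \<in> vertices d")
      case True
      then have "y \<in> I" "u \<in> vertices d" using Cons by auto
      then have "n v = y # sec n y u" using tree_aut_Cons(1)[OF T(1)] Cons n by simp
      then show ?thesis using assms(3)[of y] \<open>y \<in> I\<close> Cons by (auto simp: at_child_def H_one')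
    next
      case False
      then have "n v = v" by (rule tree_aut_off[OF T(1)])
      moreover have "sec n x u = u" if "y = x"
        using False that x Cons by (intro tree_aut_off[OF T(2)]) auto
      ultimately show ?thesis using Cons by (auto simp: at_child_def)
    qed
  qed
qed

lemma at_child_mult: "at_child x (k \<cdot> l) = at_child x k \<cdot> at_child x l"
  by (simp add: H_mult' at_child_comp)

lemma at_child_one: "at_child x one_H = one_H"
  by (simp add: H_one' at_child_id)

lemma level_transitive:
  assumes "u \<in> vertices d" "v \<in> vertices d" "length u = length v"
  shows "\<exists>g\<in>G. g u = v"
  using assms
proof (induction u arbitrary: v)
  case Nil
  then show ?case by (intro bexI[of _ one_H]) auto
next
  case (Cons x u)
  then obtain y w where v: "v = y # w" "y \<in> I" "w \<in> vertices d" "length u = length w"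
    by (cases v) auto
  then obtain g where g: "g \<in> G" "g u = w" using Cons by blast
  obtain p where p: "p \<in> G" "rt p x = y" "sec p x = one_H" using path[OF Cons.hyps(1) v(2)] by blast
  obtain h where h: "h \<in> G" "rt h y = y" "sec h y = g" using fractal[OF g(1) v(2)] by blast
  have "(p \<cdot> h) (x # u) = rt (p \<cdot> h) x # sec (p \<cdot> h) x u"
    using tree_aut_Cons(1)[OF G_tree[of "p \<cdot> h"]] p h Cons.hyps by simp
  also have "\<dots> = v" using p h g v Cons.hyps by (simp add: rt_mult sec_mult')
  finally show ?case using p h by (intro bexI[of _ "p \<cdot> h"]) auto
qed

text \<open>Sections map the stabilizer of a letter, a proper subset, onto the whole group.\<close>

lemma G_infinite: "infinite G"
proof
  assume fin: "finite G"
  have 1: "1 \<in> I" using d3 by (simp add: atLeastAtMost_iff)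
  let ?F = "{g \<in> G. rt g 1 = 1}"
  have "G \<subseteq> (\<lambda>g. sec g 1) ` ?F" using fractal[OF _ 1] by blast
  then have "card G \<le> card ?F" using fin by (intro surj_card_le) auto
  moreover obtain g where g: "g \<in> G" "rt g 1 = after 1 1" using path[OF 1 after_I] by metis
  have "rt g 1 \<noteq> 1" using g(2) after_inj[OF 1, of 1 0] after_0[OF 1] d3 by simp
  then have "g \<notin> ?F" by simp
  with g(1) have "?F \<noteq> G" by metis
  then have "?F \<subset> G" by (simp add: psubset_eq Collect_conj_eq)
  then have "card ?F < card G" by (rule psubset_card_mono[OF fin])
  ultimately show False by simp
qed

text \<open>A finite set of representatives, stated without cosets so that it can be transported through
  sections.\<close>

definition finite_index :: "(nat list \<Rightarrow> nat list) set \<Rightarrow> bool"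
  where "finite_index M \<longleftrightarrow> (\<exists>R. finite R \<and> R \<subseteq> G \<and> (\<forall>g\<in>G. \<exists>r\<in>R. g \<cdot> inv_H r \<in> M))"

lemma finite_indexI:
  assumes "finite (F ` G)" "\<And>g h. g \<in> G \<Longrightarrow> h \<in> G \<Longrightarrow> F g = F h \<Longrightarrow> g \<cdot> inv_H h \<in> M"
  shows "finite_index M"
proof -
  let ?r = "\<lambda>y. inv_into G F y"
  show ?thesis
    unfolding finite_index_def
  proof (intro exI[of _ "?r ` F ` G"] conjI ballI)
    show "?r ` F ` G \<subseteq> G" by (auto intro: inv_into_into)
    fix g assume "g \<in> G"
    then show "\<exists>r\<in>?r ` F ` G. g \<cdot> inv_H r \<in> M"
      using assms(2)[of g "?r (F g)"] by (auto simp: inv_into_into f_inv_into_f)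
  qed (use assms(1) in simp)
qed

lemma prod_cancel:
  assumes "g \<in> G" "h \<in> G" "r \<in> G"
  shows "(g \<cdot> inv_H r) \<cdot> inv_H (h \<cdot> inv_H r) = g \<cdot> inv_H h"
proof -
  have "(g \<cdot> inv_H r) \<cdot> inv_H (h \<cdot> inv_H r) = g \<cdot> (inv_H r \<cdot> r) \<cdot> inv_H h"
    using assms by (simp only: H.inv_mult_group H.inv_inv H.m_assoc H.m_closed H.inv_closed)
  then show ?thesis using assms by simp
qed

text \<open>Such an element is determined up to \<open>N\<close> by its root permutation and the classes of its sections.\<close>

lemma finite_index_sections:
  assumes M: "\<And>x. x \<in> I \<Longrightarrow> subgroup (M x) H" "\<And>x. x \<in> I \<Longrightarrow> finite_index (M x)"
    and N: "\<And>n. n \<in> St \<Longrightarrow> (\<And>x. x \<in> I \<Longrightarrow> sec n x \<in> M x) \<Longrightarrow> n \<in> N"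
  shows "finite_index N"
proof -
  have "\<exists>R. \<forall>x\<in>I. finite (R x) \<and> R x \<subseteq> G \<and> (\<forall>g\<in>G. \<exists>r\<in>R x. g \<cdot> inv_H r \<in> M x)"
    using M(2) unfolding finite_index_def by (intro bchoice) blast
  then obtain R where R': "\<forall>x\<in>I. finite (R x) \<and> R x \<subseteq> G \<and> (\<forall>g\<in>G. \<exists>r\<in>R x. g \<cdot> inv_H r \<in> M x)" ..
  then have R: "\<And>x. x \<in> I \<Longrightarrow> finite (R x)" "\<And>x. x \<in> I \<Longrightarrow> R x \<subseteq> G"
    "\<And>x g. x \<in> I \<Longrightarrow> g \<in> G \<Longrightarrow> \<exists>r\<in>R x. g \<cdot> inv_H r \<in> M x" by simp_all
  define r where "r x g = (SOME r. r \<in> R x \<and> g \<cdot> inv_H r \<in> M x)" for x g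
  have r: "r x g \<in> R x" "g \<cdot> inv_H (r x g) \<in> M x" if "x \<in> I" "g \<in> G" for x g
    using someI_ex[of "\<lambda>r. r \<in> R x \<and> g \<cdot> inv_H r \<in> M x"] R(3)[OF that] unfolding r_def by blast+
  let ?F = "\<lambda>g. (rt g, \<lambda>x\<in>I. r x (sec g x))"
  show ?thesis
  proof (rule finite_indexI[of ?F])
    have "?F ` G \<subseteq> {p. p permutes I} \<times> (\<Pi>\<^sub>E x\<in>I. R x)"
      using r(1) by (auto intro: rt_permutes)
    moreover have "finite ({p. p permutes I} \<times> (\<Pi>\<^sub>E x\<in>I. R x))"
      using R(1) by (intro finite_cartesian_product finite_permutations finite_PiE) auto
    ultimately show "finite (?F ` G)" using finite_subset by blast
    fix g h assume g: "g \<in> G" and h: "h \<in> G" and F: "?F g = ?F h"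
    then have rt: "rt g = rt h" by simp
    show "g \<cdot> inv_H h \<in> N"
    proof (rule N)
      show "g \<cdot> inv_H h \<in> St" using g h by (intro StI) (auto simp: rt_mult rt rt_inv)
      fix x assume x: "x \<in> I"
      have "(\<lambda>x\<in>I. r x (sec g x)) x = (\<lambda>x\<in>I. r x (sec h x)) x" using F by (simp only: prod.inject)
      then have eq: "r x (sec g x) = r x (sec h x)" using x by simp
      have "r x (sec g x) \<in> G" using r(1)[OF x, of "sec g x"] R(2)[OF x] g x by auto
      then have "(sec g x \<cdot> inv_H (r x (sec g x))) \<cdot> inv_H (sec h x \<cdot> inv_H (r x (sec h x))) = sec g x \<cdot> inv_H (sec h x)"
        using g h x eq by (simp add: prod_cancel)
      moreover have "(sec g x \<cdot> inv_H (r x (sec g x))) \<cdot> inv_H (sec h x \<cdot> inv_H (r x (sec h x))) \<in> M x"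
        by (rule subgroup.m_closed[OF M(1)[OF x] r(2)[OF x] subgroup.m_inv_closed[OF M(1)[OF x] r(2)[OF x]]])
          (use g h x in simp_all)
      moreover have "sec (g \<cdot> inv_H h) x = sec g x \<cdot> inv_H (sec h x)"
        using g h x sec_inv[OF h x] by (simp add: sec_mult' rt)
      ultimately show "sec (g \<cdot> inv_H h) x \<in> M x" by simp
    qed
  qed
qed

lemma finite_index_K: "finite_index K"
proof (rule finite_indexI[of "\<lambda>g. \<lambda>i\<in>I. e i g"])
  have "e i g \<in> {0..<int m}" if "g \<in> G" for i g
    using e_mod[OF that, of i] m2 pos_mod_sign[of "int m" "e i g"] pos_mod_bound[of "int m" "e i g"]
    by simp
  then have "(\<lambda>g. \<lambda>i\<in>I. e i g) ` G \<subseteq> (\<Pi>\<^sub>E i\<in>I. {0..<int m})" by auto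
  then show "finite ((\<lambda>g. \<lambda>i\<in>I. e i g) ` G)"
    by (rule finite_subset) (auto intro: finite_PiE)
  fix g h assume gh: "g \<in> G" "h \<in> G" and eq: "(\<lambda>i\<in>I. e i g) = (\<lambda>i\<in>I. e i h)"
  show "g \<cdot> inv_H h \<in> K"
  proof (rule K_diffI[OF gh])
    show "[e i g = e i h] (mod int m)" if "i \<in> I" for i
      using fun_cong[OF eq, of i] that by simp
  qed
qed

lemma finite_quotient:
  assumes "N \<lhd> H" "finite_index N"
  shows "finite (carrier (H Mod N))"
proof -
  interpret N: normal N H by fact
  obtain R where R: "finite R" "R \<subseteq> G" "\<And>g. g \<in> G \<Longrightarrow> \<exists>r\<in>R. g \<cdot> inv_H r \<in> N"
    using assms(2) unfolding finite_index_def by blast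
  have "carrier (H Mod N) \<subseteq> (\<lambda>r. N #>\<^bsub>H\<^esub> r) ` R"
  proof
    fix C assume "C \<in> carrier (H Mod N)"
    then obtain g where g: "g \<in> G" "C = N #>\<^bsub>H\<^esub> g" by (auto simp: FactGroup_def RCOSETS_def)
    obtain r where r: "r \<in> R" "g \<cdot> inv_H r \<in> N" using R(3)[OF g(1)] by blast
    have rG: "r \<in> G" using r R(2) by blast
    have "N #>\<^bsub>H\<^esub> g = N #>\<^bsub>H\<^esub> (g \<cdot> inv_H r \<cdot> r)" using g rG by (simp add: H.m_assoc)
    also have "\<dots> = (N #>\<^bsub>H\<^esub> (g \<cdot> inv_H r)) #>\<^bsub>H\<^esub> r"
      using g rG by (intro H.coset_mult_assoc[symmetric] N.subset) auto
    also have "\<dots> = N #>\<^bsub>H\<^esub> r" using H.coset_join2[OF _ N.subgroup_axioms r(2)] g rG by simp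
    finally show "C \<in> (\<lambda>r. N #>\<^bsub>H\<^esub> r) ` R" using g r by blast
  qed
  then show ?thesis using R(1) finite_surj by blast
qed

text \<open>An element of \<open>St\<close> is the product of its transplanted sections.\<close>

lemma St_decompose:
  assumes M: "subgroup M H" and n: "n \<in> St" and at: "\<And>x. x \<in> I \<Longrightarrow> at_child x (sec n x) \<in> M"
  shows "n \<in> M"
proof -
  interpret M: subgroup M H by fact
  have at_St: "at_child x (sec n x) \<in> St \<and> sec (at_child x (sec n x)) y = (if y = x then sec n x else one_H)"
    if x: "x \<in> I" and y: "y \<in> I" for x y
  proof -
    have g: "at_child x (sec n x) \<in> G" using at[OF x] M.subset by auto
    have "at_child x (sec n x) [z] = [z]" for z using n x by (simp add: at_child_def)
    then have "rt (at_child x (sec n x)) = id" by (auto simp: root_perm_def)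
    with g show ?thesis by (auto intro: StI simp: tree_section_def at_child_def fun_eq_iff H_one' n x split: list.splits)
  qed
  have "\<exists>m\<in>M \<inter> St. \<forall>y\<in>I. sec m y = (if y \<in> U then sec n y else one_H)" if "finite U" "U \<subseteq> I" for U
    using that
  proof (induction U rule: finite_induct)
    case empty
    show ?case by (intro bexI[of _ one_H]) (auto simp: sec_one')
  next
    case (insert x U)
    then obtain k where k: "k \<in> M" "k \<in> St" "\<forall>y\<in>I. sec k y = (if y \<in> U then sec n y else one_H)" by auto
    then show ?case using at_St[of x] at[of x] insert n
      by (intro bexI[of _ "k \<cdot> at_child x (sec n x)"]) auto
  qed
  from this[of I] obtain k where "k \<in> M" "k \<in> St" "\<forall>y\<in>I. sec k y = sec n y" by auto
  then show ?thesis using St_eqI[of k n] n by auto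
qed

lemma section_subgroup:
  assumes M: "subgroup M H" and x: "x \<in> I"
  shows "subgroup {h \<in> G. at_child x h \<in> M} H"
proof (rule H.subgroupI)
  interpret M: subgroup M H by fact
  show "{h \<in> G. at_child x h \<in> M} \<noteq> {}" 
    using at_child_one[of x] M.one_closed H.one_closed by (intro ex_in_conv[THEN iffD1] exI[of _ one_H]) simp
  show "g \<cdot> h \<in> {h \<in> G. at_child x h \<in> M}"
    if "g \<in> {h \<in> G. at_child x h \<in> M}" "h \<in> {h \<in> G. at_child x h \<in> M}" for g h
    using that by (simp add: at_child_mult)
  show "inv_H h \<in> {h \<in> G. at_child x h \<in> M}" if h: "h \<in> {h \<in> G. at_child x h \<in> M}" for h
  proof -
    have hG: "h \<in> G" "at_child x h \<in> G" using h M.subset by auto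
    have *: "inv_H (at_child x h) \<circ> at_child x h = id"
      using H.r_inv[OF hG(2)] by (simp add: H_mult' H_one')
    have "at_child x h \<circ> at_child x (inv_H h) = id"
      using H.l_inv[OF hG(1)] at_child_comp[of x h "inv_H h"] by (simp add: H_mult' H_one' at_child_id)
    then have "at_child x (inv_H h) = inv_H (at_child x h)"
      using * by (metis comp_assoc comp_id id_comp)
    then show ?thesis using h hG by simp
  qed
qed auto

end

context hanoi4 begin

text \<open>The exponents add up over the sections, and there is only one nontrivial section.\<close>

lemma at_child_K:
  assumes "x \<in> I" "k \<in> K"
  shows "at_child x k \<in> K"
proof -
  obtain n where n: "n \<in> St" "sec n x = k" "\<forall>y\<in>I - {x}. sec n y = one_H"
    using avoids_K[OF assms] unfolding avoids_def by blast
  then have "n = at_child x k" using at_child_eqI[of n x] assms(1) by auto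
  moreover have "n \<in> K"
    unfolding K_iff
  proof (intro conjI ballI)
    fix i assume i: "i \<in> I"
    have "e i (sec n y) = 0" if "y \<in> I" for y
      using n K_e[OF assms(2) i] that by (cases "y = x") auto
    then show "[e i n = 0] (mod int m)" using e_sections[of n i] n(1) by (simp add: cong_sym)
  qed (use n in auto)
  ultimately show ?thesis by simp
qed

lemma at_vertex_K: "v \<in> vertices d \<Longrightarrow> k \<in> K \<Longrightarrow> at_vertex v k \<in> K"
  by (induction v) (auto intro: at_child_K)

lemma at_vertex_comm:
  assumes v: "v \<in> vertices d" and k: "k \<in> K" and l: "l \<in> K"
  shows "at_vertex v (comm k l) = comm (at_vertex v k) (at_vertex v l)"
proof -
  have mult: "at_vertex v (g \<cdot> h) = at_vertex v g \<cdot> at_vertex v h" for g h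
    by (simp add: H_mult' at_vertex_comp)
  have inv: "at_vertex v (inv_H g) = inv_H (at_vertex v g)" if g: "g \<in> K" for g
  proof -
    have "inv_H g \<in> K" using g subgroup.m_inv_closed[OF K_subgroup] by blast
    then have "at_vertex v (inv_H g) \<in> G" "at_vertex v g \<in> G" using at_vertex_K[OF v] g by auto
    moreover have "at_vertex v (inv_H g) \<cdot> at_vertex v g = one_H"
      using g by (simp flip: mult) (simp add: H_one' at_vertex_id)
    ultimately show ?thesis using H.inv_equality by metis
  qed
  show ?thesis using k l by (simp add: mult inv)
qed

lemma commute_disjoint:
  assumes "inj f" "\<And>w. w \<in> T \<Longrightarrow> f w = w" "\<And>w. w \<notin> T \<Longrightarrow> h w = w" "\<And>w. w \<in> T \<Longrightarrow> h w \<in> T"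
  shows "f \<cdot> h = h \<cdot> f"
  unfolding H_mult'
proof
  fix w
  show "(h \<circ> f) w = (f \<circ> h) w"
  proof (cases "w \<in> T")
    case True
    then show ?thesis using assms(2,4) by simp
  next
    case False
    have "f w \<notin> T" using assms(1,2) False by (metis injD)
    then show ?thesis using assms(3) False by simp
  qed
qed

text \<open>If \<open>g\<close> moves \<open>v\<close>, then conjugation by \<open>g\<close> carries an element living below \<open>v\<close> away from there.
  So in the commutator of \<open>g\<close> with such an element only one factor is seen by a second element
  living below \<open>v\<close>.\<close>

lemma normal_contains_commutators:
  assumes N: "N \<lhd> H" and g: "g \<in> N" and v: "v \<in> vertices d" and moved: "g v \<noteq> v"
    and k: "k \<in> K" and l: "l \<in> K"
  shows "at_vertex v (comm k l) \<in> N"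
proof -
  interpret N: normal N H by fact
  have gG: "g \<in> G" using g N.subset by auto
  let ?k = "at_vertex v k" and ?l = "at_vertex v l"
  have kl: "?k \<in> G" "?l \<in> G" using at_vertex_K[OF v] k l by auto
  let ?T = "{v @ u | u. True}"
  define p where "p = g \<cdot> inv_H ?k \<cdot> inv_H g"
  have p: "p \<in> G" using gG kl by (simp add: p_def)
  \<comment> \<open>\<open>p\<close> acts below the preimage of \<open>v\<close> only, so it commutes with everything below \<open>v\<close>.\<close>
  have p_fix: "p w = w" if "w \<in> ?T" for w
  proof (cases "w \<in> vertices d")
    case True
    from that obtain u where w: "w = v @ u" by blast
    with True have u: "w = v @ u" "u \<in> vertices d" by simp_all
    obtain u' where u': "g w = g v @ u'" using tree_aut_append[OF G_tree[OF gG] v u(2)] u by auto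
    have "length (g v) = length v" using tree_aut_length[OF G_tree[OF gG] v] .
    then have "\<And>t. g w \<noteq> v @ t" using u' moved by auto
    then have "?k (g w) = g w" using at_vertex_elsewhere[of k] k by auto
    moreover have "inv_H ?k (?k (g w)) = g w"
      using fun_cong[OF H.r_inv[OF kl(1), unfolded H_mult' H_one'], of "g w"] by simp
    ultimately have "inv_H ?k (g w) = g w" by simp
    moreover have "inv_H g (g w) = w"
      using fun_cong[OF H.r_inv[OF gG, unfolded H_mult' H_one'], of w] by simp
    ultimately show ?thesis by (simp add: p_def H_mult')
  next
    case False
    then show ?thesis using tree_aut_off[OF G_tree[OF p]] by simp
  qed
  have p_comm: "p \<cdot> h = h \<cdot> p" if "h = at_vertex v t" "t [] = []" for h t
  proof (rule commute_disjoint[where T = ?T])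
    show "inj p" using G_tree[OF p] by (auto simp: tree_aut_def intro: permutes_inj)
    show "h w = w" if "w \<notin> ?T" for w
      using at_vertex_elsewhere[of t w v] \<open>h = _\<close> \<open>t [] = []\<close> that by auto
    show "h w \<in> ?T" if "w \<in> ?T" for w
      using at_vertex_below[of t v] \<open>h = _\<close> \<open>t [] = []\<close> that by auto
  qed (rule p_fix)
  define q where "q = p \<cdot> ?k"
  have q: "q \<in> N"
  proof -
    have "inv_H ?k \<cdot> inv_H g \<cdot> ?k \<in> N" using N.inv_op_closed1[OF kl(1)] g by simp
    then have "g \<cdot> (inv_H ?k \<cdot> inv_H g \<cdot> ?k) \<in> N" using g by simp
    then show ?thesis using gG kl by (simp add: q_def p_def H.m_assoc)
  qed
  have "?l \<cdot> inv_H q \<cdot> inv_H ?l \<in> N" using N.inv_op_closed2[OF kl(2)] q by simp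
  with q have "q \<cdot> (?l \<cdot> inv_H q \<cdot> inv_H ?l) \<in> N" by (rule N.m_closed)
  moreover have "q \<in> G" using p kl by (simp add: q_def)
  ultimately have "comm q ?l \<in> N" using kl by (simp add: H.m_assoc)
  moreover have "comm q ?l = comm ?k ?l"
  proof -
    have "at_vertex v (k \<cdot> l \<cdot> inv_H k) = ?k \<cdot> ?l \<cdot> inv_H ?k"
    proof -
      have "at_vertex v (inv_H k) = inv_H ?k"
      proof (rule H.inv_equality[symmetric])
        show "at_vertex v (inv_H k) \<cdot> ?k = one_H"
          using k by (simp add: H_mult' at_vertex_comp[symmetric]) (metis H.l_inv H_mult' H_one' K_G at_vertex_id)
        show "at_vertex v (inv_H k) \<in> G"
          using at_vertex_K[OF v] subgroup.m_inv_closed[OF K_subgroup k] by auto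
      qed (rule kl)
      then show ?thesis by (simp add: H_mult' at_vertex_comp)
    qed
    then have "p \<cdot> (?k \<cdot> ?l \<cdot> inv_H ?k) = (?k \<cdot> ?l \<cdot> inv_H ?k) \<cdot> p"
      using p_comm[of _ "k \<cdot> l \<cdot> inv_H k"] k l by simp
    moreover have "comm q ?l = p \<cdot> (?k \<cdot> ?l \<cdot> inv_H ?k) \<cdot> inv_H p \<cdot> inv_H ?l"
      using p kl by (simp add: q_def H.inv_mult_group H.m_assoc)
    ultimately have "comm q ?l = (?k \<cdot> ?l \<cdot> inv_H ?k) \<cdot> p \<cdot> inv_H p \<cdot> inv_H ?l" by simp
    also have "\<dots> = (?k \<cdot> ?l \<cdot> inv_H ?k) \<cdot> (p \<cdot> inv_H p) \<cdot> inv_H ?l"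
      using p kl by (simp only: H.m_assoc H.m_closed H.inv_closed)
    finally show ?thesis using p kl by simp
  qed
  ultimately show ?thesis using at_vertex_comm[OF v k l] by simp
qed

text \<open>For given \<open>g\<close> and \<open>h\<close> choose elements of \<open>K\<close> with sections \<open>g\<close>, \<open>inv g\<close> in coordinates
  \<open>x\<close>, \<open>y\<close> and \<open>h\<close>, \<open>inv h\<close> in coordinates \<open>x\<close>, \<open>z\<close>.  Their commutator has the
  commutator of \<open>g\<close> and \<open>h\<close> in coordinate \<open>x\<close> and nothing else.\<close>

lemma commutators_finite_index:
  assumes M: "subgroup M H" and comm: "\<And>k l. k \<in> K \<Longrightarrow> l \<in> K \<Longrightarrow> comm k l \<in> M"
  shows "finite_index M"
proof -
  interpret M: subgroup M H by fact
  have pair: "\<exists>k\<in>K \<inter> St. sec k x = g \<and> (\<forall>z\<in>I - {x, y}. sec k z = one_H)"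
    if "x \<in> I" "y \<in> I" "x \<noteq> y" "g \<in> G" for x y g
  proof -
    let ?f = "\<lambda>z. if z = x then g else if z = y then inv_H g else one_H"
    have s: "[(\<Sum>z\<in>I. e i (?f z)) = 0] (mod int m)" for i
    proof -
      have "(\<Sum>z\<in>I. e i (?f z)) = (\<Sum>z\<in>I. (if z = x then e i g else 0) + (if z = y then e i (inv_H g) else 0))"
        using that by (intro sum.cong) auto
      then have "(\<Sum>z\<in>I. e i (?f z)) = e i g + e i (inv_H g)" using that by (simp add: sum.distrib)
      then show ?thesis using e_mult[of g "inv_H g" i] that by (simp add: cong_sym)
    qed
    have "attained (\<lambda>z i. e i (?f z))" using s by (rule attained_balanced)
    then have "\<exists>n\<in>St. \<forall>z\<in>I. sec n z = ?f z"
      by (rule tuple_realized[rotated]) (use that(4) in simp)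
    then obtain k where k: "k \<in> St" "\<forall>z\<in>I. sec k z = ?f z" by blast
    have "k \<in> K" unfolding K_iff
    proof (intro conjI ballI)
      fix i
      have "(\<Sum>z\<in>I. e i (sec k z)) = (\<Sum>z\<in>I. e i (?f z))" using k by (intro sum.cong) auto
      then show "[e i k = 0] (mod int m)"
        using e_sections[of k i] s[of i] k(1) by (metis St_G cong_sym cong_trans)
    qed (use k in simp)
    then show ?thesis using k that by (intro bexI[of _ k]) auto
  qed
  let ?M = "\<lambda>x. {h \<in> G. at_child x h \<in> M}"
  have K_sub: "K \<subseteq> ?M x" if x: "x \<in> I" for x
  proof (rule K_subsetI)
    show "subgroup (?M x) H"
      by (rule section_subgroup[OF M x])
    fix g h assume g: "g \<in> G" and h: "h \<in> G"
    have "card {x} < d" using d3 by simp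
    then obtain y where y: "y \<in> I" "y \<noteq> x" using exists_outside[of "{x}"] by auto
    have "card {x, y} < d" using d3 y by simp
    then obtain z where z: "z \<in> I" "z \<noteq> x" "z \<noteq> y" using exists_outside[of "{x, y}"] by auto
    obtain k where k: "k \<in> K" "k \<in> St" "sec k x = g" "\<forall>t\<in>I - {x, y}. sec k t = one_H"
      using pair[OF x y(1) y(2)[symmetric] g] by blast
    obtain l where l: "l \<in> K" "l \<in> St" "sec l x = h" "\<forall>t\<in>I - {x, z}. sec l t = one_H"
      using pair[OF x z(1) z(2)[symmetric] h] by blast
    have s: "sec (comm k l) t = comm (sec k t) (sec l t)" if "t \<in> I" for t using k l that by simp
    have "comm k l = at_child x (sec (comm k l) x)"
    proof (rule at_child_eqI)
      show "sec (comm k l) t = one_H" if t: "t \<in> I" "t \<noteq> x" for t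
      proof (cases "t = y")
        case True
        then have "sec l t = one_H" using l z t by auto
        then show ?thesis using s[OF t(1)] k t by simp
      next
        case False
        then have "sec k t = one_H" using k t by auto
        then show ?thesis using s[OF t(1)] l t by simp
      qed
    qed (use k l x in auto)
    then have "at_child x (comm g h) = comm k l" using s[OF x] k l by simp
    then show "comm g h \<in> ?M x" using comm[OF k(1) l(1)] g h by simp
  qed
  show ?thesis
  proof (rule finite_index_sections[of "\<lambda>x. K"])
    fix n assume "n \<in> St" "\<And>x. x \<in> I \<Longrightarrow> sec n x \<in> K"
    then show "n \<in> M" using St_decompose[OF M] K_sub by blast
  qed (use K_subgroup finite_index_K in auto)
qed

text \<open>The elements that \<open>M\<close> contains in transplanted form below a given letter form a subgroup to which
  the induction hypothesis applies.\<close>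

lemma level_commutators_finite_index:
  assumes "subgroup M H"
    and "\<And>v k l. v \<in> vertices d \<Longrightarrow> length v = n \<Longrightarrow> k \<in> K \<Longrightarrow> l \<in> K \<Longrightarrow> at_vertex v (comm k l) \<in> M"
  shows "finite_index M"
  using assms
proof (induction n arbitrary: M)
  case 0
  then show ?case using commutators_finite_index[of M] by (metis at_vertex.simps(1) lists.Nil list.size(3))
next
  case (Suc n)
  let ?M = "\<lambda>x. {h \<in> G. at_child x h \<in> M}"
  have sub: "subgroup (?M x) H" if "x \<in> I" for x
    using section_subgroup[OF Suc.prems(1) that] .
  have fi: "finite_index (?M x)" if x: "x \<in> I" for x
  proof (rule Suc.IH[OF sub[OF x]])
    fix v k l assume "v \<in> vertices d" "length v = n" "k \<in> K" "l \<in> K"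
    then show "at_vertex v (comm k l) \<in> ?M x"
      using Suc.prems(2)[of "x # v" k l] at_vertex_K[of v "comm k l"] comm_K x by auto
  qed
  show ?case
    by (rule finite_index_sections[OF sub fi]) (use St_decompose[OF Suc.prems(1)] in blast)+
qed

lemma hanoi_just_infinite: "just_infinite H"
  unfolding just_infinite_def
proof (intro conjI allI impI)
  show "group H" by (rule H.is_group)
  show "infinite G" by (rule G_infinite)
  fix N assume N: "N \<lhd> H" and "N \<noteq> {one_H}"
  interpret N: normal N H by fact
  obtain g where g: "g \<in> N" "g \<noteq> one_H" using \<open>N \<noteq> {one_H}\<close> N.one_closed by blast
  have gG: "g \<in> G" using g N.subset by auto
  obtain v where v: "g v \<noteq> v" using g(2) by (auto simp: H_one' fun_eq_iff)
  then have vv: "v \<in> vertices d" using tree_aut_off[OF G_tree[OF gG]] by blast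
  have "finite_index N"
  proof (rule level_commutators_finite_index[OF N.subgroup_axioms])
    fix u k l assume u: "u \<in> vertices d" "length u = length v" and kl: "k \<in> K" "l \<in> K"
    obtain h where h: "h \<in> G" "h v = u" using level_transitive[OF vv u(1)] u(2) by auto
    have "inv_H h u = v"
      using fun_cong[OF H.r_inv[OF h(1), unfolded H_mult' H_one'], of v] h(2) by simp
    then have "(inv_H h \<cdot> g \<cdot> h) u = h (g v)" by (simp add: H_mult')
    moreover have "inj h" using G_tree[OF h(1)] by (auto simp: tree_aut_def intro: permutes_inj)
    ultimately have "(inv_H h \<cdot> g \<cdot> h) u \<noteq> u" using v h(2) by (auto dest: injD)
    moreover have "inv_H h \<cdot> g \<cdot> h \<in> N" using N.inv_op_closed1[OF h(1) g(1)] .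
    ultimately show "at_vertex u (comm k l) \<in> N"
      using normal_contains_commutators[OF N _ u(1) _ kl] by blast
  qed
  then show "finite (carrier (H Mod N))" by (rule finite_quotient[OF N])
qed

end

section \<open>Parity and the first-level stabilizer\<close>

context hanoi begin

lemma rt_permutation: "g \<in> G \<Longrightarrow> permutation (rt g)"
  using rt_permutes[of g] by (auto simp: permutation_permutes)

lemma evenperm_cycle: "i \<in> I \<Longrightarrow> evenperm (hanoi_cycle d m i) \<longleftrightarrow> odd m"
proof -
  assume i: "i \<in> I"
  have "distinct (map (after i) [1..<Suc m])"
    using after_inj[OF i] md by (simp add: distinct_map inj_on_def del: upt_Suc)
  from swapidseq_ext_imp_swapidseq[OF swapidseq_ext_of_cycles[OF this]]
  have "swapidseq (m - 1) (hanoi_cycle d m i)"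
    by (simp add: hanoi_cycle_def after_def[abs_def] del: upt_Suc)
  then show ?thesis using evenperm_unique[of "m - 1" _ "odd m"] m2 by simp
qed

lemma e_inv_cong: "g \<in> G \<Longrightarrow> [(\<Sum>i\<in>A. e i (inv_H g)) = - (\<Sum>i\<in>A. e i g)] (mod int m)"
  using cong_sum[of A "\<lambda>i. e i (inv_H g)" "\<lambda>i. - e i g" "int m"] e_inv by (simp add: sum_negf)

lemma e_mult_cong:
  "g \<in> G \<Longrightarrow> h \<in> G \<Longrightarrow> [(\<Sum>i\<in>A. e i (g \<cdot> h)) = (\<Sum>i\<in>A. e i g) + (\<Sum>i\<in>A. e i h)] (mod int m)"
  using cong_sum[of A "\<lambda>i. e i (g \<cdot> h)" "\<lambda>i. e i g + e i h" "int m"] e_mult by (simp add: sum.distrib)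

lemma cong_even: "even m \<Longrightarrow> [x = y] (mod int m) \<Longrightarrow> even x \<longleftrightarrow> even (y :: int)"
  by (meson cong_dvd_iff cong_dvd_modulus even_of_nat)

text \<open>An \<open>m\<close>-cycle is odd precisely when \<open>m\<close> is even, and then parity makes sense for exponents
  modulo \<open>m\<close>.\<close>

lemma evenperm_rt: "g \<in> G \<Longrightarrow> evenperm (rt g) \<longleftrightarrow> odd m \<or> even (\<Sum>i\<in>I. e i g)"
proof (induction g rule: G_induct)
  case one
  then show ?case by (simp add: rt_one)
next
  case (gen i)
  have "(\<Sum>j\<in>I. e j (a i)) = 1" using gen by (simp add: e_gen)
  then show ?case using evenperm_cycle[OF gen] by (simp add: rt_a)
next
  case (inv i)
  have "evenperm (rt (inv_H (a i)) \<circ> rt (a i)) \<longleftrightarrow> evenperm (rt (inv_H (a i))) = evenperm (rt (a i))"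
    using inv by (intro evenperm_comp rt_permutation) auto
  moreover have "rt (inv_H (a i)) \<circ> rt (a i) = id" using inv by (auto simp: rt_inv)
  moreover have "(\<Sum>j\<in>I. e j (a i)) = 1" using inv by (simp add: e_gen)
  ultimately show ?case
    using evenperm_cycle[OF inv] inv cong_even[OF _ e_inv_cong[of "a i" I]] by (auto simp: rt_a)
next
  case (mult g h)
  have "rt (g \<cdot> h) = rt h \<circ> rt g" using mult by (auto simp: rt_mult)
  then have "evenperm (rt (g \<cdot> h)) \<longleftrightarrow> evenperm (rt h) = evenperm (rt g)"
    using mult by (simp add: evenperm_comp rt_permutation)
  then show ?case using mult cong_even[OF _ e_mult_cong[of g h I]] by auto
qed

lemma exponents_realized: "\<exists>g\<in>G. \<forall>i\<in>I. [e i g = k i] (mod int m)"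
proof -
  let ?w = "map (\<lambda>i. (i, k i)) [1..<Suc d]"
  have w: "?w \<in> W" by (auto simp: gen_words_def atLeastAtMost_iff)
  have "word_exponent i ?w = k i" if "i \<in> I" for i
  proof -
    have "word_exponent i ?w = (\<Sum>j\<leftarrow>[1..<Suc d]. if j = i then k j else 0)"
      by (simp add: word_exponent_def o_def del: upt_Suc)
    also have "\<dots> = (\<Sum>j\<in>set [1..<Suc d]. if j = i then k j else 0)"
      by (rule sum_list_distinct_conv_sum_set) simp
    also have "\<dots> = k i" using that by (simp add: atLeastAtMost_iff del: upt_Suc)
    finally show ?thesis .
  qed
  then show ?thesis using w e_word[OF w]
    by (intro bexI[of _ "wv ?w"]) (auto simp: cong_def simp del: upt_Suc)
qed

lemma e_pow: "g \<in> G \<Longrightarrow> [e i (g [^]\<^bsub>H\<^esub> (n::nat)) = int n * e i g] (mod int m)"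
proof (induction n)
  case (Suc n)
  have "[e i (g [^]\<^bsub>H\<^esub> Suc n) = e i (g [^]\<^bsub>H\<^esub> n) + e i g] (mod int m)"
    using e_mult[of "g [^]\<^bsub>H\<^esub> n" g i] Suc.prems by simp
  also have "[e i (g [^]\<^bsub>H\<^esub> n) + e i g = int n * e i g + e i g] (mod int m)"
    using Suc by (intro cong_add) auto
  finally show ?case by (simp add: distrib_right add.commute)
qed simp

lemma St_pow: "n \<in> St \<Longrightarrow> n [^]\<^bsub>H\<^esub> (k::nat) \<in> St"
  by (induction k) auto

end

context hanoi4 begin

text \<open>The column sums of the exponent matrix of an element are its own exponents; the other direction
  corrects by a balanced matrix.\<close>

lemma attained_iff:
  "attained M \<longleftrightarrow> (\<exists>n\<in>St. \<forall>i\<in>I. [e i n = (\<Sum>x\<in>I. M x i)] (mod int m))"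
proof
  assume "attained M"
  then obtain n where n: "n \<in> St"
    "\<And>x i. x \<in> I \<Longrightarrow> i \<in> I \<Longrightarrow> [e i (sec n x) = M x i] (mod int m)"
    unfolding attained_def by blast
  have "[e i n = (\<Sum>x\<in>I. M x i)] (mod int m)" if "i \<in> I" for i
    using cong_trans[OF cong_sym[OF e_sections[of n i]] cong_sum] n that by auto
  then show "\<exists>n\<in>St. \<forall>i\<in>I. [e i n = (\<Sum>x\<in>I. M x i)] (mod int m)" using n(1) by blast
next
  assume "\<exists>n\<in>St. \<forall>i\<in>I. [e i n = (\<Sum>x\<in>I. M x i)] (mod int m)"
  then obtain n where n: "n \<in> St" "\<And>i. i \<in> I \<Longrightarrow> [e i n = (\<Sum>x\<in>I. M x i)] (mod int m)" by blast
  let ?R = "\<lambda>x i. e i (sec n x)"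
  have R: "attained ?R" by (rule attainedI[OF n(1)]) simp
  have D: "attained (\<lambda>x i. M x i - ?R x i)"
  proof (rule attained_balanced)
    fix i assume i: "i \<in> I"
    have "[(\<Sum>x\<in>I. M x i) - (\<Sum>x\<in>I. ?R x i) = e i n - e i n] (mod int m)"
      using n i e_sections[of n i] by (intro cong_diff) (auto simp: cong_sym)
    then show "[(\<Sum>x\<in>I. M x i - ?R x i) = 0] (mod int m)" by (simp add: sum_subtractf)
  qed
  from attained_add[OF R D] show "attained M" by simp
qed

lemma psi_St: "psi d ` St = {(g, id) | g. g \<in> (\<Pi>\<^sub>E x\<in>I. G) \<and> attained (\<lambda>x i. e i (g x))}"
proof (intro equalityI subsetI)
  fix p assume "p \<in> psi d ` St"
  then obtain n where n: "n \<in> St" "p = psi d n" by blast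
  have "attained (\<lambda>x i. e i ((\<lambda>x\<in>I. sec n x) x))" by (rule attainedI[OF n(1)]) simp
  then show "p \<in> {(g, id) | g. g \<in> (\<Pi>\<^sub>E x\<in>I. G) \<and> attained (\<lambda>x i. e i (g x))}"
    using n by (auto simp: psi_def)
next
  fix p assume "p \<in> {(g, id :: nat \<Rightarrow> nat) | g. g \<in> (\<Pi>\<^sub>E x\<in>I. G) \<and> attained (\<lambda>x i. e i (g x))}"
  then obtain g where g: "p = (g, id)" "g \<in> (\<Pi>\<^sub>E x\<in>I. G)" "attained (\<lambda>x i. e i (g x))" by blast
  then obtain n where n: "n \<in> St" "\<forall>x\<in>I. sec n x = g x" using tuple_realized[of g] by auto
  have "(\<lambda>x\<in>I. sec n x) = g" using g(2) n(2) by (intro extensionalityI[of _ I]) (auto simp: PiE_def)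
  then have "psi d n = p" using n g(1) by (simp add: psi_def)
  then show "p \<in> psi d ` St" using n(1) by blast
qed

text \<open>With two spare letters a 3-cycle is a commutator of two 3-cycles that share one letter.\<close>

lemma has_cycle_K_large:
  assumes "5 \<le> d" "distinct [x, y, z]" "{x, y, z} \<subseteq> I"
  shows "has_cycle K x y z"
proof -
  have "card {x, y, z} < d" using assms by (simp add: card_insert_if)
  then obtain u where u: "u \<in> I" "u \<notin> {x, y, z}" using exists_outside[of "{x, y, z}"] by auto
  have "card {x, y, z, u} < d" using assms u by (simp add: card_insert_if)
  then obtain v where v: "v \<in> I" "v \<notin> {x, y, z, u}" using exists_outside[of "{x, y, z, u}"] by auto
  have "has_cycle G x y u" "has_cycle G y v z" using has_cycle_G[of x y u] has_cycle_G[of y v z] assms u v by auto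
  then obtain g h where g: "g \<in> G" "rt g = cycle_of_list [x, y, u]"
    and h: "h \<in> G" "rt h = cycle_of_list [y, v, z]" by (auto simp: has_cycle_def)
  have ne: "x \<noteq> y" "x \<noteq> z" "y \<noteq> z" "u \<noteq> x" "u \<noteq> y" "u \<noteq> z" "v \<noteq> x" "v \<noteq> y" "v \<noteq> z" "v \<noteq> u"
    using assms(2) u v by auto
  note ne' = ne ne[symmetric]
  have eq: "rt h (rt g w) = rt g (rt h (cycle_of_list [x, y, z] w))" for w
  proof -
    consider "w = x" | "w = y" | "w = z" | "w = u" | "w = v" | "w \<notin> {x, y, z, u, v}" by blast
    then show ?thesis unfolding g(2) h(2) by cases (use ne' in simp_all)
  qed
  have "rt (comm g h) w = cycle_of_list [x, y, z] w" for w
    using g(1) h(1) by (simp add: rt_mult eq rt_inv)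
  moreover have "comm g h \<in> K" using comm_K g h by simp
  ultimately show ?thesis using assms(2,3) unfolding has_cycle_def by blast
qed

text \<open>The fourth power of \<open>b i\<close> has even exponents, hence lies in \<open>K\<close> for \<open>m = 2\<close>, and the same root
  permutation as \<open>b i\<close>.\<close>

lemma has_cycle_K_2:
  assumes m: "m = 2" and "distinct [x, y, z]" "{x, y, z} \<subseteq> I"
  shows "has_cycle K x y z"
proof (rule has_cycle_all[OF K_subgroup has_cycle_step[OF K_subgroup]])
  fix i assume i: "i \<in> I"
  let ?x = "after i 1" and ?y = "after i (m + 1)" and ?z = "after i m"
  have G: "has_cycle G ?x ?y ?z" by (rule has_cycle_b[OF i])
  let ?g = "b i [^]\<^bsub>H\<^esub> (4::nat)"
  have gG: "?g \<in> G" using i by (intro H.nat_pow_closed b_G)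
  have "e j ?g = 0" for j
  proof -
    have "[int 4 * e j (b i) = 0] (mod int m)" using m by (simp add: cong_0_iff)
    with e_pow[OF b_G[OF i], of j 4] have "[e j ?g = e j one_H] (mod int m)"
      unfolding e_one by (rule cong_trans)
    from e_eqI[OF gG H.one_closed this] show ?thesis unfolding e_one .
  qed
  then have "?g \<in> K" using gG unfolding K_def by blast
  moreover have "rt ?g = cycle_of_list [?x, ?y, ?z]"
  proof -
    have "rt (b i) ^^ 3 = id"
      using cycle_is_id_root[of "[?x, ?y, ?z]"] G by (simp add: rt_b[OF i] has_cycle_def numeral_eq_Suc)
    then have "rt (b i) ^^ 4 = rt (b i)" by (simp add: numeral_eq_Suc)
    then show ?thesis using i by (simp add: rt_pow rt_b[OF i])
  qed
  ultimately show "has_cycle K ?x ?y ?z" using G unfolding has_cycle_def by blast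
qed (use assms in auto)

text \<open>The pair \<open>(4, 3)\<close> is a genuine exception: there the root permutations of \<open>K\<close> are the Klein
  four-group.\<close>

lemma alt_K:
  assumes "\<not> (d = 4 \<and> m = 3)" "\<tau> \<in> carrier (alt_group d)"
  shows "\<exists>c\<in>K. rt c = \<tau>"
proof (rule alt_realized[OF K_subgroup _ assms(2)])
  fix x y z assume xyz: "distinct [x, y, z]" "{x, y, z} \<subseteq> I"
  consider "5 \<le> d" | "m = 2" using d4 md m2 assms(1) by linarith
  then show "has_cycle K x y z" using has_cycle_K_large has_cycle_K_2 xyz by cases auto
qed

lemma rt_alt: "g \<in> G \<Longrightarrow> rt g \<in> carrier (alt_group d) \<longleftrightarrow> evenperm (rt g)"
  using rt_permutes by (simp add: alt_group_carrier)

text \<open>An element with even root permutation can be corrected by an element of \<open>K\<close>, which has no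
  exponents, to lie in \<open>St\<close>.\<close>

lemma attained_iff_even:
  assumes "\<not> (d = 4 \<and> m = 3)"
  shows "attained M \<longleftrightarrow> odd m \<or> even (\<Sum>i\<in>I. \<Sum>x\<in>I. M x i)"
proof
  assume "attained M"
  then obtain n where n: "n \<in> St" "\<And>i. i \<in> I \<Longrightarrow> [e i n = (\<Sum>x\<in>I. M x i)] (mod int m)"
    unfolding attained_iff by blast
  have "[(\<Sum>i\<in>I. e i n) = (\<Sum>i\<in>I. \<Sum>x\<in>I. M x i)] (mod int m)" using n(2) by (rule cong_sum)
  moreover have "odd m \<or> even (\<Sum>i\<in>I. e i n)" using evenperm_rt[of n] n(1) by simp
  ultimately show "odd m \<or> even (\<Sum>i\<in>I. \<Sum>x\<in>I. M x i)" using cong_even by blast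
next
  assume *: "odd m \<or> even (\<Sum>i\<in>I. \<Sum>x\<in>I. M x i)"
  obtain h where h: "h \<in> G" "\<And>i. i \<in> I \<Longrightarrow> [e i h = (\<Sum>x\<in>I. M x i)] (mod int m)"
    using exponents_realized[of "\<lambda>i. \<Sum>x\<in>I. M x i"] by blast
  have "[(\<Sum>i\<in>I. e i h) = (\<Sum>i\<in>I. \<Sum>x\<in>I. M x i)] (mod int m)" using h(2) by (rule cong_sum)
  then have "evenperm (rt h)" using * evenperm_rt[OF h(1)] cong_even by blast
  then obtain k where k: "k \<in> K" "rt k = rt h" using alt_K[OF assms] rt_alt[OF h(1)] by blast
  have "h \<cdot> inv_H k \<in> St" using h k(1) by (intro StI) (auto simp: rt_mult rt_inv fun_eq_iff simp flip: k(2))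
  moreover have "[e i (h \<cdot> inv_H k) = (\<Sum>x\<in>I. M x i)] (mod int m)" if "i \<in> I" for i
    using cong_trans[OF e_prod_inv[of h k i]] h k K_e[OF k(1) that] that by simp
  ultimately show "attained M" unfolding attained_iff by blast
qed

lemma psi_St_even:
  assumes "even m"
  shows "psi d ` St = {(g, id) | g. g \<in> (\<Pi>\<^sub>E x\<in>I. G) \<and> [(\<Sum>x\<in>I. \<Sum>i\<in>I. e i (g x)) = 0] (mod 2)}"
proof -
  have "\<not> (d = 4 \<and> m = 3)" using assms by auto
  from attained_iff_even[OF this] assms
  have "attained (\<lambda>x i. e i (g x)) \<longleftrightarrow> [(\<Sum>x\<in>I. \<Sum>i\<in>I. e i (g x)) = 0] (mod 2)" for g
    using sum.swap[of "\<lambda>i x. e i (g x)" I I] by (simp add: cong_0_iff)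
  then show ?thesis unfolding psi_St by simp
qed

lemma psi_St_odd:
  assumes "odd m" "5 \<le> d"
  shows "psi d ` St = {(g, id) | g. g \<in> (\<Pi>\<^sub>E x\<in>I. G)}"
  unfolding psi_St using attained_iff_even assms by auto

lemma psi_G_odd:
  assumes "odd m" "5 \<le> d"
  shows "psi d ` G = carrier (perm_semidirect d H (alt_group d))"
proof (intro equalityI subsetI)
  fix p assume "p \<in> psi d ` G"
  then show "p \<in> carrier (perm_semidirect d H (alt_group d))"
    using rt_alt evenperm_rt assms(1) by (auto simp: psi_def perm_semidirect_def)
next
  fix p assume "p \<in> carrier (perm_semidirect d H (alt_group d))"
  then obtain f \<tau> where p: "p = (f, \<tau>)" "f \<in> (\<Pi>\<^sub>E x\<in>I. G)" "\<tau> \<in> carrier (alt_group d)"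
    by (auto simp: perm_semidirect_def)
  obtain k where k: "k \<in> K" "rt k = \<tau>" using alt_K p(3) assms(2) by auto
  have kG: "k \<in> G" using k by simp
  let ?f = "\<lambda>x\<in>I. f x \<cdot> inv_H (sec k x)"
  have "?f \<in> (\<Pi>\<^sub>E x\<in>I. G)" using p(2) kG by auto
  then have "(?f, id) \<in> psi d ` St" unfolding psi_St_odd[OF assms] by blast
  then obtain n where n: "n \<in> St" "psi d n = (?f, id)" by auto
  then have sec: "sec n x = f x \<cdot> inv_H (sec k x)" if "x \<in> I" for x
  proof -
    have "(\<lambda>x\<in>I. sec n x) = ?f" using n(2) by (simp add: psi_def)
    from fun_cong[OF this, of x] that show ?thesis by simp
  qed
  have "f x \<in> G" if "x \<in> I" for x using p(2) that by auto
  then have "sec (n \<cdot> k) x = f x" if "x \<in> I" for x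
    using that n(1) kG by (simp add: sec H.m_assoc)
  then have "(\<lambda>x\<in>I. sec (n \<cdot> k) x) = f" using p(2) by (intro extensionalityI[of _ I]) (auto simp: PiE_def)
  moreover have "rt (n \<cdot> k) = \<tau>" using n(1) kG k(2) by (auto simp: rt_mult)
  ultimately have "psi d (n \<cdot> k) = p" using p(1) by (simp add: psi_def)
  then show "p \<in> psi d ` G" using n(1) kG by (intro image_eqI[of _ _ "n \<cdot> k"]) auto
qed

end

section \<open>The case of four letters and three-cycles\<close>

lemma hanoi_cycle_4_3:
  "hanoi_cycle 4 3 1 1 = 1" "hanoi_cycle 4 3 1 2 = 3" "hanoi_cycle 4 3 1 3 = 4" "hanoi_cycle 4 3 1 4 = 2"
  "hanoi_cycle 4 3 2 1 = 3" "hanoi_cycle 4 3 2 2 = 2" "hanoi_cycle 4 3 2 3 = 4" "hanoi_cycle 4 3 2 4 = 1"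
  "hanoi_cycle 4 3 3 1 = 2" "hanoi_cycle 4 3 3 2 = 4" "hanoi_cycle 4 3 3 3 = 3" "hanoi_cycle 4 3 3 4 = 1"
  "hanoi_cycle 4 3 4 1 = 2" "hanoi_cycle 4 3 4 2 = 3" "hanoi_cycle 4 3 4 3 = 1" "hanoi_cycle 4 3 4 4 = 4"
  by code_simp+

lemma hanoi_cycle_3_2:
  "hanoi_cycle 3 2 1 1 = 1" "hanoi_cycle 3 2 1 2 = 3" "hanoi_cycle 3 2 1 3 = 2"
  "hanoi_cycle 3 2 2 1 = 3" "hanoi_cycle 3 2 2 2 = 2" "hanoi_cycle 3 2 2 3 = 1"
  "hanoi_cycle 3 2 3 1 = 2" "hanoi_cycle 3 2 3 2 = 1" "hanoi_cycle 3 2 3 3 = 3"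
  by code_simp+

lemma interval_1_4: "{1..4} = {1, 2, 3, 4 :: nat}" by auto

lemma interval_1_3: "{1..3} = {1, 2, 3 :: nat}" by auto

context hanoi begin

lemma I_4: "d = 4 \<Longrightarrow> I = {1, 2, 3, 4}" and I_3: "d = 3 \<Longrightarrow> I = {1, 2, 3}"
  by (simp_all only: interval_1_4 interval_1_3)

definition alt_exponent :: "(nat list \<Rightarrow> nat list) \<Rightarrow> int"
  where "alt_exponent g = (\<Sum>i\<in>I. (-1) ^ (i - 1) * e i g)"

lemma alt_exponent_mult:
  "g \<in> G \<Longrightarrow> h \<in> G \<Longrightarrow> [alt_exponent (g \<cdot> h) = alt_exponent g + alt_exponent h] (mod int m)"
proof -
  assume g: "g \<in> G" and h: "h \<in> G"
  have "[alt_exponent (g \<cdot> h) = (\<Sum>i\<in>I. (-1) ^ (i - 1) * (e i g + e i h))] (mod int m)"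
    unfolding alt_exponent_def using e_mult[OF g h] by (intro cong_sum cong_mult) auto
  then show ?thesis by (simp add: alt_exponent_def distrib_left sum.distrib)
qed

lemma alt_exponent_gen: "i \<in> I \<Longrightarrow> alt_exponent (a i) = (-1) ^ (i - 1)"
  by (simp add: alt_exponent_def e_gen if_distrib[of "\<lambda>t. _ * t"] cong: if_cong)

text \<open>The three partitions of \<open>1, 2, 3, 4\<close> into two pairs, labelled by the negative of the distance
  of the sum of a pair from 5: a pair and its complement have sums that add up to 10.\<close>

definition pairing :: "nat \<Rightarrow> nat \<Rightarrow> int"
  where "pairing x y = - \<bar>int x + int y - 5\<bar>"

text \<open>The generators rotate the three partitions, alternately in the two directions.  This is the
  abelianization of \<open>Alt(4)\<close>.\<close>

lemma pairing_shift:
  assumes dm: "d = 4" "m = 3" and "g \<in> G" "x \<in> I" "y \<in> I" "x \<noteq> y"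
  shows "[pairing (rt g x) (rt g y) = pairing x y + alt_exponent g] (mod 3)"
  using assms(3-6)
proof (induction g arbitrary: x y rule: G_induct)
  case one
  have "alt_exponent one_H = 0" by (simp add: alt_exponent_def)
  then show ?case by (simp add: rt_one)
next
  case (gen i)
  then have "i \<in> {1, 2, 3, 4}" "x \<in> {1, 2, 3, 4}" "y \<in> {1, 2, 3, 4}"
    unfolding I_4[OF dm(1)] by simp_all
  moreover have "rt (a i) = hanoi_cycle 4 3 i" using rt_a[of i] by (simp add: dm)
  ultimately show ?case using gen(4) unfolding alt_exponent_gen[OF gen(1)]
    by (elim insertE emptyE) (simp_all add: hanoi_cycle_4_3 pairing_def cong_def)
next
  case (inv i)
  have cyc: "hanoi_cycle d m = hanoi_cycle 4 3" by (simp only: dm)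
  let ?x = "rt (inv_H (a i)) x" and ?y = "rt (inv_H (a i)) y"
  have xy: "?x \<in> {1, 2, 3, 4}" "?y \<in> {1, 2, 3, 4}" "?x \<noteq> ?y" "i \<in> {1, 2, 3, 4}"
    using inv by (simp_all flip: I_4[OF dm(1)])
  have r: "x = hanoi_cycle 4 3 i ?x" "y = hanoi_cycle 4 3 i ?y"
    using inv rt_inv(2)[of "a i"] rt_a[of i, unfolded cyc] by simp_all
  have "[pairing (hanoi_cycle 4 3 i ?x) (hanoi_cycle 4 3 i ?y) = pairing ?x ?y + alt_exponent (a i)] (mod 3)"
    unfolding alt_exponent_gen[OF inv(1)] using xy
    by (elim insertE emptyE) (simp_all add: hanoi_cycle_4_3 pairing_def cong_def)
  then have 1: "[pairing x y = pairing ?x ?y + alt_exponent (a i)] (mod 3)"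
    by (simp only: r[symmetric])
  have "[alt_exponent (inv_H (a i) \<cdot> a i) = alt_exponent (inv_H (a i)) + alt_exponent (a i)] (mod 3)"
  proof -
    have "int m = 3" by (simp only: dm of_nat_numeral)
    from alt_exponent_mult[of "inv_H (a i)" "a i", unfolded this] inv show ?thesis by blast
  qed
  then have "[0 = alt_exponent (inv_H (a i)) + alt_exponent (a i)] (mod 3)"
    using inv by (simp add: alt_exponent_def)
  then have 2: "[alt_exponent (inv_H (a i)) + alt_exponent (a i) = 0] (mod 3)" by (rule cong_sym)
  have "[pairing x y + alt_exponent (inv_H (a i)) =
      pairing ?x ?y + (alt_exponent (inv_H (a i)) + alt_exponent (a i))] (mod 3)"
    using cong_add[OF 1 cong_refl[of "alt_exponent (inv_H (a i))"]] by (simp add: algebra_simps)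
  also have "[pairing ?x ?y + (alt_exponent (inv_H (a i)) + alt_exponent (a i)) = pairing ?x ?y + 0] (mod 3)"
    using 2 by (rule cong_add[OF cong_refl])
  finally show ?case by (simp add: cong_sym)
next
  case (mult g h)
  have "[pairing (rt h (rt g x)) (rt h (rt g y)) = pairing (rt g x) (rt g y) + alt_exponent h] (mod 3)"
    using mult by auto
  also have "[pairing (rt g x) (rt g y) + alt_exponent h = pairing x y + alt_exponent g + alt_exponent h] (mod 3)"
    using mult by (intro cong_add) auto
  also have "[pairing x y + alt_exponent g + alt_exponent h = pairing x y + alt_exponent (g \<cdot> h)] (mod 3)"
    using cong_add[OF cong_refl[of "pairing x y"] cong_sym[OF alt_exponent_mult[of g h]]] mult
    by (simp add: dm add.assoc)
  finally show ?case using mult by (simp add: rt_mult)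
qed

end

context hanoi4 begin

text \<open>The square of \<open>a i \<cdot> a (i + 1)\<close> fixes the first level; its own square has the exponents
  \<open>4\<close>, which is \<open>1\<close> modulo 3.\<close>

lemma adjacent_exponents:
  assumes dm: "d = 4" "m = 3" and i: "i \<in> {1, 2, 3}"
  shows "\<exists>q\<in>St. \<forall>j\<in>I. [e j q = (if j = i \<or> j = i + 1 then 1 else 0)] (mod int m)"
proof -
  let ?u = "a i \<cdot> a (i + 1)"
  have iI: "i \<in> I" "i + 1 \<in> I" using i dm by (auto simp: atLeastAtMost_iff)
  have u: "?u \<in> G" using iI by simp
  have cyc: "hanoi_cycle d m = hanoi_cycle 4 3" by (simp only: dm)
  have "rt ?u (rt ?u x) = x" for x
  proof (cases "x \<in> I")
    case True
    then have x: "x \<in> {1, 2, 3, 4}" unfolding I_4[OF dm(1)] .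
    have "rt ?u y = hanoi_cycle 4 3 (i + 1) (hanoi_cycle 4 3 i y)" for y
      using rt_mult[of "a i" "a (i + 1)" y] rt_a[of i, unfolded cyc] rt_a[of "i + 1", unfolded cyc] iI by simp
    then show ?thesis using x i
      by (elim insertE emptyE) (simp_all add: hanoi_cycle_4_3 eval_nat_numeral(2)[symmetric])
  next
    case False
    then show ?thesis using root_perm_off[OF G_tree[OF u]] by simp
  qed
  then have uu: "?u \<cdot> ?u \<in> St" using u by (intro StI) (auto simp: rt_mult)
  have "[e j (?u \<cdot> ?u \<cdot> (?u \<cdot> ?u)) = (if j = i \<or> j = i + 1 then 1 else 0)] (mod int m)" for j
  proof -
    have 1: "[e j ?u = (if j = i \<or> j = i + 1 then 1 else 0)] (mod int m)"
      using e_mult[of "a i" "a (i + 1)" j] iI by (auto simp: e_gen split: if_splits)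
    have "[e j (?u \<cdot> ?u \<cdot> (?u \<cdot> ?u)) = e j ?u + e j ?u + (e j ?u + e j ?u)] (mod int m)"
      using cong_trans[OF e_mult[of "?u \<cdot> ?u" "?u \<cdot> ?u" j] cong_add[OF e_mult[OF u u] e_mult[OF u u]]] u by simp
    also have "[e j ?u + e j ?u + (e j ?u + e j ?u) = 4 * e j ?u] (mod int m)" by simp
    also have "[4 * e j ?u = 1 * e j ?u] (mod int m)" by (rule cong_mult) (simp_all add: cong_def dm)
    also have "[1 * e j ?u = (if j = i \<or> j = i + 1 then 1 else 0)] (mod int m)" using 1 by simp
    finally show ?thesis .
  qed
  then show ?thesis using uu by (intro bexI[of _ "?u \<cdot> ?u \<cdot> (?u \<cdot> ?u)"]) auto
qed

text \<open>The exponent vectors with vanishing alternating sum are spanned by the three vectors of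
  \<open>adjacent_exponents\<close>; conversely \<open>pairing_shift\<close> makes the alternating sum vanish on \<open>St\<close>.\<close>

lemma attained_iff_4_3:
  assumes dm: "d = 4" "m = 3"
  shows "attained M \<longleftrightarrow> [(\<Sum>i\<in>I. (-1) ^ (i - 1) * (\<Sum>x\<in>I. M x i)) = 0] (mod 3)"
proof
  assume "attained M"
  then obtain n where n: "n \<in> St" "\<And>i. i \<in> I \<Longrightarrow> [e i n = (\<Sum>x\<in>I. M x i)] (mod int m)"
    unfolding attained_iff by blast
  have "1 \<in> I" "2 \<in> I" using dm by (auto simp: atLeastAtMost_iff)
  then have "[pairing 1 2 = pairing 1 2 + alt_exponent n] (mod 3)"
    using pairing_shift[OF dm, of n 1 2] n(1) by simp
  then have "[alt_exponent n = 0] (mod 3)" by (simp add: cong_iff_dvd_diff)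
  moreover have "[alt_exponent n = (\<Sum>i\<in>I. (-1) ^ (i - 1) * (\<Sum>x\<in>I. M x i))] (mod int m)"
    unfolding alt_exponent_def using n(2) by (intro cong_sum cong_mult) auto
  ultimately show "[(\<Sum>i\<in>I. (-1) ^ (i - 1) * (\<Sum>x\<in>I. M x i)) = 0] (mod 3)"
    using cong_trans[OF cong_sym] by (simp add: dm(2))
next
  define v where "v i = (\<Sum>x\<in>I. M x i)" for i
  assume "[(\<Sum>i\<in>I. (-1) ^ (i - 1) * (\<Sum>x\<in>I. M x i)) = 0] (mod 3)"
  then have "[(\<Sum>i\<in>I. (-1) ^ (i - 1) * v i) = 0] (mod 3)" by (simp only: v_def)
  then have "[v 1 - v 2 + v 3 - v 4 = 0] (mod 3)"
    unfolding I_4[OF dm(1)] by (simp add: algebra_simps)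
  then have v4: "[v 3 - v 2 + v 1 = v 4] (mod int m)" by (simp add: cong_iff_dvd_diff dm algebra_simps)
  have "1 \<in> {1, 2, 3::nat}" "2 \<in> {1, 2, 3::nat}" "3 \<in> {1, 2, 3::nat}" by auto
  from this[THEN adjacent_exponents[OF dm]] obtain q1 q2 q3 where
    q: "q1 \<in> St" "q2 \<in> St" "q3 \<in> St"
    and e1: "\<And>j. j \<in> I \<Longrightarrow> [e j q1 = (if j = 1 \<or> j = 1 + 1 then 1 else 0)] (mod int m)"
    and e2: "\<And>j. j \<in> I \<Longrightarrow> [e j q2 = (if j = 2 \<or> j = 2 + 1 then 1 else 0)] (mod int m)"
    and e3: "\<And>j. j \<in> I \<Longrightarrow> [e j q3 = (if j = 3 \<or> j = 3 + 1 then 1 else 0)] (mod int m)" by blast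
  let ?p = "\<lambda>q k. q [^]\<^bsub>H\<^esub> nat (k mod int m)"
  have pow: "[e j (?p q k) = k * t] (mod int m)" if "q \<in> St" "[e j q = t] (mod int m)" for q k j t
  proof -
    have "[e j (?p q k) = (k mod int m) * e j q] (mod int m)"
      using e_pow[of q j "nat (k mod int m)"] that(1) m2 by simp
    also have "[(k mod int m) * e j q = k * t] (mod int m)"
      using that(2) by (intro cong_mult) auto
    finally show ?thesis .
  qed
  define n where "n = ?p q1 (v 1) \<cdot> ?p q2 (v 2 - v 1) \<cdot> ?p q3 (v 3 - v 2 + v 1)"
  have n: "n \<in> St" using q by (simp add: n_def St_pow)
  have en: "[e j n = v 1 * (if j = 1 \<or> j = 1 + 1 then 1 else 0) + (v 2 - v 1) * (if j = 2 \<or> j = 2 + 1 then 1 else 0)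
      + (v 3 - v 2 + v 1) * (if j = 3 \<or> j = 3 + 1 then 1 else 0)] (mod int m)" if "j \<in> I" for j
  proof -
    let ?g = "?p q1 (v 1)" and ?h = "?p q2 (v 2 - v 1)" and ?k = "?p q3 (v 3 - v 2 + v 1)"
    have G: "?g \<in> G" "?h \<in> G" "?k \<in> G" using q by simp_all
    have "[e j n = e j (?g \<cdot> ?h) + e j ?k] (mod int m)"
      unfolding n_def using G by (intro e_mult) auto
    also have "[e j (?g \<cdot> ?h) + e j ?k = e j ?g + e j ?h + e j ?k] (mod int m)"
      using G by (intro cong_add e_mult) auto
    finally show ?thesis
      using cong_add[OF cong_add[OF pow[OF q(1) e1[OF that]] pow[OF q(2) e2[OF that]]] pow[OF q(3) e3[OF that]]]
        cong_trans by blast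
  qed
  have "[e j n = v j] (mod int m)" if j: "j \<in> I" for j
  proof -
    have "j \<in> {1, 2, 3, 4}" using j unfolding I_4[OF dm(1)] .
    then consider "j = 1" | "j = 2" | "j = 3" | "j = 4" by auto
    then show ?thesis using en[OF j] v4 cong_trans by cases auto
  qed
  then show "attained M" unfolding attained_iff v_def using n by blast
qed

lemma psi_St_4_3:
  assumes "d = 4" "m = 3"
  shows "psi d ` St = {(g, id) | g. g \<in> (\<Pi>\<^sub>E x\<in>I. G) \<and>
    [(\<Sum>x\<in>I. \<Sum>i\<in>I. (-1) ^ (i - 1) * e i (g x)) = 0] (mod 3)}"
proof -
  have "attained (\<lambda>x i. e i (g x)) \<longleftrightarrow> [(\<Sum>x\<in>I. \<Sum>i\<in>I. (-1) ^ (i - 1) * e i (g x)) = 0] (mod 3)" for g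
    unfolding attained_iff_4_3[OF assms] using sum.swap[of "\<lambda>i x. (-1) ^ (i - 1) * e i (g x)" I I]
    by (simp add: sum_distrib_left)
  then show ?thesis unfolding psi_St by simp
qed

end

section \<open>The group on three letters\<close>

context hanoi begin

text \<open>The image of a word at \<open>0\<close> in the infinite dihedral group in which \<open>a 1\<close> and \<open>a 2\<close> are the
  reflections \<open>t \<mapsto> - t\<close> and \<open>t \<mapsto> 1 - t\<close> of the integers, \<open>a 3\<close> is the identity, and the
  last syllable acts first.  All three being of order at most 2, only the parity of a syllable matters.\<close>

primrec translation :: "(nat \<times> int) list \<Rightarrow> int"
  where
    "translation [] = 0"
  | "translation (p # w) = (if odd (snd p) then
      (if fst p = 1 then - translation w else if fst p = 2 then 1 - translation w else translation w)
      else translation w)"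

text \<open>The linear part of the image in the same dihedral group.\<close>

definition orientation :: "(nat \<times> int) list \<Rightarrow> int"
  where "orientation w = (\<Prod>p\<leftarrow>w. if odd (snd p) \<and> fst p \<in> {1, 2} then -1 else 1)"

lemma orientation_simps [simp]:
  "orientation [] = 1"
  "orientation (p # w) = (if odd (snd p) \<and> fst p \<in> {1, 2} then -1 else 1) * orientation w"
  "orientation (u @ w) = orientation u * orientation w"
  by (simp_all add: orientation_def)

lemma orientation_square [simp]: "orientation w * orientation w = 1"
  by (induction w) auto

lemma translation_append [simp]: "translation (u @ w) = translation u + orientation u * translation w"
  by (induction u) auto

lemma orientation_inv_word [simp]: "orientation (inv_word w) = orientation w"
  by (induction w) (auto simp: inv_word_def)

lemma translation_inv_word [simp]: "translation (inv_word w) = - orientation w * translation w"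
proof (induction w)
  case (Cons p w)
  have "inv_word (p # w) = inv_word w @ [(fst p, - snd p)]" by (simp add: inv_word_def)
  then show ?case using Cons by (auto simp: algebra_simps)
qed (simp add: inv_word_def)

text \<open>A first syllable that is an odd power of \<open>a i\<close> swaps two of the section words of the rest and
  multiplies the third by the syllable.  Both sides change in the same way.\<close>

lemma translation_sections:
  assumes dm: "d = 3" "m = 2" and "w \<in> W"
  shows "translation w = translation (section_word 1 w) + translation (section_word 2 w) - translation (section_word 3 w)"
  using assms(3)
proof (induction w)
  case (Cons p w)
  obtain i k where p: "p = (i, k)" by (cases p)
  have cyc: "hanoi_cycle d m = hanoi_cycle 3 2" by (simp only: dm)
  have rt: "rt (a j [^]\<^bsub>H\<^esub> k) x = (if odd k then hanoi_cycle 3 2 j x else x)" if "j \<in> I" for j x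
  proof -
    have "k mod int m = (if odd k then 1 else 0)"
      unfolding dm(2) by (simp add: odd_iff_mod_2_eq_one even_iff_mod_2_eq_zero)
    then have "a j [^]\<^bsub>H\<^esub> k = (if odd k then a j else one_H)"
      using a_int_pow[OF that, of k] that by (simp add: One_nat_def)
    then show ?thesis using rt_a[of j] by (simp add: rt_one cyc)
  qed
  have I: "1 \<in> I" "2 \<in> I" "3 \<in> I" unfolding I_3[OF dm(1)] by simp_all
  have "i \<in> {1, 2, 3}" using Cons.prems p by (simp flip: I_3[OF dm(1)])
  then consider "i = 1" | "i = 2" | "i = 3" by blast
  then show ?case
    by cases (use Cons p I in \<open>simp_all add: rt hanoi_cycle_3_2\<close>)
qed simp

lemma trivial_word_translation:
  assumes dm: "d = 3" "m = 2" and "w \<in> W" "wv w = one_H"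
  shows "translation w = 0"
  using assms(3,4)
proof (induction w rule: trivial_word_induct)
  case (single i k)
  then show ?case by (simp add: dm(2))
next
  case (merge i k l w)
  then show ?case by (auto split: if_splits)
next
  case (sections w)
  have "1 \<in> I" "2 \<in> I" "3 \<in> I" using dm by (auto simp: atLeastAtMost_iff)
  then show ?case using translation_sections[OF dm sections(1)] sections(3) by simp
qed simp

text \<open>The kernel of the action on the integers contains \<open>a 3\<close>, and \<open>a 1 \<cdot> a 2\<close> acts as a
  translation, none of whose positive powers is in the kernel.\<close>

lemma not_just_infinite:
  assumes dm: "d = 3" "m = 2"
  shows "\<not> just_infinite H"
proof
  assume ji: "just_infinite H"
  let ?N = "{wv w | w. w \<in> W \<and> translation w = 0 \<and> orientation w = 1}"
  have NI: "wv w \<in> ?N" if "w \<in> W" "translation w = 0" "orientation w = 1" for w using that by blast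
  have N: "?N \<lhd> H"
    unfolding H.normal_inv_iff
  proof (intro conjI ballI)
    show "subgroup ?N H"
    proof (rule H.subgroupI)
      show "?N \<noteq> {}" using NI[of "[]"] by auto
      show "?N \<subseteq> G" by auto
      show "inv_H g \<in> ?N" if "g \<in> ?N" for g
        using that NI[of "inv_word _"] inv_word by fastforce
      show "g \<cdot> h \<in> ?N" if gh: "g \<in> ?N" "h \<in> ?N" for g h
      proof -
        obtain u w where "g = wv u" "u \<in> W" "translation u = 0" "orientation u = 1"
          "h = wv w" "w \<in> W" "translation w = 0" "orientation w = 1" using gh by blast
        then show ?thesis using NI[of "u @ w"] by (simp add: wv_append)
      qed
    qed
    fix x n assume x: "x \<in> G" and n: "n \<in> ?N"
    obtain u where u: "u \<in> W" "wv u = x" using G_word[OF x] by blast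
    obtain w where w: "n = wv w" "w \<in> W" "translation w = 0" "orientation w = 1" using n by blast
    have "translation (u @ w @ inv_word u) = translation u - (orientation u * orientation u) * translation u"
      using w by simp
    then have t: "translation (u @ w @ inv_word u) = 0" unfolding orientation_square by simp
    have "wv (u @ w @ inv_word u) \<in> ?N"
      by (rule NI) (use u w t inv_word[OF u(1)] in simp_all)
    then show "x \<cdot> n \<cdot> inv_H x \<in> ?N"
      using u w inv_word[OF u(1)] x by (simp add: wv_append H.m_assoc)
  qed
  interpret N: normal ?N H by (rule N)
  let ?Q = "H Mod ?N"
  interpret Q: group ?Q by (rule N.factorgroup_is_group)
  have I: "1 \<in> I" "2 \<in> I" "3 \<in> I" using dm by (auto simp: atLeastAtMost_iff)
  have "a 3 = wv [(3, 1)]" using I by simp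
  then have "a 3 \<in> ?N" using NI[of "[(3, 1)]"] I by simp
  moreover have "a 3 \<noteq> one_H" using e_gen[OF I(3), of 3] by auto
  ultimately have "?N \<noteq> {one_H}" by auto
  then have fin: "finite (carrier ?Q)" using ji N unfolding just_infinite_def by blast
  let ?w = "\<lambda>k. concat (replicate k [(1, 1), (2, 1 :: int)])"
  have w: "?w k \<in> W" "orientation (?w k) = 1" "translation (?w k) = - int k" for k
    using I by (induction k) auto
  let ?b = "a 1 \<cdot> a 2"
  have bG: "?b \<in> G" using I by simp
  have wb: "wv (?w k) = ?b [^]\<^bsub>H\<^esub> k" for k
  proof (induction k)
    case (Suc k)
    have "wv (?w (Suc k)) = ?b \<cdot> ?b [^]\<^bsub>H\<^esub> k" using Suc I w(1)[of k] by (simp add: H.m_assoc)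
    then show ?case using H.nat_pow_Suc2[OF bG] by simp
  qed simp
  define k where "k = order ?Q"
  have k: "k > 0" using fin Q.order_gt_0_iff_finite by (simp add: k_def)
  interpret h: group_hom H ?Q "\<lambda>g. ?N #>\<^bsub>H\<^esub> g"
    by unfold_locales (rule N.r_coset_hom_Mod)
  have "?N #>\<^bsub>H\<^esub> (?b [^]\<^bsub>H\<^esub> k) = \<one>\<^bsub>?Q\<^esub>"
    using h.hom_nat_pow[OF bG, of k] Q.pow_order_eq_1[of "?N #>\<^bsub>H\<^esub> ?b"] h.hom_closed[OF bG]
    by (simp add: k_def)
  then have "?N #>\<^bsub>H\<^esub> (?b [^]\<^bsub>H\<^esub> k) = ?N" by (simp add: FactGroup_def)
  then have "?b [^]\<^bsub>H\<^esub> k \<in> ?N"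
    using H.coset_join1[OF _ _ N.subgroup_axioms] bG by blast
  then obtain w' where w': "?b [^]\<^bsub>H\<^esub> k = wv w'" "w' \<in> W" "translation w' = 0" by blast
  have "wv (?w k @ inv_word w') = one_H" "?w k @ inv_word w' \<in> W"
    using w(1)[of k] w' wb[of k] inv_word[OF w'(2)] by (simp_all add: wv_append)
  from trivial_word_translation[OF dm this(2,1)] have "int k = 0" using w[of k] w'(3) by simp
  then show False using k by simp
qed

end
theorem theorem6p9:
  fixes d m :: nat
  assumes "d \<ge> 3" and "2 \<le> m" and "m \<le> d - 1"
  shows
    "(just_infinite (hanoi_group d m) \<longleftrightarrow> d \<ge> 4)
     \<and> (even m \<and> d \<ge> 4 \<longrightarrow>
          psi d ` level_one_stabilizer d (hanoi_group d m) =
            {(g, id) | g. g \<in> (\<Pi>\<^sub>E j\<in>{1..d}. carrier (hanoi_group d m)) \<and>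
               [(\<Sum>j=1..d. \<Sum>i=1..d. gen_exponent d m i (g j)) = 0] (mod 2)})
     \<and> (odd m \<and> d \<ge> 5 \<longrightarrow>
          psi d ` level_one_stabilizer d (hanoi_group d m) =
            {(g, id) | g. g \<in> (\<Pi>\<^sub>E j\<in>{1..d}. carrier (hanoi_group d m))}
          \<and> psi d ` carrier (hanoi_group d m) =
            carrier (perm_semidirect d (hanoi_group d m) (alt_group d)))
     \<and> (d = 4 \<and> m = 3 \<longrightarrow>
          psi d ` level_one_stabilizer d (hanoi_group d m) =
            {(g, id) | g. g \<in> (\<Pi>\<^sub>E j\<in>{1..4}. carrier (hanoi_group d m)) \<and>
               [(\<Sum>j=1..4. \<Sum>i=1..4. (-1) ^ (i - 1) * gen_exponent d m i (g j)) = 0] (mod 3)})"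
proof -
  interpret hanoi d m by unfold_locales (use assms in auto)
  have ji: "just_infinite H \<longleftrightarrow> d \<ge> 4"
  proof (cases "d \<ge> 4")
    case True
    then interpret hanoi4 d m by unfold_locales
    show ?thesis using True hanoi_just_infinite by simp
  next
    case False
    then have "d = 3" "m = 2" using assms by auto
    then show ?thesis using not_just_infinite by simp
  qed
  have even: "psi d ` St = {(g, id) | g. g \<in> (\<Pi>\<^sub>E j\<in>I. G) \<and>
      [(\<Sum>j=1..d. \<Sum>i=1..d. e i (g j)) = 0] (mod 2)}" if "even m" "d \<ge> 4"
  proof -
    interpret hanoi4 d m by unfold_locales (rule that(2))
    show ?thesis by (rule psi_St_even[OF that(1)])
  qed
  have odd: "psi d ` St = {(g, id) | g. g \<in> (\<Pi>\<^sub>E j\<in>I. G)}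
      \<and> psi d ` G = carrier (perm_semidirect d H (alt_group d))" if "odd m" "d \<ge> 5"
  proof -
    interpret hanoi4 d m by unfold_locales (use that(2) in simp)
    show ?thesis using psi_St_odd[OF that] psi_G_odd[OF that] by blast
  qed
  have "psi d ` St = {(g, id) | g. g \<in> (\<Pi>\<^sub>E j\<in>{1..4}. G) \<and>
      [(\<Sum>j=1..4. \<Sum>i=1..4. (-1) ^ (i - 1) * e i (g j)) = 0] (mod 3)}" if "d = 4" "m = 3"
  proof -
    interpret hanoi4 d m by unfold_locales (use that(1) in simp)
    show ?thesis using psi_St_4_3[OF that] unfolding that(1) .
  qed
  with ji even odd show ?thesis by blast
qed

end
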